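(* For $\varepsilon>0$ consider the linear SDE on $\mathbb{R}^{n_x}\times\mathbb{R}^{n_y}=\mathbb{R}^n$ $$\begin{pmatrix} dX^\varepsilon_t \\ dY^\varepsilon_t \end{pmatrix}=B^\varepsilon\begin{pmatrix} X^\varepsilon_t \\ Y^\varepsilon_t \end{pmatrix}dt+A^\varepsilon\begin{pmatrix} dW^1_t \\ dW^2_t \end{pmatrix},\qquad B^\varepsilon=\begin{pmatrix} B_{11} & B_{12} \\ \frac{1}{\varepsilon} B_{21} & \frac{1}{\varepsilon} B_{22} \end{pmatrix},\quad A^\varepsilon=\begin{pmatrix} A_{11} & 0 \\ 0 & \frac{1}{\sqrt{\varepsilon}} A_{22} \end{pmatrix},$$ with constant real matrices $B_{11},A_{11}\in\mathbb{R}^{n_x\times n_x}$, $B_{12}\in\mathbb{R}^{n_x\times n_y}$, $B_{21}\in\mathbb{R}^{n_y\times n_x}$, $B_{22},A_{22}\in\mathbb{R}^{n_y\times n_y}$. Assume that for every $\varepsilon>0$ the matrix $B^\varepsilon$ is Hurwitz and the pair $(B^\varepsilon,A^\varepsilon)$ is controllable. Assume in addition that: 1. $B_{22}$ is Hurwitz; 2. the pair $(B_{22},A_{22})$ is controllable; 3. $B_{11}-B_{12}B_{22}^{-1}B_{21}$ is Hurwitz and the pair $(B_{11}-B_{12}B_{22}^{-1}B_{21},A_{11})$ is controllable. Then for every $x\in\mathbb{R}^{n_x}$ the conditional invariant measure $\bar\mu^\varepsilon_x$ converges, as $\varepsilon\to0$, to the Gaussian measure $\mathcal N(-B_{22}^{-1}B_{21}x,\Sigma)$,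 where $\Sigma$ is the unique positive-definite solution of the Lyapunov equation $$B_{22}\Sigma+\Sigma B_{22}^T=-A_{22}A_{22}^T.$$
   Context: $W^1,W^2$ are standard Brownian motions in $\mathbb{R}^{n_x}$, $\mathbb{R}^{n_y}$ (independent). A matrix is Hurwitz if its spectrum lies in the open left half-plane. A pair $(B,A)$ with $B\in\mathbb{R}^{m\times m}$ is controllable if $\mathrm{rank}(A,BA,B^2A,\dots,B^{m-1}A)=m$. Under the Hurwitz and controllability assumptions on $(B^\varepsilon,A^\varepsilon)$ the SDE has a unique invariant measure $\mu^\varepsilon=\mathcal N(0,K^\varepsilon)$, where $K^\varepsilon$ is the unique positive definite solution of $B^\varepsilon K^\varepsilon+K^\varepsilon(B^\varepsilon)^T=-A^\varepsilon(A^\varepsilon)^T$. Writing $K^\varepsilon$ in blocks $K^\varepsilon_{ij}$ according to $\mathbb{R}^{n_x}\times\mathbb{R}^{n_y}$, the conditional invariant measure (law of the $y$-component given the $x$-component equals $x$, under $\mu^\varepsilon$) is $$\bar\mu^\varepsilon_x=\mathcal N\bigl(K^\varepsilon_{21}(K^\varepsilon_{11})^{-1}x,\ K^\varepsilon_{22}-K^\varepsilon_{21}(K^\varepsilon_{11})^{-1}K^\varepsilon_{12}\bigr).$$ Convergence of these Gaussian measures means convergence of means and covariances (equivalently here, weak convergence). *)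

theory Defs
  imports "HOL-Probability.Probability"
begin

section \<open>Matrices\<close>

definition complex_eigenvalue :: "real^'n^'n \<Rightarrow> complex \<Rightarrow> bool" where
  "complex_eigenvalue B l \<longleftrightarrow> (\<exists>v::complex^'n. v \<noteq> 0 \<and> map_matrix complex_of_real B *v v = l *s v)"

definition hurwitz :: "real^'n^'n \<Rightarrow> bool" where
  "hurwitz B \<longleftrightarrow> (\<forall>l. complex_eigenvalue B l \<longrightarrow> Re l < 0)"

text \<open>
  The \<open>m \<times> m\<^sup>2\<close> matrix \<open>(A, BA, \<dots>, B\<^sup>m\<^sup>-\<^sup>1A)\<close>. Its columns are indexed by pairs (block, column within
  the block); \<open>to_nat_on UNIV\<close> is a bijection from the finite index type onto \<open>{..<m}\<close>, so that every
  power below \<open>m\<close> occurs in exactly one block. The order of the blocks is immaterial for the rank.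
\<close>

definition controllability_matrix :: "real^'m^'m \<Rightarrow> real^'m^'m \<Rightarrow> real^('m \<times> 'm)^'m" where
  "controllability_matrix B A =
     (\<chi> i p. ((\<lambda>P. B ** P) ^^ to_nat_on (UNIV :: 'm set) (fst p)) A $ i $ snd p)"

definition controllable :: "real^'m^'m \<Rightarrow> real^'m^'m \<Rightarrow> bool" where
  "controllable B A \<longleftrightarrow> rank (controllability_matrix B A) = CARD('m)"

definition pos_def_matrix :: "real^'n^'n \<Rightarrow> bool" where
  "pos_def_matrix K \<longleftrightarrow> transpose K = K \<and> (\<forall>v. v \<noteq> 0 \<longrightarrow> v \<bullet> (K *v v) > 0)"

definition lyapunov_solution :: "real^'n^'n \<Rightarrow> real^'n^'n \<Rightarrow> real^'n^'n \<Rightarrow> bool" where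
  "lyapunov_solution B A K \<longleftrightarrow>
     pos_def_matrix K \<and> B ** K + K ** transpose B = - (A ** transpose A)"

text \<open>The space \<open>\<real>\<^sup>m \<times> \<real>\<^sup>n = \<real>\<^sup>m\<^sup>+\<^sup>n\<close> is represented by vectors indexed by a sum type.\<close>

definition join_vec :: "real^'m \<Rightarrow> real^'n \<Rightarrow> real^('m + 'n)" where
  "join_vec x y = (\<chi> i. case i of Inl a \<Rightarrow> x $ a | Inr b \<Rightarrow> y $ b)"

definition x_part :: "real^('m + 'n::finite) \<Rightarrow> real^'m" where
  "x_part z = (\<chi> a. z $ Inl a)"

definition y_part :: "real^('m::finite + 'n) \<Rightarrow> real^'n" where
  "y_part z = (\<chi> b. z $ Inr b)"

definition block_matrix ::
  "real^'m^'m \<Rightarrow> real^'n^'m \<Rightarrow> real^'m^'n \<Rightarrow> real^'n^'n \<Rightarrow> real^('m + 'n)^('m + 'n)" where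
  "block_matrix P Q R S =
     (\<chi> i j. case i of
        Inl a \<Rightarrow> (case j of Inl c \<Rightarrow> P $ a $ c | Inr d \<Rightarrow> Q $ a $ d)
      | Inr b \<Rightarrow> (case j of Inl c \<Rightarrow> R $ b $ c | Inr d \<Rightarrow> S $ b $ d))"


section \<open>Gaussian measures and weak convergence\<close>

text \<open>Only meaningful for positive definite \<open>C\<close>, the only case used.\<close>

definition gaussian_measure :: "real^'n \<Rightarrow> real^'n^'n \<Rightarrow> (real^'n) measure" where
  "gaussian_measure m C = density lborel (\<lambda>x. ennreal
     (exp (- ((x - m) \<bullet> (matrix_inv C *v (x - m))) / 2) / sqrt ((2 * pi) ^ CARD('n) * det C)))"

definition weakly_converges ::
  "('i \<Rightarrow> (real^'n) measure) \<Rightarrow> (real^'n) measure \<Rightarrow> 'i filter \<Rightarrow> bool" where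
  "weakly_converges \<nu> \<nu>0 F \<longleftrightarrow>
     (\<forall>f :: real^'n \<Rightarrow> real. continuous_on UNIV f \<longrightarrow> bounded (range f) \<longrightarrow>
        ((\<lambda>i. integral\<^sup>L (\<nu> i) f) \<longlongrightarrow> integral\<^sup>L \<nu>0 f) F)"


section \<open>Linear stochastic differential equations with additive noise\<close>

definition brownian_motion :: "'w measure \<Rightarrow> (real \<Rightarrow> 'w \<Rightarrow> real^'n) \<Rightarrow> bool" where
  "brownian_motion M W \<longleftrightarrow>
     prob_space M \<and>
     (\<forall>t\<ge>0. W t \<in> borel_measurable M) \<and>
     (AE \<omega> in M. W 0 \<omega> = 0) \<and>
     (AE \<omega> in M. continuous_on {0..} (\<lambda>t. W t \<omega>)) \<and>
     (\<forall>s t. 0 \<le> s \<longrightarrow> s < t \<longrightarrow>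
        distr M borel (\<lambda>\<omega>. W t \<omega> - W s \<omega>) = gaussian_measure 0 (mat (t - s))) \<and>
     (\<forall>(k::nat) (t :: nat \<Rightarrow> real). 0 \<le> t 0 \<longrightarrow> (\<forall>i<k. t i < t (Suc i)) \<longrightarrow>
        prob_space.indep_vars M (\<lambda>_. borel) (\<lambda>i \<omega>. W (t (Suc i)) \<omega> - W (t i) \<omega>) {..<k})"

definition independent_processes ::
  "'w measure \<Rightarrow> (real \<Rightarrow> 'w \<Rightarrow> real^'m) \<Rightarrow> (real \<Rightarrow> 'w \<Rightarrow> real^'n) \<Rightarrow> bool" where
  "independent_processes M U V \<longleftrightarrow>
     prob_space.indep_set M
       (sets (vimage_algebra (space M) (\<lambda>\<omega>. \<lambda>t\<in>{0..}. U t \<omega>) (\<Pi>\<^sub>M t\<in>{0..}. borel)))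
       (sets (vimage_algebra (space M) (\<lambda>\<omega>. \<lambda>t\<in>{0..}. V t \<omega>) (\<Pi>\<^sub>M t\<in>{0..}. borel)))"

text \<open>
  \<open>Z\<close> solves \<open>dZ\<^sub>t = B Z\<^sub>t dt + A dW\<^sub>t\<close>, \<open>Z\<^sub>0 = z\<close>. Since \<open>A\<close> is constant, the stochastic integral
  of \<open>A\<close> up to time \<open>t\<close> is \<open>A W\<^sub>t\<close> and the equation holds pathwise.
\<close>

definition sde_solution ::
  "'w measure \<Rightarrow> (real \<Rightarrow> 'w \<Rightarrow> real^'n) \<Rightarrow> real^'n^'n \<Rightarrow> real^'n^'n \<Rightarrow> real^'n \<Rightarrow>
     (real \<Rightarrow> 'w \<Rightarrow> real^'n) \<Rightarrow> bool" where
  "sde_solution M W B A z Z \<longleftrightarrow>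
     (\<forall>t\<ge>0. Z t \<in> borel_measurable M) \<and>
     (AE \<omega> in M. continuous_on {0..} (\<lambda>t. Z t \<omega>) \<and>
        (\<forall>t\<ge>0. Z t \<omega> = z + integral {0..t} (\<lambda>s. B *v Z s \<omega>) + A *v W t \<omega>))"

text \<open>
  Invariance under the transition kernels \<open>P\<^sub>t(z, S) = \<P>(Z\<^sup>z\<^sub>t \<in> S)\<close>. The solutions \<open>Z\<^sup>z\<close>
  are unique up to indistinguishability, so the kernels do not depend on the witness \<open>Z\<close>.
\<close>

definition invariant_measure ::
  "'w measure \<Rightarrow> (real \<Rightarrow> 'w \<Rightarrow> real^'n) \<Rightarrow> real^'n^'n \<Rightarrow> real^'n^'n \<Rightarrow>
     (real^'n) measure \<Rightarrow> bool" where
  "invariant_measure M W B A \<mu> \<longleftrightarrow>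
     prob_space \<mu> \<and> sets \<mu> = sets borel \<and>
     (\<exists>Z. (\<forall>z. sde_solution M W B A z (Z z)) \<and>
        (\<forall>t\<ge>0. \<forall>S\<in>sets borel.
           (\<integral>\<^sup>+ z. emeasure (distr M borel (Z z t)) S \<partial>\<mu>) = emeasure \<mu> S))"

text \<open>
  \<open>\<kappa> x\<close> is the law of the \<open>y\<close>-component under \<open>\<mu>\<close>, given that the \<open>x\<close>-component equals \<open>x\<close>.
  A regular conditional distribution is determined only up to null sets; requiring weak continuity
  in \<open>x\<close> selects the version that is meaningful at every single point \<open>x\<close>.
\<close>

definition conditional_law ::
  "(real^('m + 'n)) measure \<Rightarrow> (real^'m \<Rightarrow> (real^'n) measure) \<Rightarrow> bool" where
  "conditional_law \<mu> \<kappa> \<longleftrightarrow>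
     \<kappa> \<in> borel \<rightarrow>\<^sub>M prob_algebra borel \<and>
     (\<forall>S\<in>sets borel. \<forall>T\<in>sets borel.
        emeasure \<mu> {z. x_part z \<in> S \<and> y_part z \<in> T} =
        (\<integral>\<^sup>+ x\<in>S. emeasure (\<kappa> x) T \<partial>distr \<mu> borel x_part)) \<and>
     (\<forall>x. weakly_converges \<kappa> (\<kappa> x) (at x))"

end

theory Submission
  imports Defs "HOL-Computational_Algebra.Fundamental_Theorem_Algebra"
begin

text \<open>
  For a Hurwitz matrix \<open>B\<close> the flow \<open>E' = E B\<close> decays. Along it the noise \<open>\<xi> \<bullet> (Z\<^sub>T - E\<^sub>T z)\<close> is a pathwise limit of
  Riemann-Stieltjes sums of Brownian increments, hence Gaussian, and letting \<open>T \<rightarrow> \<infinity>\<close> identifies the invariant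
  measure as \<open>N(0, K)\<close>, with \<open>K\<close> the Lyapunov solution. A conditional law that is weakly continuous in the condition
  must be the Gaussian given by the Schur complement of \<open>K\<close>. Multiplying the fast blocks of the Lyapunov
  equation by \<open>\<epsilon>\<close> makes the system for the blocks of \<open>K\<close> a regular perturbation of a system that is injective because
  \<open>B\<^sub>2\<^sub>2\<close> and \<open>B\<^sub>1\<^sub>1 - B\<^sub>1\<^sub>2 B\<^sub>2\<^sub>2\<^sup>-\<^sup>1 B\<^sub>2\<^sub>1\<close> are Hurwitz, so the blocks converge to the solution at \<open>\<epsilon> = 0\<close>.
\<close>

section \<open>Flows of Hurwitz matrices\<close>

text \<open>The obstacle is that the covariance of the fast component does not itself tend to
  \<open>\<Sigma>\<close>. With H = - B22^-1 B21 the blocks of K tend to P0, P0 H^T, H P0 and H P0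
  H^T + \<open>\<Sigma>\<close>: in the limit y is H x plus an independent fluctuation of covariance
  \<open>\<Sigma>\<close>. The Schur complement removes exactly H P0 H^T. Forming it in the limit
  requires P0 to be invertible, and this is where controllability of the reduced pair enters. The
  rescaling is regular because the noise carries 1 / sqrt \<epsilon>, so that its square is balanced
  by the factor \<epsilon>. On the stochastic side, A being constant, an integration by parts moves
  the differentiation from the noise path to the smooth flow, and the Lyapunov equation turns the
  variance of the resulting Gaussian into a difference of boundary values. The flow is built by
  annihilating one vector at a time with factors M - l, where l is an eigenvalue, which replaces a
  Jordan decomposition.\<close>

lemma norm_vector_scalar_mult: "norm (c *s v) = norm c * norm (v :: complex^'n)"
  by (simp add: norm_vec_def vector_scalar_mult_def norm_mult L2_set_right_distrib)

lemma bounded_bilinear_vector_scalar_mult: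
  "bounded_bilinear ((*s) :: complex \<Rightarrow> complex^'n \<Rightarrow> complex^'n)"
proof
  show "\<exists>K. \<forall>a b. norm (a *s b :: complex^'n) \<le> norm a * norm b * K"
    by (rule exI[of _ 1]) (simp add: norm_vector_scalar_mult)
qed (simp_all add: vec_eq_iff vector_scalar_mult_def algebra_simps)

section \<open>Annihilating polynomials of a single vector\<close>

definition poly_app :: "complex^'n^'n \<Rightarrow> complex poly \<Rightarrow> complex^'n \<Rightarrow> complex^'n" where
  "poly_app M p v = (\<Sum>i\<le>degree p. coeff p i *s ((*v) M ^^ i) v)"

lemma poly_app_ge:
  assumes "degree p \<le> N"
  shows "poly_app M p v = (\<Sum>i\<le>N. coeff p i *s ((*v) M ^^ i) v)"
  unfolding poly_app_def
  by (rule sum.mono_neutral_left) (use assms in \<open>auto simp: coeff_eq_0\<close>)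

lemma iterate_linear: "((*v) M ^^ i) (M *v v - l *s v) = M *v ((*v) M ^^ i) v - l *s ((*v) M ^^ i) (v :: complex^'n)"
  by (induction i) (auto simp: matrix_vector_mult_diff_distrib vector_scalar_commute[symmetric])

lemma matrix_vector_mult_sum: "M *v (\<Sum>i\<in>S. f i) = (\<Sum>i\<in>S. M *v f i)" for M :: "complex^'n^'m"
  by (induction S rule: infinite_finite_induct) (simp_all add: matrix_vector_right_distrib)

text \<open>A linear factor may be applied first, which changes the vector, or last, which acts on
  the result. The first form serves when l is an eigenvalue of M; the second when it is not and the
  factor is to be cancelled.\<close>

lemma poly_app_factor:
  "poly_app M ([:- l, 1:] * q) v = poly_app M q (M *v v - l *s v)"
  "poly_app M ([:- l, 1:] * q) v = M *v poly_app M q v - l *s poly_app M q (v :: complex^'n)"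
proof -
  define N where "N = Suc (degree q)"
  let ?u = "\<lambda>i. ((*v) M ^^ i) v"
  have dq: "degree q \<le> N" "coeff q N = 0" by (auto simp: N_def coeff_eq_0)
  have "degree ([:- l, 1:] * q) \<le> N"
    by (rule order.trans[OF degree_mult_le]) (simp add: N_def)
  then have "poly_app M ([:- l, 1:] * q) v = (\<Sum>i\<le>N. coeff ([:- l, 1:] * q) i *s ?u i)"
    by (rule poly_app_ge)
  also have "\<dots> = (\<Sum>i\<le>N. coeff (pCons 0 q) i *s ?u i) - (\<Sum>i\<le>N. l *s (coeff q i *s ?u i))"
    by (simp add: sum_subtractf[symmetric] algebra_simps vector_scalar_mult_def vec_eq_iff)
  also have "(\<Sum>i\<le>N. coeff (pCons 0 q) i *s ?u i) = (\<Sum>i\<le>degree q. coeff q i *s ?u (Suc i))"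
    unfolding N_def by (subst sum.atMost_Suc_shift) simp
  also have "\<dots> = (\<Sum>i\<le>N. coeff q i *s ?u (Suc i))"
    by (rule sum.mono_neutral_left) (auto simp: N_def coeff_eq_0)
  also have "\<dots> - (\<Sum>i\<le>N. l *s (coeff q i *s ?u i)) = (\<Sum>i\<le>N. coeff q i *s (M *v ?u i - l *s ?u i))"
    by (simp add: sum_subtractf[symmetric] algebra_simps vector_scalar_mult_def vec_eq_iff)
  finally have eq: "poly_app M ([:- l, 1:] * q) v = \<dots>" .
  show "poly_app M ([:- l, 1:] * q) v = poly_app M q (M *v v - l *s v)"
    by (simp only: eq poly_app_ge[OF dq(1)] iterate_linear)
  show "poly_app M ([:- l, 1:] * q) v = M *v poly_app M q v - l *s poly_app M q v"
    by (simp only: eq poly_app_ge[OF dq(1)] matrix_vector_mult_sum vec.scale_sum_right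
        sum_subtractf[symmetric] vector_scalar_commute vec.scale_right_diff_distrib vec.scale_left_commute)
qed

lemma annihilating_poly_exists:
  fixes v :: "complex^'n"
  obtains p where "p \<noteq> 0" "poly_app M p v = 0"
proof -
  \<comment> \<open>\<open>DIM\<close> is the dimension over the reals, so N + 1 distinct iterates
    satisfy a relation with real coefficients.\<close>
  define N where "N = DIM(complex^'n)"
  let ?u = "\<lambda>i. ((*v) M ^^ i) v"
  show thesis
  \<comment> \<open>Linear dependence is a property of the set of iterates, which loses members when
    two of them coincide. A coincidence directly gives the difference of two monomials.\<close>
  proof (cases "inj_on ?u {..N}")
    case False
    then obtain i j where ij: "i \<noteq> j" "?u i = ?u j" "i \<le> N" "j \<le> N" by (auto simp: inj_on_def)
    let ?p = "monom 1 i - monom (1::complex) j"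
    have "coeff ?p i \<noteq> 0" using ij by simp
    then have p0: "?p \<noteq> 0" by (metis coeff_0)
    have "degree ?p \<le> N" by (rule degree_diff_le) (use ij degree_monom_le order.trans in blast)+
    then have "poly_app M ?p v = (\<Sum>k\<le>N. coeff ?p k *s ?u k)" by (rule poly_app_ge)
    also have "\<dots> = (\<Sum>k\<le>N. (if k = i then ?u k else 0)) - (\<Sum>k\<le>N. (if k = j then ?u k else 0))"
      unfolding sum_subtractf[symmetric] by (rule sum.cong) auto
    also have "\<dots> = 0" using ij by (simp add: sum.delta)
    finally show thesis using that p0 by blast
  next
    case True
    then have "card (?u ` {..N}) = Suc N" by (simp add: card_image)
    then have "dependent (?u ` {..N})"
      using independent_card_le[of "?u ` {..N}"] by (auto simp: N_def)
    then obtain c w where c: "(\<Sum>w\<in>?u ` {..N}. c w *\<^sub>R w) = 0" "w \<in> ?u ` {..N}" "c w \<noteq> 0"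
      using real_vector.dependent_finite[of "?u ` {..N}"] by auto
    then obtain i where i: "i \<le> N" "c (?u i) \<noteq> 0" by auto
    let ?p = "\<Sum>k\<le>N. monom (complex_of_real (c (?u k))) k"
    have co: "coeff ?p k = (if k \<le> N then of_real (c (?u k)) else 0)" for k
      by (simp add: coeff_sum if_distrib[of "\<lambda>x. x = _"])
    have p0: "?p \<noteq> 0" using co[of i] i by (metis coeff_0 of_real_eq_0_iff)
    have "degree ?p \<le> N" by (rule degree_le) (simp add: co)
    then have "poly_app M ?p v = (\<Sum>k\<le>N. coeff ?p k *s ?u k)" by (rule poly_app_ge)
    also have "\<dots> = (\<Sum>k\<le>N. c (?u k) *\<^sub>R ?u k)"
      by (rule sum.cong) (auto simp: co vec_eq_iff scaleR_conv_of_real[of _ "_ :: complex"])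
    also have "\<dots> = 0" using c(1) by (simp add: sum.reindex[OF True])
    finally show thesis using that p0 by blast
  qed
qed

text \<open>Peel one root l off an annihilating polynomial at a time. If l is an eigenvalue of M, it
  is recorded and v is replaced by (M - l) v; otherwise M - l is injective and the factor is
  cancelled. Only eigenvalues are recorded, and these are what the Hurwitz condition
  controls.\<close>

lemma annihilating_eigenvalues:
  fixes v :: "complex^'n"
  obtains ls where "\<forall>l\<in>set ls. \<exists>w. w \<noteq> 0 \<and> M *v w = l *s w"
    and "foldl (\<lambda>v l. M *v v - l *s v) v ls = 0"
proof -
  have "\<exists>ls. (\<forall>l\<in>set ls. \<exists>w. w \<noteq> 0 \<and> M *v w = l *s w) \<and> foldl (\<lambda>v l. M *v v - l *s v) v ls = 0"
    if "p \<noteq> 0" "poly_app M p v = 0" for p v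
    using that
  proof (induction "degree p" arbitrary: p v rule: less_induct)
    case less
    show ?case
    proof (cases "degree p = 0")
      case True
      then have "v = 0" using less.prems by (auto simp: poly_app_def elim!: degree_eq_zeroE split: if_splits)
      then show ?thesis by (intro exI[of _ "[]"]) simp
    next
      case False
      then obtain l where "poly p l = 0"
        using fundamental_theorem_of_algebra[of p] by (auto simp: constant_degree)
      then obtain q where q: "p = [:- l, 1:] * q" by (auto simp: poly_eq_0_iff_dvd)
      with less.prems have q0: "q \<noteq> 0" by auto
      then have deg: "degree q < degree p" unfolding q by (subst degree_mult_eq) auto
      show ?thesis
      proof (cases "\<exists>w. w \<noteq> 0 \<and> M *v w = l *s w")
        case True
        have "poly_app M q (M *v v - l *s v) = 0"
          using less.prems(2) poly_app_factor(1) q by metis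
        from less.hyps[OF deg q0 this] obtain ls where
          "\<forall>l\<in>set ls. \<exists>w. w \<noteq> 0 \<and> M *v w = l *s w"
          "foldl (\<lambda>v l. M *v v - l *s v) (M *v v - l *s v) ls = 0" by blast
        with True show ?thesis by (intro exI[of _ "l # ls"]) simp
      next
        case False
        have "M *v poly_app M q v - l *s poly_app M q v = 0"
          using less.prems(2) poly_app_factor(2) q by metis
        with False have "poly_app M q v = 0" by auto
        with less.hyps[OF deg q0] show ?thesis by blast
      qed
    qed
  qed
  moreover obtain p where "p \<noteq> 0" "poly_app M p v = 0" by (rule annihilating_poly_exists)
  ultimately show thesis using that by blast
qed

text \<open>Induction along the list: given a decaying solution \<omega> of the same equation
  starting at (M - l) v, solve \<eta>' = l \<eta> + \<omega> with \<eta> 0 = v. The defect M \<eta>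
  - l \<eta> - \<omega> solves a linear equation with initial value 0, so it vanishes and \<eta>' =
  M \<eta>.\<close>

lemma decaying_solution:
  fixes M :: "complex^'n^'n"
  assumes "\<forall>l\<in>set ls. Re l < - c" "foldl (\<lambda>v l. M *v v - l *s v) v ls = 0"
  shows "\<exists>\<eta> C. \<eta> 0 = v \<and> (\<forall>t\<ge>0. (\<eta> has_vector_derivative M *v \<eta> t) (at t within {0..})) \<and>
           (\<forall>t\<ge>0. norm (\<eta> t) \<le> C * exp (- c * t))"
  using assms
proof (induction ls arbitrary: v)
  case Nil
  then show ?case by (intro exI[of _ "\<lambda>_. 0"] exI[of _ 0]) auto
next
  case (Cons l ls)
  then obtain \<omega> C where \<omega>0: "\<omega> 0 = M *v v - l *s v"
    and \<omega>': "\<And>t. t \<ge> 0 \<Longrightarrow> (\<omega> has_vector_derivative M *v \<omega> t) (at t within {0..})"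
    and \<omega>n: "\<And>t. t \<ge> 0 \<Longrightarrow> norm (\<omega> t) \<le> C * exp (- c * t)"
    by (metis (no_types, lifting) foldl_Cons list.set_intros(2))
  interpret sm: bounded_bilinear "(*s) :: complex \<Rightarrow> complex^'n \<Rightarrow> complex^'n"
    by (rule bounded_bilinear_vector_scalar_mult)
  have lin: "bounded_linear ((*v) M)" by (simp add: matrix_vector_mul_bounded_linear)
  \<comment> \<open>The gap between the rate c and the rate of l. Since it is strictly positive, the
    integral of e^(d s) stays a multiple of e^(d t), and repeated eigenvalues cost no powers of
    t.\<close>
  define d where "d = - c - Re l"
  have d: "d > 0" using Cons.prems by (simp add: d_def)
  have C: "C \<ge> 0" using \<omega>n[of 0] norm_ge_zero[of "\<omega> 0"] by (simp del: norm_ge_zero)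
  have \<omega>c: "continuous_on {0..} \<omega>"
    using \<omega>' by (auto simp: continuous_on_eq_continuous_within intro!: has_vector_derivative_continuous)
  define g where "g = (\<lambda>s::real. exp (- l * s) *s \<omega> s)"
  have ec: "continuous_on S (\<lambda>s::real. exp (l' * s))" for S and l' :: complex
    by (intro continuous_intros)
  have gc: "continuous_on {0..} g"
    unfolding g_def by (intro sm.continuous_on ec \<omega>c)
  have exp_d: "((\<lambda>s::real. exp (l' * s)) has_vector_derivative l' * exp (l' * t)) (at t within S)"
    for l' :: complex and t S
  proof -
    have "((\<lambda>s::complex. exp (l' * s)) has_field_derivative l' * exp (l' * of_real t)) (at (of_real t))"
      by (auto intro!: derivative_eq_intros)
    from has_vector_derivative_real_field[OF this] show ?thesis by simp
  qed
  \<comment> \<open>Variation of constants for the scalar coefficient l.\<close>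
  define \<eta> where "\<eta> = (\<lambda>t. exp (l * t) *s (v + integral {0..t} g))"
  have G': "((\<lambda>t. integral {0..t} g) has_vector_derivative g t) (at t within {0..})" if "t \<ge> 0" for t
  proof -
    have "((\<lambda>t. integral {0..t} g) has_vector_derivative g t) (at t within {0..t+1})"
      by (rule integral_has_vector_derivative) (use that in \<open>auto intro: continuous_on_subset[OF gc]\<close>)
    moreover have "at t within {0..t+1} = at t within {0..}"
      by (rule at_within_nhd[of _ "{..<t+1}"]) auto
    ultimately show ?thesis by simp
  qed
  have \<eta>': "(\<eta> has_vector_derivative l *s \<eta> t + \<omega> t) (at t within {0..})" if "t \<ge> 0" for t
  proof -
    have "(\<eta> has_vector_derivative exp (l * t) *s (0 + g t) + (l * exp (l * t)) *s (v + integral {0..t} g)) (at t within {0..})"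
      unfolding \<eta>_def by (intro sm.has_vector_derivative exp_d has_vector_derivative_add has_vector_derivative_const G' that)
    moreover have "exp (l * t) *s (0 + g t) = \<omega> t"
      by (simp add: g_def exp_minus field_simps)
    ultimately show ?thesis by (simp add: \<eta>_def add.commute)
  qed
  have \<eta>0: "\<eta> 0 = v" by (simp add: \<eta>_def)
  \<comment> \<open>The defect. Its derivative is M (l \<eta> + \<omega>) - l (l \<eta> + \<omega>)
    - M \<omega>, which is l \<theta>.\<close>
  define \<theta> where "\<theta> = (\<lambda>t. M *v \<eta> t - l *s \<eta> t - \<omega> t)"
  have \<theta>': "(\<theta> has_vector_derivative l *s \<theta> t) (at t within {0..})" if "t \<ge> 0" for t
  proof -
    have "(\<theta> has_vector_derivative M *v (l *s \<eta> t + \<omega> t) - l *s (l *s \<eta> t + \<omega> t) - M *v \<omega> t) (at t within {0..})"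
      unfolding \<theta>_def using that
      by (intro has_vector_derivative_diff bounded_linear.has_vector_derivative[OF lin]
          bounded_linear.has_vector_derivative[OF sm.bounded_linear_right] \<eta>' \<omega>')
    then show ?thesis
      by (simp add: \<theta>_def matrix_vector_right_distrib vector_scalar_commute algebra_simps
          vec.scale_right_diff_distrib vec.scale_right_distrib)
  qed
  have "exp (- l * t) *s \<theta> t = exp (- l * 0) *s \<theta> 0" if "t \<ge> 0" for t :: real
  proof -
    have "((\<lambda>s. exp (- l * complex_of_real s) *s \<theta> s) has_derivative (\<lambda>_. 0)) (at s within {0..})" if "s \<ge> 0" for s
    proof -
      have "((\<lambda>s. exp (- l * complex_of_real s) *s \<theta> s) has_vector_derivative
          exp (- l * s) *s (l *s \<theta> s) + (- l * exp (- l * s)) *s \<theta> s) (at s within {0..})"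
        by (intro sm.has_vector_derivative exp_d \<theta>' that)
      then show ?thesis by (simp add: has_vector_derivative_def mult.commute)
    qed
    then obtain k where "\<And>s. s \<in> {0..} \<Longrightarrow> exp (- l * complex_of_real s) *s \<theta> s = k"
      using has_derivative_zero_constant[of "{0::real..}" "\<lambda>s. exp (- l * complex_of_real s) *s \<theta> s"] by auto
    then show ?thesis using that by force
  qed
  moreover have "\<theta> 0 = 0" by (simp add: \<theta>_def \<eta>0 \<omega>0)
  ultimately have \<theta>: "\<theta> t = 0" if "t \<ge> 0" for t
    using that by (metis exp_not_eq_zero vec.scale_eq_0_iff)
  have "norm (\<eta> t) \<le> (norm v + C / d) * exp (- c * t)" if t: "t \<ge> 0" for t
  proof -
    have I: "((\<lambda>s. C * exp (d * s)) has_integral C / d * exp (d * t) - C / d * exp (d * 0)) {0..t}"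
      by (rule fundamental_theorem_of_calculus)
        (use t d in \<open>auto intro!: derivative_eq_intros simp: has_real_derivative_iff_has_vector_derivative[symmetric]\<close>)
    have "norm (integral {0..t} g) \<le> integral {0..t} (\<lambda>s. C * exp (d * s))"
    proof (rule integral_norm_bound_integral)
      show "g integrable_on {0..t}"
        by (rule integrable_continuous_real) (auto intro: continuous_on_subset[OF gc])
      show "norm (g s) \<le> C * exp (d * s)" if "s \<in> {0..t}" for s
      proof -
        have "norm (g s) = exp (- Re l * s) * norm (\<omega> s)"
          by (simp add: g_def norm_vector_scalar_mult)
        also have "\<dots> \<le> exp (- Re l * s) * (C * exp (- c * s))"
          using that by (intro mult_left_mono \<omega>n) auto
        also have "\<dots> = C * exp (d * s)"
          by (simp add: d_def exp_add[symmetric] algebra_simps)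
        finally show ?thesis .
      qed
    qed (use I in blast)
    also have "\<dots> \<le> C / d * exp (d * t)" using integral_unique[OF I] C d by simp
    finally have i: "norm (integral {0..t} g) \<le> C / d * exp (d * t)" .
    have "norm (\<eta> t) \<le> exp (Re l * t) * (norm v + C / d * exp (d * t))"
      unfolding \<eta>_def norm_vector_scalar_mult
      by (intro mult_mono order.trans[OF norm_triangle_ineq] add_left_mono i) auto
    also have "\<dots> = norm v * exp (Re l * t) + C / d * exp (- c * t)"
      by (simp add: algebra_simps exp_add[symmetric] d_def)
    also have "\<dots> \<le> norm v * exp (- c * t) + C / d * exp (- c * t)"
      using mult_right_mono[of "Re l" "- c" t] t Cons.prems(1) by (intro add_right_mono mult_left_mono) auto
    finally show ?thesis by (simp add: algebra_simps)
  qed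
  moreover have "(\<eta> has_vector_derivative M *v \<eta> t) (at t within {0..})" if "t \<ge> 0" for t
    using \<eta>'[OF that] \<theta>[OF that] by (simp add: \<theta>_def algebra_simps)
  ultimately show ?case using \<eta>0 by blast
qed

section \<open>From the spectrum of a real matrix to its decaying flow\<close>

lemma complex_eigenvalue_det:
  "complex_eigenvalue B l \<longleftrightarrow> det (map_matrix complex_of_real B - mat l) = 0"
proof -
  let ?N = "map_matrix complex_of_real B - mat l"
  have "?N *v v = map_matrix complex_of_real B *v v - l *s v" for v
    by (simp add: matrix_vector_mult_diff_rdistrib) (simp add: vec_eq_iff mat_def matrix_vector_mult_def if_distrib[of "\<lambda>x. x * _"] cong: if_cong)
  then have "complex_eigenvalue B l \<longleftrightarrow> \<not> (\<forall>v. ?N *v v = 0 \<longrightarrow> v = 0)"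
    by (auto simp: complex_eigenvalue_def)
  also have "\<dots> \<longleftrightarrow> \<not> invertible ?N"
    by (simp add: invertible_left_inverse matrix_left_invertible_ker)
  finally show ?thesis by (simp add: invertible_det_nz)
qed

lemma hurwitz_transpose: "hurwitz B \<Longrightarrow> hurwitz (transpose B)"
proof -
  have "map_matrix complex_of_real (transpose B) - mat l = transpose (map_matrix complex_of_real B - mat l)" for l
    by (simp add: vec_eq_iff transpose_def mat_def)
  then have "complex_eigenvalue (transpose B) l \<longleftrightarrow> complex_eigenvalue B l" for l
    by (simp add: complex_eigenvalue_det)
  then show "hurwitz B \<Longrightarrow> hurwitz (transpose B)" by (simp add: hurwitz_def)
qed

text \<open>A real kernel vector, read as a complex one, would be an eigenvector for 0, whose real
  part is not negative.\<close>

lemma hurwitz_invertible: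
  fixes B :: "real^'n^'n"
  assumes "hurwitz B"
  shows "invertible B"
proof (rule ccontr)
  assume "\<not> invertible B"
  then obtain v where v: "B *v v = 0" "v \<noteq> 0"
    by (auto simp: invertible_left_inverse matrix_left_invertible_ker)
  let ?v = "\<chi> i. complex_of_real (v $ i)"
  have "map_matrix complex_of_real B *v ?v = (\<chi> i. complex_of_real ((B *v v) $ i))"
    by (simp add: vec_eq_iff matrix_vector_mult_def)
  then have "map_matrix complex_of_real B *v ?v = 0 *s ?v" by (simp add: v vec_eq_iff)
  moreover have "?v \<noteq> 0" using v(2) by (simp add: vec_eq_iff)
  ultimately have "complex_eigenvalue B 0" unfolding complex_eigenvalue_def by blast
  with assms show False by (auto simp: hurwitz_def)
qed

text \<open>This is E t = exp (t B), given by its differential equation. B stands on the right so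
  that each row of E evolves on its own under \<open>transpose B\<close> and so that B lands next to
  K in E K E^T. Derivatives are one-sided at 0.\<close>

definition decaying_flow :: "real^'n^'n \<Rightarrow> (real \<Rightarrow> real^'n^'n) \<Rightarrow> bool" where
  "decaying_flow B E \<longleftrightarrow> E 0 = mat 1 \<and>
     (\<forall>t\<ge>0. (E has_vector_derivative E t ** B) (at t within {0..})) \<and> (E \<longlongrightarrow> 0) at_top"

lemma decaying_flowD:
  assumes "decaying_flow B E"
  shows "E 0 = mat 1" "t \<ge> 0 \<Longrightarrow> (E has_vector_derivative E t ** B) (at t within {0..})"
    "(E \<longlongrightarrow> 0) at_top"
  using assms by (auto simp: decaying_flow_def)

text \<open>Row i is the real part of the decaying solution for \<open>transpose B\<close> that
  starts at the i-th unit vector.\<close>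

lemma hurwitz_flow:
  fixes B :: "real^'n^'n"
  assumes "hurwitz B"
  shows "\<exists>E. decaying_flow B E"
proof -
  let ?M = "map_matrix complex_of_real (transpose B)"
  have row: "\<exists>\<eta>. \<eta> 0 = v \<and> (\<forall>t\<ge>0. (\<eta> has_vector_derivative transpose B *v \<eta> t) (at t within {0..})) \<and>
      (\<eta> \<longlongrightarrow> 0) at_top" for v :: "real^'n"
  proof -
    define cv where "cv = (\<chi> i. complex_of_real (v $ i))"
    obtain ls where ls: "\<forall>l\<in>set ls. \<exists>w. w \<noteq> 0 \<and> ?M *v w = l *s w"
      and ann: "foldl (\<lambda>v l. ?M *v v - l *s v) cv ls = 0"
      by (rule annihilating_eigenvalues)
    have neg: "Re l < 0" if "l \<in> set ls" for l
      using ls hurwitz_transpose[OF assms] that unfolding hurwitz_def complex_eigenvalue_def by blast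
    \<comment> \<open>Half of the smallest decay rate in the list makes Re l < - c strict. The empty
      list has no minimum; it arises only for the zero vector, where any positive rate will
      do.\<close>
    define c where "c = (if ls = [] then 1 else Min ((\<lambda>l. - Re l) ` set ls) / 2)"
    have c: "c > 0" using neg by (auto simp: c_def)
    have "Re l < - c" if "l \<in> set ls" for l
    proof -
      have "Min ((\<lambda>l. - Re l) ` set ls) \<le> - Re l" using that by simp
      moreover have "ls \<noteq> []" using that by auto
      ultimately show ?thesis using neg[OF that] by (auto simp: c_def)
    qed
    with decaying_solution[of ls c ?M cv] ann obtain \<eta> C where \<eta>: "\<eta> 0 = cv"
      "\<And>t. t \<ge> 0 \<Longrightarrow> (\<eta> has_vector_derivative ?M *v \<eta> t) (at t within {0..})"
      "\<And>t. t \<ge> 0 \<Longrightarrow> norm (\<eta> t) \<le> C * exp (- c * t)" by blast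
    \<comment> \<open>Taking real parts commutes with \<open>?M\<close>, because its entries are
      real, so it carries solutions to solutions.\<close>
    define R where "R = (\<lambda>w :: complex^'n. (\<chi> i. Re (w $ i)))"
    have linR: "linear R" by (auto simp: R_def linear_iff vec_eq_iff)
    then have R: "bounded_linear R" by (simp add: linear_linear)
    have RM: "R (?M *v w) = transpose B *v R w" for w
      by (simp add: R_def vec_eq_iff matrix_vector_mult_def)
    have "R (\<eta> 0) = v" by (simp add: \<eta> R_def cv_def vec_eq_iff)
    moreover have "((\<lambda>t. R (\<eta> t)) has_vector_derivative transpose B *v R (\<eta> t)) (at t within {0..})" if "t \<ge> 0" for t
      using bounded_linear.has_vector_derivative[OF R \<eta>(2)[OF that]] by (simp add: RM)
    moreover have "((\<lambda>t. R (\<eta> t)) \<longlongrightarrow> 0) at_top"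
    proof -
      have "((\<lambda>t. C * exp (- c * t)) \<longlongrightarrow> C * 0) at_top"
        by (intro tendsto_mult tendsto_const filterlim_compose[OF exp_at_bot]
            filterlim_tendsto_neg_mult_at_bot[OF tendsto_const]) (use c in \<open>auto simp: filterlim_ident\<close>)
      then have "((\<lambda>t. C * exp (- c * t)) \<longlongrightarrow> 0) at_top" by (simp only: mult_zero_right)
      moreover have "\<forall>\<^sub>F t in at_top. norm (\<eta> t) \<le> C * exp (- c * t)"
        using eventually_ge_at_top[of 0] by (rule eventually_mono) (rule \<eta>(3))
      ultimately have "(\<eta> \<longlongrightarrow> 0) at_top"
        by (rule Lim_null_comparison[rotated])
      from bounded_linear.tendsto[OF R this] show ?thesis by (simp add: linear_0[OF linR])
    qed
    ultimately show ?thesis by (intro exI[of _ "\<lambda>t. R (\<eta> t)"] conjI allI impI)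
  qed
  then have "\<exists>\<eta>. \<forall>i. \<eta> i 0 = axis i 1 \<and> (\<forall>t\<ge>0. (\<eta> i has_vector_derivative transpose B *v \<eta> i t) (at t within {0..})) \<and>
      (\<eta> i \<longlongrightarrow> 0) at_top"
    by (intro choice allI)
  then obtain \<eta> :: "'n \<Rightarrow> real \<Rightarrow> real^'n" where \<eta>: "\<And>i. \<eta> i 0 = axis i 1"
    "\<And>i t. t \<ge> 0 \<Longrightarrow> (\<eta> i has_vector_derivative transpose B *v \<eta> i t) (at t within {0..})"
    "\<And>i. (\<eta> i \<longlongrightarrow> 0) at_top" by blast
  define E where "E = (\<lambda>t. \<chi> i. \<eta> i t)"
  have "decaying_flow B E"
    unfolding decaying_flow_def
  proof (intro conjI allI impI)
    show "E 0 = mat 1" by (simp add: E_def \<eta>(1) vec_eq_iff mat_def axis_def)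
    show "(E \<longlongrightarrow> 0) at_top" by (rule vec_tendstoI) (simp add: E_def \<eta>(3))
    show "(E has_vector_derivative E t ** B) (at t within {0..})" if "t \<ge> 0" for t
    proof -
      have "transpose B *v \<eta> i t = (E t ** B) $ i" for i
        by (simp add: E_def vec_eq_iff matrix_vector_mult_def matrix_matrix_mult_def transpose_def mult.commute)
      with \<eta>(2)[OF that] have i: "(\<eta> i has_vector_derivative (E t ** B) $ i) (at t within {0..})" for i by metis
      \<comment> \<open>The derivatives of the rows are assembled by writing a matrix as the sum of
        its rows, each placed in an otherwise zero matrix.\<close>
      have J: "bounded_linear (\<lambda>w :: real^'n. \<chi> k. if k = i then w else 0)" for i :: 'n
        by (auto simp: linear_linear linear_iff vec_eq_iff)
      have sum: "(\<Sum>i\<in>UNIV. \<chi> k. if k = i then w i else 0) = (\<chi> k. w k)" for w :: "'n \<Rightarrow> real^'n"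
        by (simp add: vec_eq_iff[of "sum _ _"] if_distrib[of "\<lambda>x. x $ _"] sum.delta cong: if_cong)
      have "((\<lambda>t. \<Sum>i\<in>UNIV. \<chi> k. if k = i then \<eta> i t else 0) has_vector_derivative
          (\<Sum>i\<in>UNIV. \<chi> k. if k = i then (E t ** B) $ i else 0)) (at t within {0..})"
        by (intro has_vector_derivative_sum bounded_linear.has_vector_derivative[OF J] i)
      then show ?thesis unfolding sum E_def by simp
    qed
  qed
  then show ?thesis by blast
qed

section \<open>The Lyapunov equation\<close>

text \<open>As a simp rule it turns products with \<open>transpose A\<close> into \<open>v*\<close>
  products, whereas the adjoint flow below is written with \<open>transpose\<close>.\<close>

declare transpose_matrix_vector [simp del]

lemma bounded_bilinear_matrix_mult:
  "bounded_bilinear ((**) :: real^'n^'m \<Rightarrow> real^'k^'n \<Rightarrow> real^'k^'m)"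
  unfolding bilinear_conv_bounded_bilinear[symmetric] bilinear_def linear_iff
  by (simp add: vec_eq_iff matrix_matrix_mult_def algebra_simps sum.distrib sum_distrib_left)

lemma bounded_linear_transpose: "bounded_linear (transpose :: real^'n^'m \<Rightarrow> real^'m^'n)"
  by (auto simp: linear_conv_bounded_linear[symmetric] linear_iff transpose_def vec_eq_iff)

lemma bounded_bilinear_matrix_vector: "bounded_bilinear ((*v) :: real^'n^'m \<Rightarrow> real^'n \<Rightarrow> real^'m)"
  unfolding bilinear_conv_bounded_bilinear[symmetric] bilinear_def linear_iff
  by (simp add: vec_eq_iff matrix_vector_mult_def algebra_simps sum.distrib sum_distrib_left)

lemmas matrix_mult_linear_simps =
  bounded_bilinear.add_left[OF bounded_bilinear_matrix_mult]
  bounded_bilinear.add_right[OF bounded_bilinear_matrix_mult]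
  bounded_bilinear.diff_left[OF bounded_bilinear_matrix_mult]
  bounded_bilinear.diff_right[OF bounded_bilinear_matrix_mult]
  bounded_bilinear.minus_left[OF bounded_bilinear_matrix_mult]
  bounded_bilinear.minus_right[OF bounded_bilinear_matrix_mult]
  bounded_bilinear.scaleR_left[OF bounded_bilinear_matrix_mult]
  bounded_bilinear.scaleR_right[OF bounded_bilinear_matrix_mult]
  bounded_bilinear.zero_left[OF bounded_bilinear_matrix_mult]
  bounded_bilinear.zero_right[OF bounded_bilinear_matrix_mult]

lemma transpose_add: "transpose (A + B) = transpose A + transpose (B :: real^'n^'m)"
  and transpose_uminus: "transpose (- A) = - transpose (A :: real^'n^'m)"
  by (simp_all add: transpose_def vec_eq_iff)

lemma transpose_scaleR: "transpose (c *\<^sub>R A) = c *\<^sub>R transpose (A :: real^'n^'m)"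
  by (simp add: transpose_def vec_eq_iff)

text \<open>The product rule places the Lyapunov operator of K between E and E^T. Everything about
  the Lyapunov equation in this section is read off from this curve.\<close>

lemma flow_congruence_derivative:
  fixes E :: "real \<Rightarrow> real^'n^'n"
  assumes "(E has_vector_derivative E t ** B) (at t within S)"
  shows "((\<lambda>t. E t ** K ** transpose (E t)) has_vector_derivative
           E t ** (B ** K + K ** transpose B) ** transpose (E t)) (at t within S)"
proof -
  interpret mm: bounded_bilinear "(**) :: real^'n^'n \<Rightarrow> real^'n^'n \<Rightarrow> real^'n^'n"
    by (rule bounded_bilinear_matrix_mult)
  have "((\<lambda>t. E t ** K ** transpose (E t)) has_vector_derivative
      (E t ** K) ** transpose (E t ** B) + (E t ** B ** K) ** transpose (E t)) (at t within S)"
    by (intro mm.has_vector_derivative bounded_linear.has_vector_derivative[OF bounded_linear_transpose]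
        bounded_linear.has_vector_derivative[OF mm.bounded_linear_left] assms)
  then show ?thesis
    by (simp add: matrix_transpose_mul matrix_mul_assoc mm.add_left mm.add_right add.commute)
qed

lemma flow_congruence_tendsto:
  fixes E :: "real \<Rightarrow> real^'n^'n"
  assumes "(E \<longlongrightarrow> 0) F"
  shows "((\<lambda>t. E t ** K ** transpose (E t)) \<longlongrightarrow> 0) F"
proof -
  interpret mm: bounded_bilinear "(**) :: real^'n^'n \<Rightarrow> real^'n^'n \<Rightarrow> real^'n^'n"
    by (rule bounded_bilinear_matrix_mult)
  have "((\<lambda>t. E t ** K ** transpose (E t)) \<longlongrightarrow> 0 ** K ** transpose 0) F"
    by (intro mm.tendsto bounded_linear.tendsto[OF bounded_linear_transpose] assms tendsto_const)
  then show ?thesis by (simp add: mm.zero_left)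
qed

text \<open>E P E^T is constant in time, equals P at 0 and tends to 0 at infinity.\<close>

lemma lyapunov_homogeneous:
  fixes B P :: "real^'n^'n"
  assumes "hurwitz B" "B ** P + P ** transpose B = 0"
  shows "P = 0"
proof -
  obtain E where "decaying_flow B E" using hurwitz_flow[OF assms(1)] by blast
  note E = decaying_flowD[OF this]
  let ?g = "\<lambda>t. E t ** P ** transpose (E t)"
  have "(?g has_derivative (\<lambda>_. 0)) (at t within {0..})" if "t \<ge> 0" for t
    using flow_congruence_derivative[OF E(2)[OF that], of P]
    by (simp add: assms(2) has_vector_derivative_def bounded_bilinear.zero_left[OF bounded_bilinear_matrix_mult]
        bounded_bilinear.zero_right[OF bounded_bilinear_matrix_mult])
  then obtain c where c: "\<And>t. t \<in> {0..} \<Longrightarrow> ?g t = c"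
    using has_derivative_zero_constant[of "{0::real..}" ?g] by auto
  have "(?g \<longlongrightarrow> c) at_top"
    using eventually_ge_at_top[of 0] by (rule tendsto_eventually[OF eventually_mono]) (rule c, simp)
  with flow_congruence_tendsto[OF E(3), of P] have "c = 0" using tendsto_unique trivial_limit_at_top_linorder by blast
  then show ?thesis using c[of 0] by (simp add: E(1) transpose_mat)
qed

text \<open>The Lyapunov operator is an injective endomorphism of a finite-dimensional space, hence
  surjective; the usual integral formula for the solution is bypassed.\<close>

lemma lyapunov_exists:
  fixes B Q :: "real^'n^'n"
  assumes "hurwitz B"
  obtains P where "B ** P + P ** transpose B = Q"
proof -
  interpret mm: bounded_bilinear "(**) :: real^'n^'n \<Rightarrow> real^'n^'n \<Rightarrow> real^'n^'n"
    by (rule bounded_bilinear_matrix_mult)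
  let ?L = "\<lambda>P. B ** P + P ** transpose B"
  have "linear ?L"
    by (intro bounded_linear.linear bounded_linear_add mm.bounded_linear_left mm.bounded_linear_right)
  moreover from this have "inj ?L"
    unfolding linear_injective_0[OF \<open>linear ?L\<close>] using lyapunov_homogeneous[OF assms] by blast
  ultimately have "surj ?L" by (rule linear_inj_imp_surj)
  then obtain P where "Q = ?L P" by (rule surjE)
  with that show thesis by simp
qed

lemma lyapunov_unique:
  fixes B :: "real^'n^'n"
  assumes "hurwitz B" "B ** P + P ** transpose B = Q" "B ** P' + P' ** transpose B = Q"
  shows "P = P'"
proof -
  interpret mm: bounded_bilinear "(**) :: real^'n^'n \<Rightarrow> real^'n^'n \<Rightarrow> real^'n^'n"
    by (rule bounded_bilinear_matrix_mult)
  have "B ** (P - P') + (P - P') ** transpose B = 0"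
    using assms(2,3) by (simp add: mm.diff_left mm.diff_right algebra_simps)
  from lyapunov_homogeneous[OF assms(1) this] show ?thesis by simp
qed

lemma lyapunov_symmetric:
  fixes B :: "real^'n^'n"
  assumes "hurwitz B" "B ** P + P ** transpose B = Q" "transpose Q = Q"
  shows "transpose P = P"
proof (rule lyapunov_unique[OF assms(1) _ assms(2)])
  have "transpose (B ** P + P ** transpose B) = Q" using assms(2,3) by simp
  then show "B ** transpose P + transpose P ** transpose B = Q"
    by (simp add: transpose_add matrix_transpose_mul add.commute)
qed

text \<open>Full rank makes x an image \<open>?C *v w\<close>, while the hypotheses say that x is
  orthogonal to every column of \<open>?C\<close>; hence x is orthogonal to itself.\<close>

lemma controllable_kernel:
  fixes B A :: "real^'n^'n"
  assumes "controllable B A" "\<And>k. transpose (((\<lambda>P. B ** P) ^^ k) A) *v x = 0"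
  shows "x = 0"
proof -
  let ?C = "controllability_matrix B A"
  from assms(1) have "surj ((*v) ?C)"
    by (simp add: controllable_def full_rank_surjective)
  then obtain w where w: "x = ?C *v w" by (metis surjD)
  have "transpose ?C *v x = 0"
  proof -
    have "(transpose ?C *v x) $ p = (transpose (((\<lambda>P. B ** P) ^^ to_nat_on (UNIV :: 'n set) (fst p)) A) *v x) $ snd p" for p
      by (simp add: controllability_matrix_def transpose_def matrix_vector_mult_def)
    then show ?thesis by (simp only: assms(2) vec_eq_iff zero_index) simp
  qed
  then have "x \<bullet> x = 0" by (metis w dot_lmul_matrix inner_zero_right transpose_matrix_vector inner_commute)
  then show ?thesis by simp
qed

text \<open>Along the flow, q t = v . E K E^T v has derivative - |A^T E^T v|^2 and tends to 0, so it
  is nonnegative and decreasing. If q 0 = 0, then q vanishes identically and so does A^T E^T v;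
  repeated differentiation gives (B^k A)^T E^T v = 0 for all k, and at time 0 controllability forces
  v = 0.\<close>

lemma lyapunov_pos_def:
  fixes B A K :: "real^'n^'n"
  assumes "hurwitz B" "controllable B A" and K: "B ** K + K ** transpose B = - (A ** transpose A)"
  shows "pos_def_matrix K"
  unfolding pos_def_matrix_def
proof (intro conjI allI impI)
  show "transpose K = K"
    by (rule lyapunov_symmetric[OF assms(1) K]) (simp add: transpose_uminus matrix_transpose_mul)
  fix v :: "real^'n" assume "v \<noteq> 0"
  obtain E where "decaying_flow B E" using hurwitz_flow[OF assms(1)] by blast
  note E = decaying_flowD[OF this]
  define \<eta> where "\<eta> t = transpose (E t) *v v" for t
  define q where "q t = v \<bullet> ((E t ** K ** transpose (E t)) *v v)" for t
  have lin: "bounded_linear (\<lambda>P. v \<bullet> (P *v v))"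
    by (rule bounded_linear_compose[OF bounded_linear_inner_right])
      (rule bounded_bilinear.bounded_linear_left[OF bounded_bilinear_matrix_vector])
  have q': "(q has_vector_derivative - ((norm (transpose A *v \<eta> t))\<^sup>2)) (at t within {0..})" if "t \<ge> 0" for t
  proof -
    have "(q has_vector_derivative v \<bullet> ((E t ** (- (A ** transpose A)) ** transpose (E t)) *v v)) (at t within {0..})"
      unfolding q_def
      using bounded_linear.has_vector_derivative[OF lin flow_congruence_derivative[OF E(2)[OF that], of K]] by (simp add: K)
    also have "E t ** (- (A ** transpose A)) ** transpose (E t) = - ((E t ** A) ** transpose (E t ** A))"
      by (simp add: matrix_transpose_mul matrix_mul_assoc bounded_bilinear.minus_left[OF bounded_bilinear_matrix_mult]
          bounded_bilinear.minus_right[OF bounded_bilinear_matrix_mult])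
    also have "v \<bullet> (- ((E t ** A) ** transpose (E t ** A)) *v v) = - ((norm (transpose (E t ** A) *v v))\<^sup>2)"
      unfolding power2_norm_eq_inner bounded_bilinear.minus_left[OF bounded_bilinear_matrix_vector]
        matrix_vector_mul_assoc[of "E t ** A", symmetric] inner_minus_right dot_lmul_matrix[symmetric] transpose_matrix_vector ..
    also have "transpose (E t ** A) *v v = transpose A *v \<eta> t"
      unfolding \<eta>_def matrix_transpose_mul matrix_vector_mul_assoc ..
    finally show ?thesis .
  qed
  have mono: "q t \<le> q s" if "0 \<le> s" "s \<le> t" for s t
  proof -
    have "\<exists>x\<in>{s..t}. q t - q s = (\<lambda>h. h *\<^sub>R (- ((norm (transpose A *v \<eta> x))\<^sup>2))) (t - s)"
      by (rule mvt_very_simple[OF that(2)])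
        (use q' that in \<open>auto simp: has_vector_derivative_def intro: has_derivative_subset[where s = "{0..}"]\<close>)
    then obtain x where "q t - q s = (t - s) * (- ((norm (transpose A *v \<eta> x))\<^sup>2))" by auto
    moreover have "(t - s) * ((norm (transpose A *v \<eta> x))\<^sup>2) \<ge> 0" using that by simp
    ultimately show ?thesis by simp
  qed
  have lim: "(q \<longlongrightarrow> 0) at_top"
    using bounded_linear.tendsto[OF lin flow_congruence_tendsto[OF E(3), of K]]
    by (simp add: q_def[abs_def] bounded_bilinear.zero_left[OF bounded_bilinear_matrix_vector])
  have nonneg: "q s \<ge> 0" if "s \<ge> 0" for s
  proof (rule tendsto_upperbound[OF lim])
    show "\<forall>\<^sub>F t in at_top. q t \<le> q s"
      using eventually_ge_at_top[of s] by eventually_elim (use mono that in auto)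
  qed simp
  have "q 0 \<noteq> 0"
  proof
    assume "q 0 = 0"
    then have zero: "q t = 0" if "t \<ge> 0" for t using mono[of 0 t] nonneg[of t] that by auto
    \<comment> \<open>Derivatives within {0..} are unique at every t, including the endpoint 0,
      because this filter is nontrivial.\<close>
    have nb: "at t within {0..} \<noteq> bot" if "t \<ge> 0" for t :: real
    proof -
      have "{t<..} \<subseteq> {0..}" using that by auto
      from at_le[OF this, of t] show ?thesis using trivial_limit_at_right_real[of t] by (auto simp: bot_unique)
    qed
    have A0: "transpose A *v \<eta> t = 0" if "t \<ge> 0" for t
    proof -
      have "(q has_vector_derivative 0) (at t within {0..})"
        by (rule has_vector_derivative_transform[of _ _ _ "\<lambda>_. 0"]) (use that zero in auto)
      from vector_derivative_unique_within[OF nb[OF that] q'[OF that] this] show ?thesis by simp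
    qed
    have "transpose (((\<lambda>P. B ** P) ^^ k) A) *v \<eta> t = 0" if "t \<ge> 0" for k t
      using that
    proof (induction k arbitrary: t)
      case 0
      then show ?case by (simp add: A0)
    next
      case (Suc k)
      let ?X = "((\<lambda>P. B ** P) ^^ k) A"
      have lin': "bounded_linear (\<lambda>P. transpose ?X *v (transpose P *v v))"
        by (intro bounded_linear_compose[OF bounded_bilinear.bounded_linear_right[OF bounded_bilinear_matrix_vector]]
            bounded_linear_compose[OF bounded_bilinear.bounded_linear_left[OF bounded_bilinear_matrix_vector]]
            bounded_linear_transpose)
      \<comment> \<open>Differentiating the identity for B^k A multiplies by B^T on the right of
        \<open>transpose ?X\<close>, which is the identity for B^(k+1) A.\<close>
      have "((\<lambda>t. transpose ?X *v \<eta> t) has_vector_derivative transpose ?X *v (transpose (E t ** B) *v v)) (at t within {0..})"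
        unfolding \<eta>_def by (rule bounded_linear.has_vector_derivative[OF lin' E(2)[OF Suc.prems]])
      moreover have "((\<lambda>t. transpose ?X *v \<eta> t) has_vector_derivative 0) (at t within {0..})"
        by (rule has_vector_derivative_transform[of _ _ _ "\<lambda>_. 0"]) (use Suc in auto)
      ultimately have "transpose ?X *v (transpose (E t ** B) *v v) = 0"
        by (rule vector_derivative_unique_within[OF nb[OF Suc.prems]])
      then show ?case by (simp add: \<eta>_def matrix_transpose_mul matrix_vector_mul_assoc matrix_mul_assoc)
    qed
    from controllable_kernel[OF assms(2) this[of 0]] have "\<eta> 0 = 0" by simp
    with \<open>v \<noteq> 0\<close> show False by (simp add: \<eta>_def E(1) transpose_mat)
  qed
  with nonneg[of 0] have "q 0 > 0" by simp
  then show "v \<bullet> (K *v v) > 0" by (simp add: q_def E(1) transpose_mat)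
qed

lemma lyapunov_solution_exists_unique:
  fixes B A :: "real^'n^'n"
  assumes "hurwitz B" "controllable B A"
  shows "\<exists>!K. lyapunov_solution B A K"
proof -
  obtain K where "B ** K + K ** transpose B = - (A ** transpose A)" by (rule lyapunov_exists[OF assms(1)])
  then have "lyapunov_solution B A K"
    using lyapunov_pos_def[OF assms] by (simp add: lyapunov_solution_def)
  moreover have "K' = K''" if "lyapunov_solution B A K'" "lyapunov_solution B A K''" for K' K''
    using that lyapunov_unique[OF assms(1), of K' _ K''] by (simp add: lyapunov_solution_def)
  ultimately show ?thesis by (intro ex1I[of _ K]) simp_all
qed

section \<open>Block matrices and the singular perturbation limit\<close>

lemma transpose_diff: "transpose (A - B) = transpose A - transpose (B :: real^'n^'m)"
  and transpose_zero: "transpose (0 :: real^'n^'m) = 0"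
  by (simp_all add: transpose_def vec_eq_iff)

lemma matrix_inv_mult:
  assumes "invertible (A :: real^'n^'n)"
  shows "A ** matrix_inv A = mat 1" "matrix_inv A ** A = mat 1"
proof -
  have "A ** matrix_inv A = mat 1 \<and> matrix_inv A ** A = mat 1"
    unfolding matrix_inv_def by (rule someI_ex) (use assms in \<open>simp add: invertible_def\<close>)
  then show "A ** matrix_inv A = mat 1" "matrix_inv A ** A = mat 1" by auto
qed

lemma transpose_matrix_inv:
  assumes "invertible (A :: real^'n^'n)"
  shows "transpose (matrix_inv A) = matrix_inv (transpose A)"
proof -
  have "transpose (A ** matrix_inv A) = mat 1" using matrix_inv_mult[OF assms] by (simp add: transpose_mat)
  then have "transpose (matrix_inv A) ** transpose A = mat 1" by (simp add: matrix_transpose_mul)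
  then have "transpose (matrix_inv A) ** transpose A ** matrix_inv (transpose A) = matrix_inv (transpose A)" by simp
  moreover have "transpose A ** matrix_inv (transpose A) = mat 1"
    by (rule matrix_inv_mult) (simp add: invertible_det_nz assms[unfolded invertible_det_nz])
  ultimately show ?thesis by (metis matrix_mul_assoc matrix_mul_rid)
qed

lemma pos_def_matrix_invertible:
  assumes "pos_def_matrix C"
  shows "invertible C"
proof -
  have "C *v v = 0 \<Longrightarrow> v = 0" for v
    using assms by (metis pos_def_matrix_def inner_zero_right less_irrefl)
  then show ?thesis by (simp add: invertible_left_inverse matrix_left_invertible_ker)
qed

lemma tendsto_det:
  assumes "(C \<longlongrightarrow> C0) F"
  shows "((\<lambda>x. det (C x :: real^'n^'n)) \<longlongrightarrow> det C0) F"
  unfolding det_def by (intro tendsto_intros assms)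

text \<open>Writes each entry of the inverse as a quotient of determinants, so that continuity of
  inversion reduces to continuity of \<open>det\<close>.\<close>

lemma matrix_inv_cramer:
  fixes A :: "real^'n^'n"
  assumes "det A \<noteq> 0"
  shows "matrix_inv A $ i $ j = det (\<chi> k l. if l = i then axis j 1 $ k else A $ k $ l) / det A"
proof -
  have "invertible A" using assms by (simp add: invertible_det_nz)
  then have "A *v (matrix_inv A *v axis j 1) = axis j 1"
    by (simp add: matrix_vector_mul_assoc matrix_inv_mult)
  then have "matrix_inv A *v axis j 1 = (\<chi> k. det (\<chi> m l. if l = k then axis j 1 $ m else A $ m $ l) / det A)"
    by (simp only: cramer[OF assms])
  then show ?thesis by (simp add: matrix_vector_mult_basis column_def vec_eq_iff)
qed

lemma tendsto_matrix_inv: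
  fixes C :: "'a \<Rightarrow> real^'n^'n"
  assumes C: "(C \<longlongrightarrow> C0) F" and inv: "invertible C0"
  shows "((\<lambda>x. matrix_inv (C x)) \<longlongrightarrow> matrix_inv C0) F"
proof (intro vec_tendstoI)
  fix i j
  have d0: "det C0 \<noteq> 0" using inv by (simp add: invertible_det_nz)
  have "((\<lambda>x. det (\<chi> k l. if l = i then axis j 1 $ k else C x $ k $ l) / det (C x)) \<longlongrightarrow>
      det (\<chi> k l. if l = i then axis j 1 $ k else C0 $ k $ l) / det C0) F"
  proof (intro tendsto_divide tendsto_det C d0 vec_tendstoI)
    fix k l
    show "((\<lambda>x. (\<chi> k l. if l = i then axis j 1 $ k else C x $ k $ l) $ k $ l) \<longlongrightarrow>
        (\<chi> k l. if l = i then axis j 1 $ k else C0 $ k $ l) $ k $ l) F"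
      using tendsto_vec_nth[OF tendsto_vec_nth[OF C]] by simp
  qed
  moreover have "\<forall>\<^sub>F x in F. det (C x) \<noteq> 0"
    by (rule tendsto_imp_eventually_ne[OF tendsto_det[OF C] d0])
  ultimately show "((\<lambda>x. matrix_inv (C x) $ i $ j) \<longlongrightarrow> matrix_inv C0 $ i $ j) F"
    by (subst tendsto_cong[where g = "\<lambda>x. det (\<chi> k l. if l = i then axis j 1 $ k else C x $ k $ l) / det (C x)"])
      (auto elim!: eventually_mono simp: matrix_inv_cramer d0)
qed

section \<open>Block calculus and Schur complements\<close>

lemma sum_UNIV_sum:
  "(\<Sum>i\<in>UNIV. f i) = (\<Sum>a\<in>UNIV. f (Inl a)) + (\<Sum>b\<in>UNIV. f (Inr b :: 'm::finite + 'n::finite))"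
  by (subst UNIV_Plus_UNIV[symmetric], subst sum.Plus) (simp_all add: o_def)

lemma all_sum_iff: "(\<forall>i :: 'm + 'n. P i) \<longleftrightarrow> (\<forall>a. P (Inl a)) \<and> (\<forall>b. P (Inr b))"
  by (metis sum.exhaust)

lemma block_matrix_mult:
  "block_matrix P Q R S ** block_matrix P' Q' R' S' =
     block_matrix (P ** P' + Q ** R') (P ** Q' + Q ** S') (R ** P' + S ** R') (R ** Q' + S ** S')"
  by (simp add: vec_eq_iff all_sum_iff block_matrix_def matrix_matrix_mult_def sum_UNIV_sum)

lemma transpose_block_matrix:
  "transpose (block_matrix P Q R S) = block_matrix (transpose P) (transpose R) (transpose Q) (transpose S)"
  by (simp add: vec_eq_iff all_sum_iff block_matrix_def transpose_def)

lemma block_matrix_add: "block_matrix P Q R S + block_matrix P' Q' R' S' = block_matrix (P + P') (Q + Q') (R + R') (S + S')"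
  and block_matrix_uminus: "- block_matrix P Q R S = block_matrix (- P) (- Q) (- R) (- S)"
  and block_matrix_inject: "block_matrix P Q R S = block_matrix P' Q' R' S' \<longleftrightarrow> P = P' \<and> Q = Q' \<and> R = R' \<and> S = S'"
  by (auto simp: vec_eq_iff all_sum_iff block_matrix_def)

lemma block_matrix_exhaust:
  obtains P Q R S where "K = block_matrix P Q R S"
proof
  show "K = block_matrix (\<chi> a c. K $ Inl a $ Inl c) (\<chi> a d. K $ Inl a $ Inr d)
     (\<chi> b c. K $ Inr b $ Inl c) (\<chi> b d. K $ Inr b $ Inr d)"
    by (simp add: vec_eq_iff all_sum_iff block_matrix_def)
qed

lemma block_matrix_vector:
  "block_matrix P Q R S *v join_vec x y = join_vec (P *v x + Q *v y) (R *v x + S *v y)"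
  by (simp add: vec_eq_iff all_sum_iff block_matrix_def join_vec_def matrix_vector_mult_def sum_UNIV_sum)

lemma inner_join_vec: "join_vec x y \<bullet> join_vec x' y' = x \<bullet> x' + y \<bullet> y'"
  by (simp add: inner_vec_def join_vec_def sum_UNIV_sum)

lemma join_vec_eq_0: "join_vec x y = 0 \<longleftrightarrow> x = 0 \<and> y = 0"
  by (simp add: vec_eq_iff all_sum_iff join_vec_def)

lemma join_parts: "join_vec (x_part z) (y_part z) = z" "x_part (join_vec x y) = x" "y_part (join_vec x y) = y"
  by (simp_all add: vec_eq_iff all_sum_iff join_vec_def x_part_def y_part_def)

lemma inner_matrix_transpose: "x \<bullet> (A *v y) = (transpose A *v x) \<bullet> (y :: real^'n)" for A :: "real^'n^'m"
  by (simp add: dot_lmul_matrix transpose_matrix_vector)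

text \<open>Completing the square in a. The identity gives positivity of the Schur complement and,
  later, the factorisation of the Gaussian characteristic function.\<close>

lemma schur_complement_quadratic:
  fixes P :: "real^'m^'m" and S :: "real^'n^'n"
  assumes "transpose P = P" "transpose Q = R" "invertible P"
  defines "H \<equiv> R ** matrix_inv P"
  shows "join_vec a b \<bullet> (block_matrix P Q R S *v join_vec a b) =
    (a + transpose H *v b) \<bullet> (P *v (a + transpose H *v b)) + b \<bullet> ((S - R ** matrix_inv P ** Q) *v b)"
proof -
  have HT: "transpose H = matrix_inv P ** Q"
    using assms by (simp add: H_def matrix_transpose_mul transpose_matrix_inv flip: assms(2))
  have PH: "P ** transpose H = Q"
    by (simp add: HT matrix_mul_assoc matrix_inv_mult[OF assms(3)])
  have "(a + transpose H *v b) \<bullet> (P *v (a + transpose H *v b))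
     = a \<bullet> (P *v a) + a \<bullet> (Q *v b) + (P *v (transpose H *v b)) \<bullet> a + (transpose H *v b) \<bullet> (Q *v b)"
    using inner_matrix_transpose[of "transpose H *v b" P a]
    by (simp add: assms(1) matrix_vector_right_distrib inner_add_left inner_add_right matrix_vector_mul_assoc PH)
  also have "(P *v (transpose H *v b)) \<bullet> a = b \<bullet> (R *v a)"
    by (simp add: matrix_vector_mul_assoc PH inner_matrix_transpose flip: assms(2))
  also have "(transpose H *v b) \<bullet> (Q *v b) = b \<bullet> ((R ** matrix_inv P ** Q) *v b)"
    unfolding inner_matrix_transpose[of b H, symmetric] by (simp add: H_def matrix_vector_mul_assoc)
  finally show ?thesis
    by (simp add: block_matrix_vector inner_join_vec inner_add_right matrix_vector_mult_diff_rdistrib inner_diff_right)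
qed

lemma pos_def_block:
  fixes P :: "real^'m^'m" and S :: "real^'n^'n"
  assumes "pos_def_matrix (block_matrix P Q R S)"
  shows "transpose Q = R" "pos_def_matrix P" "pos_def_matrix (S - R ** matrix_inv P ** Q)"
proof -
  have tr: "transpose P = P" "transpose Q = R" "transpose S = S" "transpose R = Q"
    using assms by (auto simp: pos_def_matrix_def transpose_block_matrix block_matrix_inject)
  show "transpose Q = R" by fact
  have pos: "join_vec x y \<noteq> 0 \<Longrightarrow> join_vec x y \<bullet> (block_matrix P Q R S *v join_vec x y) > 0" for x y
    using assms by (simp add: pos_def_matrix_def)
  show P: "pos_def_matrix P"
    unfolding pos_def_matrix_def
    using pos[of _ 0] tr(1) by (simp add: block_matrix_vector inner_join_vec join_vec_eq_0)
  note inv = pos_def_matrix_invertible[OF P]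
  show "pos_def_matrix (S - R ** matrix_inv P ** Q)"
    unfolding pos_def_matrix_def
  proof (intro conjI allI impI)
    show "transpose (S - R ** matrix_inv P ** Q) = S - R ** matrix_inv P ** Q"
      using tr inv by (simp add: transpose_diff matrix_transpose_mul
          transpose_matrix_inv matrix_mul_assoc)
    fix b :: "real^'n" assume "b \<noteq> 0"
    \<comment> \<open>For given b this choice makes the completed square vanish, leaving only the
      Schur complement.\<close>
    let ?a = "- (transpose (R ** matrix_inv P) *v b)"
    have "0 < join_vec ?a b \<bullet> (block_matrix P Q R S *v join_vec ?a b)"
      by (rule pos) (simp add: join_vec_eq_0 \<open>b \<noteq> 0\<close>)
    also have "\<dots> = b \<bullet> ((S - R ** matrix_inv P ** Q) *v b)"
      by (subst schur_complement_quadratic[OF tr(1,2) inv]) simp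
    finally show "0 < b \<bullet> ((S - R ** matrix_inv P ** Q) *v b)" .
  qed
qed

text \<open>Injectivity gives c |x| \<le> |L x|, and L (k e - k0) = - e N (k e). Splitting k e as (k
  e - k0) + k0 lets half of the left side absorb the unknown part for small e, so boundedness of k e
  comes out of the same estimate.\<close>

lemma linear_perturbation_tendsto:
  fixes L N :: "'a::euclidean_space \<Rightarrow> 'a"
  assumes L: "linear L" "inj L" and N: "linear N"
    and k0: "L k0 = r" and k: "\<And>e. e > 0 \<Longrightarrow> L (k e) + e *\<^sub>R N (k e) = r"
  shows "(k \<longlongrightarrow> k0) (at_right (0::real))"
proof -
  obtain c where c: "c > 0" "\<And>x. c * norm x \<le> norm (L x)"
    using linear_inj_bounded_below_pos[OF L] by blast
  obtain D where D: "D > 0" "\<And>x. norm (N x) \<le> D * norm x"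
    using linear_bounded_pos[OF N] by blast
  \<comment> \<open>The threshold c / (2 D) is what makes e D at most c / 2, the share that can be
    absorbed.\<close>
  have bound: "norm (k e - k0) \<le> e * (2 * D * norm k0 / c)" if e: "e > 0" "e < c / (2 * D)" for e
  proof -
    have "c * norm (k e - k0) \<le> norm (L (k e - k0))" by (rule c)
    also have "L (k e - k0) = - (e *\<^sub>R N (k e))"
      using k[OF e(1)] k0 by (simp add: linear_diff[OF L(1)] algebra_simps)
    also have "norm \<dots> \<le> e * (D * norm (k e))" using D(2)[of "k e"] e by simp
    also have "\<dots> \<le> e * (D * (norm (k e - k0) + norm k0))"
      using e D norm_triangle_ineq[of "k e - k0" k0] by simp
    also have "\<dots> \<le> c / 2 * norm (k e - k0) + e * (D * norm k0)"
      using e D mult_right_mono[of "e * D" "c / 2" "norm (k e - k0)"] by (simp add: field_simps)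
    finally have "c / 2 * norm (k e - k0) \<le> e * (D * norm k0)" by simp
    then show ?thesis using c(1) by (simp add: field_simps)
  qed
  have "((\<lambda>e. e * (2 * D * norm k0 / c)) \<longlongrightarrow> 0) (at_right 0)"
    by (rule tendsto_mult_left_zero[OF tendsto_ident_at])
  moreover have "\<forall>\<^sub>F e in at_right 0. norm (k e - k0) \<le> e * (2 * D * norm k0 / c)"
    unfolding eventually_at_right_field
    by (intro exI[of _ "c / (2 * D)"] conjI allI impI bound) (use c(1) D(1) in auto)
  ultimately have "((\<lambda>e. k e - k0) \<longlongrightarrow> 0) (at_right 0)" by (rule Lim_null_comparison[rotated])
  then show ?thesis by (simp add: LIM_zero_iff)
qed

text \<open>Multiplying the off-diagonal and fast block equations by e removes every 1 / e, also
  from the noise term, whose factor is (1 / sqrt e)^2. The four blocks then solve L k + e N k = r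
  with r independent of e. They are treated as independent unknowns, so that L is an endomorphism of
  one product space.\<close>

lemma slow_fast_covariance_limit:
  fixes B11 A11 P0 :: "real^'nx^'nx" and B12 :: "real^'ny^'nx" and B21 :: "real^'nx^'ny"
    and B22 A22 \<Sigma> :: "real^'ny^'ny"
    and P :: "real \<Rightarrow> real^'nx^'nx" and Q :: "real \<Rightarrow> real^'ny^'nx"
    and R :: "real \<Rightarrow> real^'nx^'ny" and S :: "real \<Rightarrow> real^'ny^'ny"
  defines "H \<equiv> - (matrix_inv B22 ** B21)" and "Beff \<equiv> B11 - B12 ** matrix_inv B22 ** B21"
  assumes h22: "hurwitz B22" and heff: "hurwitz Beff"
    and lyap: "\<And>e. e > 0 \<Longrightarrow>
      block_matrix B11 B12 ((1 / e) *\<^sub>R B21) ((1 / e) *\<^sub>R B22) ** block_matrix (P e) (Q e) (R e) (S e) +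
      block_matrix (P e) (Q e) (R e) (S e) ** transpose (block_matrix B11 B12 ((1 / e) *\<^sub>R B21) ((1 / e) *\<^sub>R B22)) =
      - (block_matrix A11 0 0 ((1 / sqrt e) *\<^sub>R A22) ** transpose (block_matrix A11 0 0 ((1 / sqrt e) *\<^sub>R A22)))"
    and P0: "Beff ** P0 + P0 ** transpose Beff = - (A11 ** transpose A11)"
    and \<Sigma>: "B22 ** \<Sigma> + \<Sigma> ** transpose B22 = - (A22 ** transpose A22)"
  shows "(P \<longlongrightarrow> P0) (at_right 0)" "(Q \<longlongrightarrow> P0 ** transpose H) (at_right 0)"
    "(R \<longlongrightarrow> H ** P0) (at_right 0)" "(S \<longlongrightarrow> H ** P0 ** transpose H + \<Sigma>) (at_right 0)"
proof -
  \<comment> \<open>The rescaled system at e = 0: the slow equation is unchanged, the other three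
    keep only their fast rows.\<close>
  define L where "L = (\<lambda>(p, q, r, s).
    (B11 ** p + B12 ** r + p ** transpose B11 + q ** transpose B12,
     p ** transpose B21 + q ** transpose B22,
     B21 ** p + B22 ** r,
     B21 ** q + B22 ** s + r ** transpose B21 + s ** transpose B22))"
  \<comment> \<open>What the factor e leaves behind: the slow rows in the two off-diagonal
    equations.\<close>
  define N where "N = (\<lambda>(p :: real^'nx^'nx, q :: real^'ny^'nx, r :: real^'nx^'ny, s :: real^'ny^'ny).
    (0 :: real^'nx^'nx, B11 ** q + B12 ** s, r ** transpose B11 + s ** transpose B12, 0 :: real^'ny^'ny))"
  have lin: "linear L" "linear N"
    by (auto simp: linear_iff L_def N_def matrix_mult_linear_simps scaleR_add_right)
  note inv = matrix_inv_mult[OF hurwitz_invertible[OF h22]]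
  have B22H: "B22 ** H = - B21" by (simp add: H_def matrix_mult_linear_simps matrix_mul_assoc inv)
  have HB22: "transpose H ** transpose B22 = - transpose B21"
    by (simp add: B22H transpose_uminus flip: matrix_transpose_mul)
  have eff: "Beff = B11 + B12 ** H" by (simp add: Beff_def H_def matrix_mult_linear_simps matrix_mul_assoc)
  have effT: "transpose Beff = transpose B11 + transpose H ** transpose B12"
    by (simp add: eff transpose_add matrix_transpose_mul)
  \<comment> \<open>Elimination: the third equation gives r = H p and the second q = p H^T, which
    turns the first into the Lyapunov equation of \<open>Beff\<close>, so p = q = r = 0. What
    remains of the fourth is the Lyapunov equation of B22 for s.\<close>
  have "inj L"
    unfolding linear_injective_0[OF lin(1)]
  proof (intro allI impI)
    fix k assume Lk: "L k = 0"
    obtain p q r s where k: "k = (p, q, r, s)" by (cases k) auto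
    from Lk have e1: "B11 ** p + B12 ** r + p ** transpose B11 + q ** transpose B12 = 0"
      and e2: "p ** transpose B21 + q ** transpose B22 = 0" and e3: "B21 ** p + B22 ** r = 0"
      and e4: "B21 ** q + B22 ** s + r ** transpose B21 + s ** transpose B22 = 0"
      by (simp_all add: L_def k zero_prod_def)
    have "matrix_inv B22 ** (B21 ** p + B22 ** r) = 0" by (simp add: e3 matrix_mult_linear_simps)
    then have r: "r = H ** p"
      by (simp add: H_def matrix_mult_linear_simps matrix_mul_assoc inv add_eq_0_iff)
    have "transpose (p ** transpose B21 + q ** transpose B22) = 0"
      by (simp add: e2 transpose_zero)
    then have "matrix_inv B22 ** (B21 ** transpose p + B22 ** transpose q) = 0"
      by (simp add: transpose_add matrix_transpose_mul matrix_mult_linear_simps)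
    then have "transpose q = H ** transpose p"
      by (simp add: H_def matrix_mult_linear_simps matrix_mul_assoc inv add_eq_0_iff)
    then have q: "q = p ** transpose H" by (metis matrix_transpose_mul transpose_transpose)
    have "Beff ** p + p ** transpose Beff = 0"
      using e1 by (simp add: eff effT[unfolded eff] r q matrix_mult_linear_simps matrix_mul_assoc algebra_simps)
    from lyapunov_homogeneous[OF heff this] have "p = 0" .
    with q r have qr: "q = 0" "r = 0" by (simp_all add: matrix_mult_linear_simps)
    have "B22 ** s + s ** transpose B22 = 0"
      using e4 by (simp add: qr matrix_mult_linear_simps)
    from lyapunov_homogeneous[OF h22 this] have "s = 0" .
    with qr \<open>p = 0\<close> show "k = 0" by (simp add: k zero_prod_def)
  qed
  \<comment> \<open>The candidate is the covariance of (x, H x + v) with x of covariance P0 and v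
    independent of covariance \<open>\<Sigma>\<close>. It solves the system because B22 H = - B21
    cancels all mixed terms.\<close>
  moreover have "L (P0, P0 ** transpose H, H ** P0, H ** P0 ** transpose H + \<Sigma>) =
      (- (A11 ** transpose A11), 0, 0, - (A22 ** transpose A22))"
  proof -
    have "B22 ** H ** P0 = - (B21 ** P0)" "B22 ** H ** P0 ** transpose H = - (B21 ** P0 ** transpose H)"
      by (simp_all add: B22H matrix_mult_linear_simps)
    moreover have "P0 ** transpose H ** transpose B22 = - (P0 ** transpose B21)"
      "H ** P0 ** transpose H ** transpose B22 = - (H ** P0 ** transpose B21)"
      by (simp_all add: HB22 matrix_mult_linear_simps flip: matrix_mul_assoc)
    ultimately show ?thesis
      using P0 \<Sigma>
      by (simp add: L_def matrix_mult_linear_simps matrix_mul_assoc eff effT[unfolded eff] algebra_simps)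
  qed
  moreover have "L (P e, Q e, R e, S e) + e *\<^sub>R N (P e, Q e, R e, S e) =
      (- (A11 ** transpose A11), 0, 0, - (A22 ** transpose A22))" if e: "e > 0" for e
  proof -
    let ?p = "P e" and ?q = "Q e" and ?r = "R e" and ?s = "S e"
    from lyap[OF e] have
      1: "B11 ** ?p + B12 ** ?r + (?p ** transpose B11 + ?q ** transpose B12) = - (A11 ** transpose A11)" and
      2: "B11 ** ?q + B12 ** ?s + (1 / e) *\<^sub>R (?p ** transpose B21 + ?q ** transpose B22) = 0" and
      3: "(1 / e) *\<^sub>R (B21 ** ?p + B22 ** ?r) + (?r ** transpose B11 + ?s ** transpose B12) = 0" and
      4: "(1 / e) *\<^sub>R (B21 ** ?q + B22 ** ?s) + (1 / e) *\<^sub>R (?r ** transpose B21 + ?s ** transpose B22) =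
        - ((1 / sqrt e * (1 / sqrt e)) *\<^sub>R (A22 ** transpose A22))"
      by (simp_all add: block_matrix_mult transpose_block_matrix block_matrix_add block_matrix_uminus
          block_matrix_inject matrix_mult_linear_simps transpose_scaleR scaleR_add_right
          transpose_zero)
    have "e *\<^sub>R (B11 ** ?q + B12 ** ?s + (1 / e) *\<^sub>R (?p ** transpose B21 + ?q ** transpose B22)) = 0"
      "e *\<^sub>R ((1 / e) *\<^sub>R (B21 ** ?p + B22 ** ?r) + (?r ** transpose B11 + ?s ** transpose B12)) = 0"
      "e *\<^sub>R ((1 / e) *\<^sub>R (B21 ** ?q + B22 ** ?s) + (1 / e) *\<^sub>R (?r ** transpose B21 + ?s ** transpose B22)) =
         e *\<^sub>R (- ((1 / e) *\<^sub>R (A22 ** transpose A22)))"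
      unfolding 2 3 4 using e by simp_all
    with 1 e show ?thesis
      by (simp add: L_def N_def scaleR_add_right algebra_simps)
  qed
  ultimately have "((\<lambda>e. (P e, Q e, R e, S e)) \<longlongrightarrow> (P0, P0 ** transpose H, H ** P0, H ** P0 ** transpose H + \<Sigma>)) (at_right 0)"
    by (intro linear_perturbation_tendsto[OF lin(1) _ lin(2)])
  note lims = tendsto_fst[OF this] tendsto_fst[OF tendsto_snd[OF this]]
    tendsto_fst[OF tendsto_snd[OF tendsto_snd[OF this]]] tendsto_snd[OF tendsto_snd[OF tendsto_snd[OF this]]]
  from lims show "(P \<longlongrightarrow> P0) (at_right 0)" "(Q \<longlongrightarrow> P0 ** transpose H) (at_right 0)"
    "(R \<longlongrightarrow> H ** P0) (at_right 0)" "(S \<longlongrightarrow> H ** P0 ** transpose H + \<Sigma>) (at_right 0)"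
    by simp_all
qed

text \<open>The contribution H P0 H^T of the slow variable to the fast covariance is exactly what
  the Schur complement subtracts.\<close>

lemma conditional_parameters_limit:
  fixes P0 :: "real^'nx^'nx" and H :: "real^'nx^'ny"
  assumes lims: "(P \<longlongrightarrow> P0) F" "(Q \<longlongrightarrow> P0 ** transpose H) F" "(R \<longlongrightarrow> H ** P0) F"
      "(S \<longlongrightarrow> H ** P0 ** transpose H + \<Sigma>) F" and inv: "invertible P0"
  shows "((\<lambda>e. R e ** matrix_inv (P e)) \<longlongrightarrow> H) F"
    "((\<lambda>e. S e - R e ** matrix_inv (P e) ** Q e) \<longlongrightarrow> \<Sigma>) F"
proof -
  note mm = bounded_bilinear.tendsto[OF bounded_bilinear_matrix_mult]
  have "((\<lambda>e. R e ** matrix_inv (P e)) \<longlongrightarrow> H ** P0 ** matrix_inv P0) F"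
    by (intro mm tendsto_matrix_inv lims inv)
  then show H: "((\<lambda>e. R e ** matrix_inv (P e)) \<longlongrightarrow> H) F"
    by (simp add: matrix_inv_mult[OF inv] flip: matrix_mul_assoc)
  have "((\<lambda>e. S e - R e ** matrix_inv (P e) ** Q e) \<longlongrightarrow> H ** P0 ** transpose H + \<Sigma> - H ** (P0 ** transpose H)) F"
    by (intro tendsto_diff mm lims H)
  then show "((\<lambda>e. S e - R e ** matrix_inv (P e) ** Q e) \<longlongrightarrow> \<Sigma>) F"
    by (simp add: matrix_mul_assoc)
qed

section \<open>Lebesgue measure under linear maps\<close>

text \<open>Integrate over coordinate b first. With the other coordinates fixed, the shear is a
  translation by the value of coordinate c, which does not change because b and c differ.\<close>

lemma distr_lborel_shear:
  fixes b c :: "'a::euclidean_space"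
  assumes "b \<in> Basis" "c \<in> Basis" "b \<noteq> c"
  shows "distr lborel borel (\<lambda>x. x + (x \<bullet> c) *\<^sub>R b) = lborel" (is "distr _ _ ?E = _")
proof (rule measure_eqI)
  fix S :: "'a set" assume "S \<in> sets (distr lborel borel ?E)"
  then have [measurable]: "S \<in> sets borel" by simp
  let ?f = "indicator S :: 'a \<Rightarrow> ennreal"
  define I where "I = Basis - {b}"
  have I: "finite I" "b \<notin> I" "Basis = insert b I" using assms by (auto simp: I_def)
  define T where "T g = (\<Sum>i\<in>Basis. g i *\<^sub>R i)" for g :: "'a \<Rightarrow> real"
  interpret product_sigma_finite "\<lambda>_::'a. lborel :: real measure" ..
  have T[measurable]: "T \<in> borel_measurable (PiM (insert b I) (\<lambda>_. lborel))"
    unfolding T_def I(3) by measurable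
  have Tb: "T (x(b := y)) = y *\<^sub>R b + (\<Sum>i\<in>I. x i *\<^sub>R i)" for x y
    unfolding T_def I(3) using I(1,2) by (auto intro!: sum.cong)
  have ins: "integral\<^sup>N (lborel :: 'a measure) h = (\<integral>\<^sup>+x. (\<integral>\<^sup>+y. h (T (x(b := y))) \<partial>lborel) \<partial>PiM I (\<lambda>_. lborel))"
    if [measurable]: "h \<in> borel_measurable borel" for h
  proof -
    have "integral\<^sup>N (lborel :: 'a measure) h = integral\<^sup>N (distr (PiM Basis (\<lambda>_. lborel)) borel T) h"
      by (simp add: lborel_eq[symmetric] T_def[abs_def])
    also have "\<dots> = (\<integral>\<^sup>+g. h (T g) \<partial>PiM (insert b I) (\<lambda>_. lborel))"
      unfolding I(3) by (rule nn_integral_distr) simp_all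
    also have "\<dots> = (\<integral>\<^sup>+x. (\<integral>\<^sup>+y. h (T (x(b := y))) \<partial>lborel) \<partial>PiM I (\<lambda>_. lborel))"
      by (rule product_nn_integral_insert[OF I(1,2)]) simp
    finally show ?thesis .
  qed
  have "emeasure (distr lborel borel ?E) S = (\<integral>\<^sup>+x. ?f (?E x) \<partial>lborel)"
    by (simp add: nn_integral_indicator[symmetric] nn_integral_distr del: nn_integral_indicator)
  also have "\<dots> = (\<integral>\<^sup>+x. (\<integral>\<^sup>+y. ?f (?E (T (x(b := y)))) \<partial>lborel) \<partial>PiM I (\<lambda>_. lborel))"
    by (rule ins) simp
  also have "\<dots> = (\<integral>\<^sup>+x. (\<integral>\<^sup>+y. ?f (T (x(b := x c + 1 * y))) \<partial>lborel) \<partial>PiM I (\<lambda>_. lborel))"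
  proof -
    have "?E (T (x(b := y))) = T (x(b := x c + 1 * y))" for x y
    proof -
      have "T (x(b := y)) \<bullet> c = x c"
        using assms by (simp add: T_def inner_sum_left inner_Basis if_distrib[of "\<lambda>x. _ * x"] sum.delta cong: if_cong)
      then show ?thesis by (simp add: Tb algebra_simps)
    qed
    then show ?thesis by simp
  qed
  also have "\<dots> = (\<integral>\<^sup>+x. (\<integral>\<^sup>+y. ?f (T (x(b := y))) \<partial>lborel) \<partial>PiM I (\<lambda>_. lborel))"
  proof (rule nn_integral_cong)
    fix x
    have [measurable]: "(\<lambda>y. ?f (T (x(b := y)))) \<in> borel_measurable borel"
      unfolding Tb by measurable
    show "(\<integral>\<^sup>+y. ?f (T (x(b := x c + 1 * y))) \<partial>lborel) = (\<integral>\<^sup>+y. ?f (T (x(b := y))) \<partial>lborel)"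
      by (subst (2) nn_integral_real_affine[of _ 1 "x c"]) simp_all
  qed
  also have "\<dots> = integral\<^sup>N lborel ?f" by (rule ins[symmetric]) simp
  finally show "emeasure (distr lborel borel ?E) S = emeasure lborel S" by simp
qed simp

text \<open>The preimage of a box is the box with permuted corners, of the same volume, and Lebesgue
  measure is determined by boxes.\<close>

lemma distr_lborel_permute:
  fixes p :: "'a::euclidean_space \<Rightarrow> 'a"
  assumes p: "bij_betw p Basis Basis"
  shows "distr lborel borel (\<lambda>x. \<Sum>b\<in>Basis. (x \<bullet> p b) *\<^sub>R b) = lborel"
proof (rule lborel_eqI[symmetric])
  fix l u :: 'a assume le: "\<And>b. b \<in> Basis \<Longrightarrow> l \<bullet> b \<le> u \<bullet> b"
  let ?q = "inv_into Basis p"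
  let ?m = "\<lambda>v :: 'a. \<Sum>b\<in>Basis. (v \<bullet> ?q b) *\<^sub>R b"
  have q: "bij_betw ?q Basis Basis" by (rule bij_betw_inv_into[OF p])
  have pB: "p b \<in> Basis" "?q b \<in> Basis" "?q (p b) = b" "p (?q b) = b" if "b \<in> Basis" for b
    using p q that by (auto simp: bij_betwE bij_betw_inv_into_left bij_betw_inv_into_right)
  have m: "?m v \<bullet> b = v \<bullet> ?q b" if "b \<in> Basis" for v b
    using that by (simp add: inner_sum_left inner_Basis if_distrib[of "\<lambda>x. _ * x"] sum.delta cong: if_cong)
  have vi: "(\<lambda>x. \<Sum>b\<in>Basis. (x \<bullet> p b) *\<^sub>R b) -` box l u = box (?m l) (?m u)"
  proof -
    have "(\<forall>b\<in>Basis. l \<bullet> b < x \<bullet> p b \<and> x \<bullet> p b < u \<bullet> b) \<longleftrightarrow> (\<forall>b\<in>Basis. l \<bullet> ?q b < x \<bullet> b \<and> x \<bullet> b < u \<bullet> ?q b)" for x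
      by (metis pB)
    then show ?thesis by (auto simp: box_def m)
  qed
  have "emeasure (distr lborel borel (\<lambda>x. \<Sum>b\<in>Basis. (x \<bullet> p b) *\<^sub>R b)) (box l u) = emeasure lborel (box (?m l) (?m u))"
    by (simp add: emeasure_distr vi)
  also have "\<dots> = ennreal (\<Prod>b\<in>Basis. (u - l) \<bullet> ?q b)"
    using le pB by (simp add: emeasure_lborel_box_eq m inner_diff_left)
  also have "(\<Prod>b\<in>Basis. (u - l) \<bullet> ?q b) = (\<Prod>b\<in>Basis. (u - l) \<bullet> b)"
    by (rule prod.reindex_bij_betw[OF q])
  finally show "emeasure (distr lborel borel (\<lambda>x. \<Sum>b\<in>Basis. (x \<bullet> p b) *\<^sub>R b)) (box l u) = ennreal (\<Prod>b\<in>Basis. (u - l) \<bullet> b)" .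
qed simp

lemma Basis_cart: "(Basis :: (real^'n) set) = range (\<lambda>i. axis i 1)"
  by (auto simp: Basis_vec_def)

lemma sum_Basis_cart: "(\<Sum>b\<in>Basis. f b) = (\<Sum>i\<in>UNIV. f (axis i 1 :: real^'n))"
  and prod_Basis_cart: "(\<Prod>b\<in>Basis. g b) = (\<Prod>i\<in>UNIV. g (axis i 1 :: real^'n))"
  unfolding Basis_cart by (subst sum.reindex prod.reindex; simp add: inj_on_def axis_eq_axis)+

lemma sum_axis: "(\<Sum>i\<in>UNIV. f i *\<^sub>R axis i (1::real)) = (\<chi> i. f i)"
  by (simp add: vec_eq_iff axis_def if_distrib[of "\<lambda>x. _ * x"] cong: if_cong)

text \<open>A matrix is decomposed into diagonal, swap and shear factors (or has a zero row). In the
  density form the factors |det| simply multiply when two maps are composed.\<close>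

theorem lborel_eq_density_distr_linear:
  fixes A :: "real^'n^'n"
  assumes "invertible A"
  shows "lborel = density (distr lborel borel ((*v) A)) (\<lambda>_. ennreal \<bar>det A\<bar>)"
proof -
  have [measurable]: "(*v) A \<in> borel_measurable borel" for A :: "real^'n^'n"
    by (intro borel_measurable_continuous_onI linear_continuous_on matrix_vector_mul_bounded_linear)
  \<comment> \<open>Invertibility is part of the induction statement: a product passes it on to both
    factors, and the case of a zero row contradicts it.\<close>
  have "invertible A \<longrightarrow> lborel = density (distr lborel borel ((*v) A)) (\<lambda>_. ennreal \<bar>det A\<bar>)"
  proof (rule induct_matrix_elementary_alt; (intro impI)?)
    fix A B :: "real^'n^'n"
    assume A: "invertible A \<longrightarrow> lborel = density (distr lborel borel ((*v) A)) (\<lambda>_. ennreal \<bar>det A\<bar>)"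
      and B: "invertible B \<longrightarrow> lborel = density (distr lborel borel ((*v) B)) (\<lambda>_. ennreal \<bar>det B\<bar>)"
      and AB: "invertible (A ** B)"
    from AB have inv: "invertible A" "invertible B" by (auto simp: invertible_det_nz det_mul)
    have "density (distr lborel borel ((*v) (A ** B))) (\<lambda>_. ennreal \<bar>det (A ** B)\<bar>)
        = density (distr (distr lborel borel ((*v) B)) borel ((*v) A)) (\<lambda>_. ennreal \<bar>det B\<bar> * ennreal \<bar>det A\<bar>)"
      by (simp add: distr_distr o_def matrix_vector_mul_assoc det_mul abs_mult ennreal_mult'' mult.commute)
    also have "\<dots> = density (density (distr (distr lborel borel ((*v) B)) borel ((*v) A)) (\<lambda>_. ennreal \<bar>det B\<bar>)) (\<lambda>_. ennreal \<bar>det A\<bar>)"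
      by (rule density_density_eq[symmetric]) simp_all
    also have "density (distr (distr lborel borel ((*v) B)) borel ((*v) A)) (\<lambda>_. ennreal \<bar>det B\<bar>)
        = distr (density (distr lborel borel ((*v) B)) (\<lambda>_. ennreal \<bar>det B\<bar>)) borel ((*v) A)"
      by (rule density_distr) simp_all
    also have "density (distr lborel borel ((*v) B)) (\<lambda>_. ennreal \<bar>det B\<bar>) = lborel"
      using B inv by simp
    finally show "lborel = density (distr lborel borel ((*v) (A ** B))) (\<lambda>_. ennreal \<bar>det (A ** B)\<bar>)"
      using A inv by simp
  next
    fix A :: "real^'n^'n" and i assume "row i A = 0" "invertible A"
    then show "lborel = density (distr lborel borel ((*v) A)) (\<lambda>_. ennreal \<bar>det A\<bar>)"
      by (simp add: invertible_det_nz det_zero_row)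
  next
    fix A :: "real^'n^'n"
    assume diag: "\<And>i j. i \<noteq> j \<Longrightarrow> A $ i $ j = 0" and inv: "invertible A"
    let ?c = "\<lambda>b. b \<bullet> (A *v b)"
    have c: "?c (axis i 1) = A $ i $ i" for i
      by (simp add: inner_axis' matrix_vector_mult_basis column_def)
    have det: "det A = (\<Prod>i\<in>UNIV. A $ i $ i)" by (rule det_diagonal) (rule diag)
    have nz: "A $ i $ i \<noteq> 0" for i using inv by (simp add: invertible_det_nz det)
    have Ax: "A *v x = (\<Sum>j\<in>Basis. (?c j * (x \<bullet> j)) *\<^sub>R j)" for x
    proof -
      have "(\<Sum>j\<in>UNIV. A $ i $ j * x $ j) = (\<Sum>j\<in>UNIV. if j = i then A $ i $ i * x $ i else 0)" for i
        by (rule sum.cong) (auto simp: diag)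
      then have "A *v x = (\<chi> i. A $ i $ i * x $ i)" by (simp add: vec_eq_iff matrix_vector_mult_def)
      then show ?thesis by (simp add: sum_Basis_cart sum_axis c inner_axis del: matrix_vector_mult_basis)
    qed
    have A: "(*v) A = (\<lambda>x. 0 + (\<Sum>j\<in>Basis. (?c j * (x \<bullet> j)) *\<^sub>R j))"
      unfolding add_0 by (rule ext) (rule Ax)
    have "\<bar>det A\<bar> = (\<Prod>j\<in>Basis. \<bar>?c j\<bar>)" by (simp only: prod_Basis_cart c det abs_prod)
    then have "ennreal \<bar>det A\<bar> = (\<Prod>j\<in>Basis. ennreal \<bar>?c j\<bar>)" by (simp add: prod_ennreal)
    moreover have "?c j \<noteq> 0" if "j \<in> Basis" for j using that nz c by (auto simp only: Basis_cart)
    ultimately show "lborel = density (distr lborel borel ((*v) A)) (\<lambda>_. ennreal \<bar>det A\<bar>)"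
      using lborel_affine_euclidean[of ?c 0, folded A] by (simp add: prod_ennreal)
  next
    fix m n :: 'n assume "m \<noteq> n"
    let ?A = "\<chi> i j. mat 1 $ i $ Transposition.transpose m n j :: real^'n^'n"
    let ?p = "\<lambda>b :: real^'n. \<chi> i. b $ Transposition.transpose m n i"
    have "\<bar>det ?A\<bar> = 1"
      by (simp add: det_permute_columns permutes_swap_id sign_swap_id abs_mult)
    moreover have "distr lborel borel ((*v) ?A) = lborel"
    proof -
      have p: "?p (axis i 1) = axis (Transposition.transpose m n i) 1" for i
        by (auto simp: vec_eq_iff axis_def Transposition.transpose_def)
      have tr: "(\<Sum>j\<in>UNIV. if i = Transposition.transpose m n j then x $ j else 0) = x $ Transposition.transpose m n i" for i and x :: "real^'n"
      proof -
        have "(\<Sum>j\<in>UNIV. if i = Transposition.transpose m n j then x $ j else 0) =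
            (\<Sum>j\<in>UNIV. if j = Transposition.transpose m n i then x $ j else 0)"
          by (rule sum.cong) auto
        then show ?thesis by simp
      qed
      have Ax: "?A *v x = (\<Sum>b\<in>Basis. (x \<bullet> ?p b) *\<^sub>R b)" for x
        unfolding sum_Basis_cart p sum_axis
        by (simp add: inner_axis vec_eq_iff matrix_vector_mult_def mat_def if_distrib[of "\<lambda>x. x * _"] cong: if_cong)
          (simp add: tr)
      have "(*v) ?A = (\<lambda>x. \<Sum>b\<in>Basis. (x \<bullet> ?p b) *\<^sub>R b)" by (rule ext) (rule Ax)
      moreover have "bij_betw ?p Basis Basis"
        by (rule bij_betwI[of _ _ _ ?p]) (auto simp: Basis_cart p vec_eq_iff simp del: axis_eq_axis)
      ultimately show ?thesis by (simp only: distr_lborel_permute)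
    qed
    ultimately show "lborel = density (distr lborel borel ((*v) ?A)) (\<lambda>_. ennreal \<bar>det ?A\<bar>)"
      by (simp add: density_1)
  next
    fix m n :: 'n assume mn: "m \<noteq> n"
    let ?A = "\<chi> i j. of_bool (i = m \<and> j = n \<or> i = j) :: real^'n^'n"
    have "det ?A = det (\<chi> k. if k = m then row m (mat 1) + 1 *s row n (mat 1) else row k (mat 1 :: real^'n^'n))"
      by (rule arg_cong[of _ _ det]) (use mn in \<open>auto simp: vec_eq_iff row_def mat_def\<close>)
    also have "\<dots> = 1" by (subst det_row_operation[OF mn]) simp
    finally have "det ?A = 1" .
    moreover have Ax: "?A *v x = x + (x \<bullet> axis n 1) *\<^sub>R axis m 1" for x
    proof -
      have "(\<Sum>j\<in>UNIV. of_bool (i = m \<and> j = n \<or> i = j) * x $ j) = (\<Sum>j\<in>UNIV. (if j = i then x $ i else 0) + (if j = n then if i = m then x $ n else 0 else 0))" for i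
        by (rule sum.cong) (use mn in auto)
      then show ?thesis
        by (simp add: vec_eq_iff matrix_vector_mult_def inner_axis sum.distrib) (simp add: axis_def)
    qed
    have "(*v) ?A = (\<lambda>x. x + (x \<bullet> axis n 1) *\<^sub>R axis m 1)" by (rule ext) (rule Ax)
    then have "distr lborel borel ((*v) ?A) = lborel"
      using distr_lborel_shear[of "axis m 1 :: real^'n" "axis n 1"] mn by (simp add: axis_eq_axis Basis_cart)
    ultimately show "lborel = density (distr lborel borel ((*v) ?A)) (\<lambda>_. ennreal \<bar>det ?A\<bar>)"
      by (simp add: density_1)
  qed
  with assms show ?thesis by blast
qed

section \<open>Gaussian measures\<close>

lemma mat_vector: "mat s *v v = s *\<^sub>R (v :: real^'n)"
  by (simp add: vec_eq_iff mat_def matrix_vector_mult_def if_distrib[of "\<lambda>x. x * _"] cong: if_cong)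

lemma mat_mult_mat: "mat s ** mat t = (mat (s * t) :: real^'n^'n)"
  by (rule matrix_eq[THEN iffD2]) (simp add: mat_vector flip: matrix_vector_mul_assoc)

lemma det_mat: "det (mat s :: real^'n^'n) = s ^ CARD('n)"
  by (subst det_diagonal) (auto simp: mat_def)

lemma matrix_inv_unique:
  fixes A B :: "real^'n^'n"
  assumes "A ** B = mat 1" "B ** A = mat 1"
  shows "matrix_inv A = B"
proof -
  have "invertible A" using assms by (auto simp: invertible_def)
  then have "matrix_inv A ** A ** B = B" by (simp add: matrix_inv_mult)
  then show ?thesis by (simp add: assms(1) flip: matrix_mul_assoc)
qed

lemma matrix_inv_mat: "s \<noteq> 0 \<Longrightarrow> matrix_inv (mat s :: real^'n^'n) = mat (1 / s)"
  by (rule matrix_inv_unique) (simp_all add: mat_mult_mat)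

lemma pos_def_mat: "s > 0 \<Longrightarrow> pos_def_matrix (mat s :: real^'n^'n)"
  by (simp add: pos_def_matrix_def transpose_mat mat_vector)

lemma borel_measurable_matrix_vector[measurable]: "(*v) (A :: real^'n^'m) \<in> borel_measurable borel"
  by (intro borel_measurable_continuous_onI linear_continuous_on matrix_vector_mul_bounded_linear)

text \<open>Gram-Schmidt for the inner product of C. Fewer than n vectors C u_i leave a nonzero v
  orthogonal to all of them, and v is then normalised in the C-norm.\<close>

lemma pos_def_matrix_orthonormal:
  fixes C :: "real^'n^'n"
  assumes C: "pos_def_matrix C"
  shows "\<exists>u. \<forall>i\<in>I. \<forall>j\<in>(I :: 'n set). u i \<bullet> (C *v u j) = (if i = j then 1 else 0)"
proof -
  have "finite I" by simp
  then show ?thesis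
  proof (induction I)
    case (insert k I)
    then obtain u where u: "\<forall>i\<in>I. \<forall>j\<in>I. u i \<bullet> (C *v u j) = (if i = j then 1 else 0)" by blast
    have "card ((\<lambda>i. C *v u i) ` I) \<le> card I" by (rule card_image_le) simp
    also have "card I < CARD('n)" using insert.hyps by (intro psubset_card_mono) auto
    finally have "dim ((\<lambda>i. C *v u i) ` I) < DIM(real^'n)"
      using dim_le_card'[of "(\<lambda>i. C *v u i) ` I"] by simp
    then obtain v where v: "v \<noteq> 0" "\<And>x. x \<in> span ((\<lambda>i. C *v u i) ` I) \<Longrightarrow> orthogonal v x"
      by (rule orthogonal_to_subspace_exists) blast
    have vi: "v \<bullet> (C *v u i) = 0" if "i \<in> I" for i
      using v(2)[of "C *v u i"] that by (simp add: orthogonal_def span_base)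
    have sym: "x \<bullet> (C *v y) = y \<bullet> (C *v x)" for x y
      using C by (metis inner_matrix_transpose pos_def_matrix_def inner_commute)
    have pos: "v \<bullet> (C *v v) > 0" using C v(1) by (simp add: pos_def_matrix_def)
    define w where "w = (1 / sqrt (v \<bullet> (C *v v))) *\<^sub>R v"
    have "w \<bullet> (C *v w) = 1"
      using pos by (simp add: w_def matrix_vector_mult_scaleR real_sqrt_mult_self field_simps flip: power2_eq_square)
    moreover have "w \<bullet> (C *v u i) = 0" "u i \<bullet> (C *v w) = 0" if "i \<in> I" for i
      using vi[OF that] sym[of "u i" w] by (simp_all add: w_def)
    ultimately show ?case
      using u insert.hyps by (intro exI[of _ "u(k := w)"]) auto
  qed simp
qed

text \<open>With a C-orthonormal basis as the rows of U one has U C U^T = 1, so L = U^-1 serves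
  where a Cholesky factor would be used.\<close>

lemma pos_def_matrix_factor:
  fixes C :: "real^'n^'n"
  assumes C: "pos_def_matrix C"
  shows "\<exists>L :: real^'n^'n. invertible L \<and> C = L ** transpose L"
proof -
  obtain u where u: "\<And>i j :: 'n. u i \<bullet> (C *v u j) = (if i = j then 1 else 0)"
    using pos_def_matrix_orthonormal[OF C, of UNIV] by auto
  define U where "U = (\<chi> i. u i)"
  have "(U ** C ** transpose U) $ i $ j = u i \<bullet> (C *v u j)" for i j
    unfolding U_def
    by (simp add: matrix_matrix_mult_def matrix_vector_mult_def transpose_def inner_vec_def
        sum_distrib_left sum_distrib_right mult.assoc) (rule sum.swap)
  then have UCU: "U ** C ** transpose U = mat 1" by (simp add: vec_eq_iff u mat_def)
  then have "det (U ** C ** transpose U) = 1" by simp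
  then have "det U \<noteq> 0" by (auto simp: det_mul)
  then have inv: "invertible U" by (simp add: invertible_det_nz)
  have "det (matrix_inv U) * det U = 1"
    by (metis det_I det_mul matrix_inv_mult(2)[OF inv])
  then have "invertible (matrix_inv U)" by (auto simp: invertible_det_nz)
  moreover have "C = matrix_inv U ** transpose (matrix_inv U)"
  proof -
    have "transpose U ** transpose (matrix_inv U) = mat 1"
      by (metis matrix_inv_mult(2)[OF inv] matrix_transpose_mul transpose_mat)
    then have "matrix_inv U ** (U ** C ** transpose U) ** transpose (matrix_inv U) = C"
      by (metis matrix_inv_mult(2)[OF inv] matrix_mul_assoc matrix_mul_lid matrix_mul_rid)
    then show ?thesis by (simp add: UCU)
  qed
  ultimately show ?thesis by blast
qed

section \<open>Standard Gaussian measure, affine images and characteristic functions\<close>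

definition std_gaussian :: "(real^'n) measure" where
  "std_gaussian = gaussian_measure 0 (mat 1)"

lemma std_normal_density_prod:
  "exp (- (x \<bullet> x) / 2) / sqrt ((2 * pi) ^ CARD('n)) = (\<Prod>b\<in>Basis. std_normal_density (x \<bullet> b))" for x :: "real^'n"
proof -
  have "(\<Prod>b\<in>Basis. std_normal_density (x \<bullet> b)) = (\<Prod>b\<in>(Basis :: (real^'n) set). 1 / sqrt (2 * pi)) * (\<Prod>b\<in>Basis. exp (- (x \<bullet> b)\<^sup>2 / 2))"
    unfolding std_normal_density_def prod.distrib ..
  also have "(\<Prod>b\<in>Basis. exp (- (x \<bullet> b)\<^sup>2 / 2)) = exp (- (x \<bullet> x) / 2)"
    by (subst exp_sum[symmetric]) (simp_all add: euclidean_inner[of x x] power2_eq_square sum_negf flip: sum_divide_distrib)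
  also have "(\<Prod>b\<in>(Basis :: (real^'n) set). 1 / sqrt (2 * pi)) = 1 / sqrt ((2 * pi) ^ CARD('n))"
    unfolding real_sqrt_power by (simp add: power_one_over)
  finally show ?thesis by simp
qed

lemma std_gaussian_density:
  "std_gaussian = density lborel (\<lambda>x :: real^'n. ennreal (\<Prod>b\<in>Basis. std_normal_density (x \<bullet> b)))"
  by (simp add: std_gaussian_def gaussian_measure_def matrix_inv_mat flip: std_normal_density_prod)

lemma sets_gaussian_measure[measurable_cong]: "sets (gaussian_measure m C) = sets borel"
  and space_gaussian_measure[simp]: "space (gaussian_measure m C) = UNIV"
  by (simp_all add: gaussian_measure_def)

lemma sets_std_gaussian[measurable_cong]: "sets std_gaussian = sets borel"
  and space_std_gaussian[simp]: "space std_gaussian = UNIV"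
  by (simp_all add: std_gaussian_def sets_gaussian_measure)

lemma prob_space_std_gaussian: "prob_space (std_gaussian :: (real^'n) measure)"
proof
  have "emeasure (std_gaussian :: (real^'n) measure) UNIV = (\<integral>\<^sup>+x. (\<Prod>b\<in>Basis. ennreal (std_normal_density (x \<bullet> b))) \<partial>(lborel :: (real^'n) measure))"
    by (simp add: std_gaussian_density emeasure_density prod_ennreal)
  also have "\<dots> = (\<Prod>b\<in>(Basis :: (real^'n) set). \<integral>\<^sup>+x. ennreal (std_normal_density x) \<partial>lborel)"
    by (rule nn_integral_lborel_prod) auto
  also have "(\<integral>\<^sup>+x. ennreal (std_normal_density x) \<partial>lborel) = 1"
  proof -
    interpret prob_space std_normal_distribution using real_dist_normal_dist by (simp add: real_distribution_def)
    show ?thesis using emeasure_space_1 by (simp add: emeasure_density)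
  qed
  finally show "emeasure (std_gaussian :: (real^'n) measure) (space std_gaussian) = 1" by simp
qed

definition vchar :: "(real^'n) measure \<Rightarrow> real^'n \<Rightarrow> complex" where
  "vchar \<mu> \<xi> = (CLINT x|\<mu>. iexp (\<xi> \<bullet> x))"

text \<open>Both the density and the exponential factor over the coordinates, which leaves a product
  of one-dimensional standard normal characteristic functions.\<close>

lemma vchar_std_gaussian: "vchar std_gaussian \<xi> = of_real (exp (- (\<xi> \<bullet> \<xi>) / 2))" for \<xi> :: "real^'n"
proof -
  let ?f = "\<lambda>b x. std_normal_density x *\<^sub>R iexp ((\<xi> \<bullet> b) * x)"
  interpret N: prob_space std_normal_distribution using real_dist_normal_dist by (simp add: real_distribution_def)
  have int: "integrable lborel (?f b)" for b
  proof -
    have "integrable std_normal_distribution (\<lambda>x. iexp ((\<xi> \<bullet> b) * x))"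
      by (rule N.integrable_iexp) auto
    then show ?thesis by (subst (asm) integrable_density) auto
  qed
  have one: "(CLINT x|lborel. ?f b x) = of_real (exp (- (\<xi> \<bullet> b)\<^sup>2 / 2))" for b
  proof -
    have "char std_normal_distribution (\<xi> \<bullet> b) = (CLINT x|lborel. ?f b x)"
      unfolding char_def by (subst integral_density) auto
    then show ?thesis by (simp only: char_std_normal_distribution)
  qed
  have prod: "(\<Prod>b\<in>Basis. std_normal_density (x \<bullet> b)) *\<^sub>R iexp (\<xi> \<bullet> x) = (\<Prod>b\<in>Basis. ?f b (x \<bullet> b))" for x :: "real^'n"
  proof -
    have "iexp (\<xi> \<bullet> x) = (\<Prod>b\<in>Basis. iexp ((\<xi> \<bullet> b) * (x \<bullet> b)))"
      by (subst exp_sum[symmetric]) (simp_all add: euclidean_inner[of \<xi> x] sum_distrib_left)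
    then show ?thesis by (simp add: scaleR_conv_of_real prod.distrib)
  qed
  have "vchar std_gaussian \<xi> = (CLINT x|lborel. (\<Prod>b\<in>Basis. ?f b (x \<bullet> b)))"
    unfolding vchar_def std_gaussian_density
    by (subst integral_density) (auto simp: prod prod_nonneg)
  also have "\<dots> = (CLINT x|PiM Basis (\<lambda>_. lborel). (\<Prod>b\<in>Basis. ?f b ((\<Sum>b\<in>Basis. x b *\<^sub>R b :: real^'n) \<bullet> b)))"
    by (subst lborel_eq, subst integral_distr) auto
  also have "\<dots> = (CLINT x|PiM Basis (\<lambda>_. lborel). (\<Prod>b\<in>Basis. ?f b (x b)))"
    by (intro Bochner_Integration.integral_cong prod.cong refl)
      (simp add: inner_sum_left inner_Basis if_distrib[of "\<lambda>x. _ * x"] sum.delta cong: if_cong)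
  also have "\<dots> = (\<Prod>b\<in>Basis. (CLINT x|lborel. ?f b x))"
  proof -
    interpret product_sigma_finite "\<lambda>_ :: real^'n. lborel :: real measure" ..
    show ?thesis by (rule product_integral_prod[OF finite_Basis int])
  qed
  also have "\<dots> = of_real (exp (- (\<xi> \<bullet> \<xi>) / 2))"
    unfolding one of_real_prod[symmetric] by (subst exp_sum[symmetric])
      (simp_all add: euclidean_inner[of \<xi> \<xi>] power2_eq_square sum_negf flip: sum_divide_distrib)
  finally show ?thesis .
qed

lemma lborel_eq_density_distr_affine:
  fixes L :: "real^'n^'n"
  assumes "invertible L"
  shows "lborel = density (distr lborel borel (\<lambda>v. m + L *v v)) (\<lambda>_. ennreal \<bar>det L\<bar>)"
proof -
  have "lborel = distr lborel borel ((+) m)" by (rule lborel_distr_plus[symmetric])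
  also have "\<dots> = distr (density (distr lborel borel ((*v) L)) (\<lambda>_. ennreal \<bar>det L\<bar>)) borel ((+) m)"
    using lborel_eq_density_distr_linear[OF assms] by simp
  also have "\<dots> = density (distr (distr lborel borel ((*v) L)) borel ((+) m)) (\<lambda>_. ennreal \<bar>det L\<bar>)"
    by (rule density_distr[symmetric]) simp_all
  finally show ?thesis by (simp add: distr_distr o_def)
qed

text \<open>Under x = m + L v the exponent becomes |v|^2 / 2, and the Jacobian |det L| cancels
  against the square root of det (L L^T). Moments and characteristic functions of all Gaussians are
  thereby reduced to the standard one.\<close>

lemma gaussian_measure_eq_distr:
  fixes L :: "real^'n^'n"
  assumes L: "invertible L"
  shows "gaussian_measure m (L ** transpose L) = distr std_gaussian borel (\<lambda>v. m + L *v v)"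
proof -
  let ?T = "\<lambda>v. m + L *v v"
  let ?G = "\<lambda>x. ennreal (exp (- ((x - m) \<bullet> (matrix_inv (L ** transpose L) *v (x - m))) / 2) /
      sqrt ((2 * pi) ^ CARD('n) * det (L ** transpose L)))"
  have d: "det L \<noteq> 0" using L by (simp add: invertible_det_nz)
  then have LT: "invertible (transpose L)" "invertible (L ** transpose L)" by (simp_all add: invertible_det_nz det_mul)
  have "transpose L ** matrix_inv (L ** transpose L) ** L = mat 1"
  proof -
    have "matrix_inv (L ** transpose L) = matrix_inv (transpose L) ** matrix_inv L"
      by (rule matrix_inv_unique)
        (metis matrix_inv_mult[OF L] matrix_inv_mult[OF LT(1)] matrix_mul_assoc matrix_mul_rid)+
    then show ?thesis
      by (metis matrix_inv_mult[OF L] matrix_inv_mult[OF LT(1)] matrix_mul_assoc matrix_mul_rid)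
  qed
  then have quad: "(L *v v) \<bullet> (matrix_inv (L ** transpose L) *v (L *v v)) = v \<bullet> v" for v
    unfolding inner_commute[of "L *v v"]
    by (subst inner_matrix_transpose) (simp add: matrix_vector_mul_assoc matrix_mul_assoc)
  have G: "ennreal \<bar>det L\<bar> * ?G (?T v) = ennreal (exp (- (v \<bullet> v) / 2) / sqrt ((2 * pi) ^ CARD('n)))" for v
  proof -
    have "sqrt ((2 * pi) ^ CARD('n) * det (L ** transpose L)) = sqrt ((2 * pi) ^ CARD('n)) * \<bar>det L\<bar>"
      unfolding det_mul det_transpose real_sqrt_mult[of "(2 * pi) ^ CARD('n)"] real_sqrt_abs2 ..
    then show ?thesis using d by (simp add: quad ennreal_mult'[symmetric] field_simps)
  qed
  have [measurable]: "?G \<in> borel_measurable borel" by measurable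
  have "gaussian_measure m (L ** transpose L) = density (density (distr lborel borel ?T) (\<lambda>_. ennreal \<bar>det L\<bar>)) ?G"
    unfolding gaussian_measure_def using lborel_eq_density_distr_affine[OF L, of m] by simp
  also have "\<dots> = density (distr lborel borel ?T) (\<lambda>x. ennreal \<bar>det L\<bar> * ?G x)"
    by (rule density_density_eq) simp_all
  also have "\<dots> = distr (density lborel (\<lambda>v. ennreal \<bar>det L\<bar> * ?G (?T v))) borel ?T"
    by (rule density_distr) simp_all
  also have "density lborel (\<lambda>v. ennreal \<bar>det L\<bar> * ?G (?T v)) = std_gaussian"
    unfolding G std_gaussian_density std_normal_density_prod ..
  finally show ?thesis .
qed

lemma prob_space_gaussian_measure:
  fixes C :: "real^'n^'n"
  assumes "pos_def_matrix C"
  shows "prob_space (gaussian_measure m C)"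
proof -
  obtain L :: "real^'n^'n" where L: "invertible L" "C = L ** transpose L"
    using pos_def_matrix_factor[OF assms] by blast
  interpret prob_space "std_gaussian :: (real^'n) measure" by (rule prob_space_std_gaussian)
  show ?thesis unfolding L(2) gaussian_measure_eq_distr[OF L(1)] by (rule prob_space_distr) simp
qed

lemma vchar_gaussian_measure:
  fixes C :: "real^'n^'n"
  assumes "pos_def_matrix C"
  shows "vchar (gaussian_measure m C) \<xi> = iexp (\<xi> \<bullet> m) * of_real (exp (- (\<xi> \<bullet> (C *v \<xi>)) / 2))"
proof -
  obtain L :: "real^'n^'n" where L: "invertible L" "C = L ** transpose L"
    using pos_def_matrix_factor[OF assms] by blast
  have "vchar (gaussian_measure m C) \<xi> = (CLINT v|std_gaussian. iexp (\<xi> \<bullet> m) * iexp ((transpose L *v \<xi>) \<bullet> v))"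
    unfolding vchar_def L(2) gaussian_measure_eq_distr[OF L(1)]
    by (subst integral_distr) (simp_all add: inner_add_right inner_matrix_transpose[of \<xi> L] distrib_left exp_add)
  also have "\<dots> = iexp (\<xi> \<bullet> m) * vchar std_gaussian (transpose L *v \<xi>)"
    unfolding vchar_def by simp
  also have "(transpose L *v \<xi>) \<bullet> (transpose L *v \<xi>) = \<xi> \<bullet> (C *v \<xi>)"
    by (simp add: L(2) inner_matrix_transpose[symmetric] flip: matrix_vector_mul_assoc)
  then have "vchar std_gaussian (transpose L *v \<xi>) = of_real (exp (- (\<xi> \<bullet> (C *v \<xi>)) / 2))"
    by (simp add: vchar_std_gaussian)
  finally show ?thesis .
qed

text \<open>The indicator of a closed set is the limit of the functions max 0 (1 - k dist), and
  closed sets form an intersection-stable generator. Test functions with values in [0, 1] suffice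
  and pass easily to nonnegative integrals.\<close>

lemma measure_eqI_bounded_continuous:
  fixes \<mu> \<nu> :: "(real^'n) measure"
  assumes \<mu>: "prob_space \<mu>" "sets \<mu> = sets borel" and \<nu>: "prob_space \<nu>" "sets \<nu> = sets borel"
    and eq: "\<And>f :: real^'n \<Rightarrow> real. continuous_on UNIV f \<Longrightarrow> (\<And>x. 0 \<le> f x) \<Longrightarrow> (\<And>x. f x \<le> 1) \<Longrightarrow>
      integral\<^sup>L \<mu> f = integral\<^sup>L \<nu> f"
  shows "\<mu> = \<nu>"
proof -
  interpret \<mu>: prob_space \<mu> by fact
  interpret \<nu>: prob_space \<nu> by fact
  note [measurable_cong] = \<mu>(2) \<nu>(2)
  have closed: "measure \<mu> S = measure \<nu> S" if S: "closed S" for S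
  \<comment> \<open>The distance to the empty set is 0 by convention, so the approximations below
    would be constantly 1 there.\<close>
  proof (cases "S = {}")
    case False
    define f where "f k x = max 0 (1 - real k * infdist x S)" for k x
    have cont: "continuous_on UNIV (f k)" for k
      unfolding f_def by (intro continuous_intros)
    have b: "0 \<le> f k x" "f k x \<le> 1" for k x
      by (auto simp: f_def infdist_nonneg)
    have lim: "(\<lambda>k. f k x) \<longlonglongrightarrow> indicator S x" for x
    proof (cases "x \<in> S")
      case True
      then show ?thesis by (simp add: f_def)
    next
      case False
      then have "infdist x S > 0"
        using S \<open>S \<noteq> {}\<close> in_closed_iff_infdist_zero infdist_nonneg less_le by metis
      then obtain n where n: "1 < real n * infdist x S" using reals_Archimedean3 by blast
      have "\<forall>\<^sub>F k in sequentially. f k x = indicator S x"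
      proof (rule eventually_mono[OF eventually_ge_at_top[of n]])
        fix k assume "n \<le> k"
        then have "real n * infdist x S \<le> real k * infdist x S" by (intro mult_right_mono) (auto simp: infdist_nonneg)
        with n False show "f k x = indicator S x" by (simp add: f_def)
      qed
      then show ?thesis by (rule tendsto_eventually)
    qed
    have [measurable]: "f k \<in> borel_measurable borel" for k
      by (rule borel_measurable_continuous_onI[OF cont])
    have [measurable]: "S \<in> sets borel" using S by simp
    have "(\<lambda>k. integral\<^sup>L M (f k)) \<longlonglongrightarrow> measure M S"
      if M: "prob_space M" "sets M = sets borel" for M
    proof -
      interpret prob_space M by fact
      note [measurable_cong] = M(2)
      have "(\<lambda>k. integral\<^sup>L M (f k)) \<longlonglongrightarrow> integral\<^sup>L M (indicator S)"
        by (rule integral_dominated_convergence[of _ _ _ "\<lambda>_. 1"]) (auto simp: lim b)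
      then show ?thesis using sets_eq_imp_space_eq[OF M(2)] by simp
    qed
    from LIMSEQ_unique[OF this[OF \<mu>] this[OF \<nu>, folded eq[OF cont b]]] show ?thesis .
  qed simp
  show ?thesis
  proof (rule measure_eqI_generator_eq)
    show "Int_stable (Collect closed :: (real^'n) set set)" by (auto simp: Int_stable_def)
    show "Collect closed \<subseteq> Pow (UNIV :: (real^'n) set)" by simp
    show "sets \<mu> = sigma_sets UNIV (Collect closed)" "sets \<nu> = sigma_sets UNIV (Collect closed)"
      by (simp_all add: \<mu>(2) \<nu>(2) borel_eq_closed)
    show "emeasure \<mu> X = emeasure \<nu> X" if "X \<in> Collect closed" for X
      using closed[of X] that by (simp add: \<mu>.emeasure_eq_measure \<nu>.emeasure_eq_measure)
    show "range (\<lambda>_. UNIV) \<subseteq> Collect closed" "(\<Union>i::nat. UNIV) = (UNIV :: (real^'n) set)" by auto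
    show "emeasure \<mu> UNIV \<noteq> \<infinity>" by simp
  qed
qed

lemma gaussian_measure_mat:
  assumes "s > 0"
  shows "gaussian_measure y (mat s :: real^'n^'n) =
    density lborel (\<lambda>x. ennreal (exp (- ((x - y) \<bullet> (x - y)) / (2 * s)) / sqrt ((2 * pi * s) ^ CARD('n))))"
proof -
  have "exp (- (v \<bullet> (matrix_inv (mat s) *v v)) / 2) = exp (- (v \<bullet> v) / (2 * s))" for v :: "real^'n"
    using assms by (simp add: matrix_inv_mat mat_vector)
  then show ?thesis
    by (simp only: gaussian_measure_def det_mat power_mult_distrib)
qed

lemma gaussian_measure_mat_distr:
  fixes y :: "real^'n"
  assumes "s > 0"
  shows "gaussian_measure y (mat (s\<^sup>2)) = distr std_gaussian borel (\<lambda>v. y + s *\<^sub>R v)"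
proof -
  have "invertible (mat s :: real^'n^'n)" using assms by (simp add: invertible_det_nz det_mat)
  from gaussian_measure_eq_distr[OF this, of y] show ?thesis
    by (simp add: transpose_mat mat_mult_mat mat_vector power2_eq_square)
qed

text \<open>Smoothing by a Gaussian kernel, itself a Fourier transform, expresses the smoothed measure through
  its characteristic function.\<close>

lemma vchar_determines_measure:
  fixes \<mu> \<nu> :: "(real^'n) measure"
  assumes \<mu>: "prob_space \<mu>" "sets \<mu> = sets borel" and \<nu>: "prob_space \<nu>" "sets \<nu> = sets borel"
    and eq: "\<And>\<xi>. vchar \<mu> \<xi> = vchar \<nu> \<xi>"
  shows "\<mu> = \<nu>"
proof (rule measure_eqI_bounded_continuous[OF \<mu> \<nu>])
  fix f :: "real^'n \<Rightarrow> real" assume f: "continuous_on UNIV f" "\<And>x. 0 \<le> f x" "\<And>x. f x \<le> 1"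
  let ?\<gamma> = "std_gaussian :: (real^'n) measure"
  have [measurable]: "f \<in> borel_measurable borel" by (rule borel_measurable_continuous_onI[OF f(1)])
  \<comment> \<open>The law of Y + s V, with Y distributed by M and V an independent standard
    Gaussian.\<close>
  define conv where "conv M s = distr (M \<Otimes>\<^sub>M ?\<gamma>) borel (\<lambda>(y, v). y + s *\<^sub>R v)" for M and s :: real
  define h where "h s w = exp (- (w \<bullet> w) / (2 * s\<^sup>2))" for s :: real and w :: "real^'n"
  \<comment> \<open>The Gaussian kernel of width s is the standard Gaussian characteristic function
    at (x - y) / s. Fubini can then integrate over y first, which produces
    \<open>vchar M\<close>.\<close>
  have h: "of_real (h s (x - y)) = (CLINT u|?\<gamma>. iexp ((1 / s) *\<^sub>R (x - y) \<bullet> u))" if "s > 0" for s x y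
    using vchar_std_gaussian[of "(1 / s) *\<^sub>R (x - y)"] that
    by (simp add: vchar_def h_def power2_eq_square)
  have hb: "0 \<le> h s w" "h s w \<le> 1" for s w by (auto simp: h_def)
  have [measurable]: "h s \<in> borel_measurable borel" for s unfolding h_def by measurable
  have smooth: "of_real (LINT y|M. h s (x - y)) =
      (CLINT u|?\<gamma>. iexp ((1 / s) *\<^sub>R x \<bullet> u) * vchar M (- ((1 / s) *\<^sub>R u)))"
    if M: "prob_space M" "sets M = sets borel" and s: "s > 0" for M s x
  proof -
    interpret M: prob_space M by fact
    interpret G: prob_space ?\<gamma> by (rule prob_space_std_gaussian)
    interpret P: pair_prob_space M ?\<gamma> ..
    note [measurable_cong] = M(2)
    have "of_real (LINT y|M. h s (x - y)) = (CLINT y|M. (CLINT u|?\<gamma>. iexp ((1 / s) *\<^sub>R (x - y) \<bullet> u)))"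
      by (subst integral_complex_of_real[symmetric]) (simp only: h[OF s])
    also have "\<dots> = (CLINT u|?\<gamma>. (CLINT y|M. iexp ((1 / s) *\<^sub>R (x - y) \<bullet> u)))"
      by (rule P.Fubini_integral[symmetric])
        (rule P.integrable_const_bound[of _ 1], auto simp: split_beta)
    also have "\<dots> = (CLINT u|?\<gamma>. iexp ((1 / s) *\<^sub>R x \<bullet> u) * vchar M (- ((1 / s) *\<^sub>R u)))"
    proof (intro Bochner_Integration.integral_cong refl)
      fix u
      have "iexp ((1 / s) *\<^sub>R (x - y) \<bullet> u) = iexp ((1 / s) *\<^sub>R x \<bullet> u) * iexp (- ((1 / s) *\<^sub>R u) \<bullet> y)" for y
        by (simp add: exp_add[symmetric] inner_diff_left inner_commute[of u] algebra_simps diff_divide_distrib)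
      then show "(CLINT y|M. iexp ((1 / s) *\<^sub>R (x - y) \<bullet> u)) = iexp ((1 / s) *\<^sub>R x \<bullet> u) * vchar M (- ((1 / s) *\<^sub>R u))"
        by (simp add: vchar_def)
    qed
    finally show ?thesis .
  qed
  have conv_eq: "emeasure (conv M s) S = (\<integral>\<^sup>+x. indicator S x * ennreal ((LINT y|M. h s (x - y)) / sqrt ((2 * pi * s\<^sup>2) ^ CARD('n))) \<partial>lborel)"
    if M: "prob_space M" "sets M = sets borel" and s: "s > 0" and [measurable]: "S \<in> sets borel" for M s S
  proof -
    interpret M: prob_space M by fact
    interpret G: prob_space ?\<gamma> by (rule prob_space_std_gaussian)
    note [measurable_cong] = M(2)
    interpret PL: pair_sigma_finite M "lborel :: (real^'n) measure" ..
    let ?k = "sqrt ((2 * pi * s\<^sup>2) ^ CARD('n))"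
    have k: "?k > 0" using s by simp
    have "emeasure (conv M s) S = emeasure (M \<Otimes>\<^sub>M ?\<gamma>) ((\<lambda>(y, v). y + s *\<^sub>R v) -` S \<inter> space (M \<Otimes>\<^sub>M ?\<gamma>))"
      unfolding conv_def by (rule emeasure_distr) simp_all
    also have "\<dots> = (\<integral>\<^sup>+y. emeasure ?\<gamma> (Pair y -` ((\<lambda>(y, v). y + s *\<^sub>R v) -` S \<inter> space (M \<Otimes>\<^sub>M ?\<gamma>))) \<partial>M)"
      by (rule G.emeasure_pair_measure_alt) (rule measurable_sets[of _ _ borel]; simp)
    also have "\<dots> = (\<integral>\<^sup>+y. emeasure (gaussian_measure y (mat (s\<^sup>2))) S \<partial>M)"
    proof (rule nn_integral_cong)
      fix y assume "y \<in> space M"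
      then have "Pair y -` ((\<lambda>(y, v). y + s *\<^sub>R v) -` S \<inter> space (M \<Otimes>\<^sub>M ?\<gamma>)) = (\<lambda>v. y + s *\<^sub>R v) -` S \<inter> space ?\<gamma>"
        by (auto simp: space_pair_measure)
      then show "emeasure ?\<gamma> (Pair y -` ((\<lambda>(y, v). y + s *\<^sub>R v) -` S \<inter> space (M \<Otimes>\<^sub>M ?\<gamma>))) = emeasure (gaussian_measure y (mat (s\<^sup>2))) S"
        by (simp add: gaussian_measure_mat_distr[OF s] emeasure_distr)
    qed
    also have "\<dots> = (\<integral>\<^sup>+y. (\<integral>\<^sup>+x. indicator S x * ennreal (h s (x - y) / ?k) \<partial>lborel) \<partial>M)"
      using s by (simp add: gaussian_measure_mat emeasure_density h_def mult.commute)
    also have "\<dots> = (\<integral>\<^sup>+x. (\<integral>\<^sup>+y. indicator S x * ennreal (h s (x - y) / ?k) \<partial>M) \<partial>lborel)"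
      by (rule PL.Fubini'[symmetric]) measurable
    also have "\<dots> = (\<integral>\<^sup>+x. indicator S x * ennreal ((LINT y|M. h s (x - y)) / ?k) \<partial>lborel)"
    proof (rule nn_integral_cong)
      fix x
      have "(\<integral>\<^sup>+y. ennreal (h s (x - y) / ?k) \<partial>M) = ennreal (LINT y|M. h s (x - y) / ?k)"
        by (rule nn_integral_eq_integral)
          (use k hb in \<open>auto intro!: M.integrable_const_bound[of _ "1 / ?k"] AE_I2 simp: divide_right_mono\<close>)
      then show "(\<integral>\<^sup>+y. indicator S x * ennreal (h s (x - y) / ?k) \<partial>M) = indicator S x * ennreal ((LINT y|M. h s (x - y)) / ?k)"
        by (simp add: nn_integral_cmult)
    qed
    finally show ?thesis .
  qed
  have cc: "conv \<mu> s = conv \<nu> s" if s: "s > 0" for s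
  proof (rule measure_eqI)
    fix S assume "S \<in> sets (conv \<mu> s)"
    then have S: "S \<in> sets borel" by (simp add: conv_def)
    have "complex_of_real (LINT y|\<mu>. h s (x - y)) = of_real (LINT y|\<nu>. h s (x - y))" for x
      unfolding smooth[OF \<mu> s] smooth[OF \<nu> s] eq ..
    then have "(LINT y|\<mu>. h s (x - y)) = (LINT y|\<nu>. h s (x - y))" for x by (simp only: of_real_eq_iff)
    then show "emeasure (conv \<mu> s) S = emeasure (conv \<nu> s) S"
      by (simp only: conv_eq[OF \<mu> s S] conv_eq[OF \<nu> s S])
  qed (simp add: conv_def)
  have lim: "(\<lambda>n. integral\<^sup>L (conv M (1 / real (Suc n))) f) \<longlonglongrightarrow> integral\<^sup>L M f"
    if M: "prob_space M" "sets M = sets borel" for M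
  proof -
    interpret M: prob_space M by fact
    interpret G: prob_space ?\<gamma> by (rule prob_space_std_gaussian)
    interpret P: pair_prob_space M ?\<gamma> ..
    note [measurable_cong] = M(2)
    have cf: "isCont f x" for x using f(1) by (simp add: continuous_on_eq_continuous_at)
    have "(\<lambda>n. LINT p|(M \<Otimes>\<^sub>M ?\<gamma>). f (fst p + (1 / real (Suc n)) *\<^sub>R snd p)) \<longlonglongrightarrow> (LINT p|(M \<Otimes>\<^sub>M ?\<gamma>). f (fst p))"
    proof (rule integral_dominated_convergence[of _ _ _ "\<lambda>_. 1"])
      show "AE p in M \<Otimes>\<^sub>M ?\<gamma>. (\<lambda>n. f (fst p + (1 / real (Suc n)) *\<^sub>R snd p)) \<longlonglongrightarrow> f (fst p)"
      proof (rule AE_I2)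
        fix p :: "(real^'n) \<times> (real^'n)"
        have "(\<lambda>n. fst p + (1 / real (Suc n)) *\<^sub>R snd p) \<longlonglongrightarrow> fst p + 0 *\<^sub>R snd p"
          by (intro tendsto_intros LIMSEQ_Suc lim_1_over_n)
        then show "(\<lambda>n. f (fst p + (1 / real (Suc n)) *\<^sub>R snd p)) \<longlonglongrightarrow> f (fst p)"
          by (intro isCont_tendsto_compose[OF cf]) simp
      qed
    qed (use f(2,3) in auto)
    moreover have "(LINT p|(M \<Otimes>\<^sub>M ?\<gamma>). f (fst p)) = integral\<^sup>L M f"
      using G.distr_pair_fst[of M] integral_distr[of fst "M \<Otimes>\<^sub>M ?\<gamma>" M f] by simp
    ultimately show ?thesis
      by (simp add: conv_def integral_distr split_beta)
  qed
  have "(\<lambda>n. integral\<^sup>L (conv \<mu> (1 / real (Suc n))) f) = (\<lambda>n. integral\<^sup>L (conv \<nu> (1 / real (Suc n))) f)"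
    by (simp add: cc)
  with LIMSEQ_unique[OF lim[OF \<mu>]] lim[OF \<nu>] show "integral\<^sup>L \<mu> f = integral\<^sup>L \<nu> f" by simp
qed

section \<open>Weak convergence of Gaussian measures\<close>

lemma pos_def_matrix_lower_bound:
  fixes C :: "real^'n^'n"
  assumes C: "pos_def_matrix C"
  shows "\<exists>c>0. \<forall>v. c * (v \<bullet> v) \<le> v \<bullet> (C *v v)"
proof -
  obtain L :: "real^'n^'n" where L: "invertible L" "C = L ** transpose L"
    using pos_def_matrix_factor[OF C] by blast
  have "invertible (transpose L)" using L(1) by (simp add: invertible_det_nz)
  then have "inj ((*v) (transpose L))" by (rule inj_matrix_vector_mult)
  then obtain b where b: "b > 0" "\<And>v. b * norm v \<le> norm (transpose L *v v)"
    using linear_inj_bounded_below_pos[of "(*v) (transpose L)"] by auto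
  have "b\<^sup>2 * (v \<bullet> v) \<le> v \<bullet> (C *v v)" for v
  proof -
    have "b\<^sup>2 * (v \<bullet> v) = (b * norm v)\<^sup>2" by (simp add: power_mult_distrib power2_norm_eq_inner)
    also have "\<dots> \<le> (norm (transpose L *v v))\<^sup>2" using b by (intro power_mono) auto
    also have "\<dots> = v \<bullet> (C *v v)"
      unfolding power2_norm_eq_inner inner_matrix_transpose[symmetric] L(2) by (simp only: matrix_vector_mul_assoc)
    finally show ?thesis .
  qed
  with b(1) show ?thesis by (intro exI[of _ "b\<^sup>2"]) simp
qed

lemma pos_def_matrix_det: "pos_def_matrix C \<Longrightarrow> det (C :: real^'n^'n) > 0"
proof -
  assume C: "pos_def_matrix C"
  obtain L :: "real^'n^'n" where L: "invertible L" "C = L ** transpose L"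
    using pos_def_matrix_factor[OF C] by blast
  from L(1) have "det L * det L > 0"
    using not_real_square_gt_zero[of "det L"] unfolding invertible_det_nz by blast
  then show ?thesis by (simp only: L(2) det_mul det_transpose)
qed

lemma pos_def_matrix_inv:
  assumes C: "pos_def_matrix (C :: real^'n^'n)"
  shows "pos_def_matrix (matrix_inv C)"
  unfolding pos_def_matrix_def
proof (intro conjI allI impI)
  note inv = pos_def_matrix_invertible[OF C]
  show "transpose (matrix_inv C) = matrix_inv C"
    using C by (simp add: transpose_matrix_inv[OF inv] pos_def_matrix_def)
  fix v :: "real^'n" assume "v \<noteq> 0"
  let ?w = "matrix_inv C *v v"
  have v: "C *v ?w = v" by (simp add: matrix_vector_mul_assoc matrix_inv_mult[OF inv])
  then have "?w \<noteq> 0" using \<open>v \<noteq> 0\<close> by auto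
  then have "?w \<bullet> (C *v ?w) > 0" using C by (simp add: pos_def_matrix_def)
  then show "v \<bullet> ?w > 0" by (simp only: v inner_commute)
qed

text \<open>Half of the lower bound of the limit form survives a small perturbation of the matrix.
  Applied to inverse covariances it gives the uniform Gaussian tail for dominated
  convergence.\<close>

lemma eventually_quadratic_form_ge:
  fixes D :: "'a \<Rightarrow> real^'n^'n"
  assumes D: "(D \<longlongrightarrow> D0) F" and pd: "pos_def_matrix D0"
  shows "\<exists>c>0. \<forall>\<^sub>F i in F. \<forall>v. c * (v \<bullet> v) \<le> v \<bullet> (D i *v v)"
proof -
  obtain c where c: "c > 0" "\<And>v. c * (v \<bullet> v) \<le> v \<bullet> (D0 *v v)"
    using pos_def_matrix_lower_bound[OF pd] by blast
  obtain K where K: "K > 0" "\<And>(A :: real^'n^'n) v. norm (A *v v) \<le> norm A * norm v * K"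
    using bounded_bilinear.pos_bounded[OF bounded_bilinear_matrix_vector] by blast
  have "\<forall>\<^sub>F i in F. dist (D i) D0 < c / (2 * K)"
    using D c(1) K(1) by (intro tendstoD) auto
  then have "\<forall>\<^sub>F i in F. \<forall>v. c / 2 * (v \<bullet> v) \<le> v \<bullet> (D i *v v)"
  proof eventually_elim
    fix i assume i: "dist (D i) D0 < c / (2 * K)"
    show "\<forall>v. c / 2 * (v \<bullet> v) \<le> v \<bullet> (D i *v v)"
    proof
      fix v :: "real^'n"
      have "\<bar>v \<bullet> ((D i - D0) *v v)\<bar> \<le> norm v * norm ((D i - D0) *v v)" by (rule Cauchy_Schwarz_ineq2)
      also have "\<dots> \<le> norm v * (norm (D i - D0) * norm v * K)" by (intro mult_left_mono K) auto
      also have "\<dots> = (norm (D i - D0) * K) * (v \<bullet> v)"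
        by (simp add: power2_norm_eq_inner[symmetric] power2_eq_square)
      also have "\<dots> \<le> c / 2 * (v \<bullet> v)"
        using i K(1) by (intro mult_right_mono) (auto simp: dist_norm field_simps)
      finally have "- (c / 2 * (v \<bullet> v)) \<le> v \<bullet> ((D i - D0) *v v)" by simp
      with c(2)[of v] show "c / 2 * (v \<bullet> v) \<le> v \<bullet> (D i *v v)"
        by (simp add: matrix_vector_mult_diff_rdistrib inner_diff_right field_simps)
    qed
  qed
  with c(1) show ?thesis by (intro exI[of _ "c / 2"]) simp
qed

lemma integral_gaussian_measure:
  fixes f :: "real^'n \<Rightarrow> real"
  assumes "f \<in> borel_measurable borel" "det C \<ge> 0"
  shows "integral\<^sup>L (gaussian_measure m C) f =
    (LINT x|lborel. exp (- ((x - m) \<bullet> (matrix_inv C *v (x - m))) / 2) / sqrt ((2 * pi) ^ CARD('n) * det C) * f x)"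
  unfolding gaussian_measure_def using assms by (subst integral_density) auto

text \<open>Dominated convergence of the densities against Lebesgue measure.\<close>

lemma gaussian_integral_tendsto:
  fixes f :: "real^'n \<Rightarrow> real"
  assumes m: "m \<longlonglongrightarrow> m0" and C: "C \<longlonglongrightarrow> C0" and pd: "pos_def_matrix C0" "\<And>n. pos_def_matrix (C n)"
    and f: "continuous_on UNIV f" "bounded (range f)"
  shows "(\<lambda>n. integral\<^sup>L (gaussian_measure (m n) (C n)) f) \<longlonglongrightarrow> integral\<^sup>L (gaussian_measure m0 C0) f"
proof -
  have [measurable]: "f \<in> borel_measurable borel" by (rule borel_measurable_continuous_onI[OF f(1)])
  obtain Bf where Bf: "\<And>x. \<bar>f x\<bar> \<le> Bf" using f(2) by (auto simp: bounded_real)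
  have Bf0: "Bf \<ge> 0" using Bf[of 0] by linarith
  define g where "g m C x = exp (- ((x - m) \<bullet> (matrix_inv C *v (x - m))) / 2) / sqrt ((2 * pi) ^ CARD('n) * det C)"
    for m :: "real^'n" and C :: "real^'n^'n" and x
  have [measurable]: "g m C \<in> borel_measurable borel" for m C unfolding g_def by measurable
  note invlim = tendsto_matrix_inv[OF C pos_def_matrix_invertible[OF pd(1)]]
  define q0 where "q0 = sqrt ((2 * pi) ^ CARD('n) * det C0)"
  have q0: "q0 > 0" using pos_def_matrix_det[OF pd(1)] by (simp add: q0_def)
  have qlim: "(\<lambda>n. sqrt ((2 * pi) ^ CARD('n) * det (C n))) \<longlonglongrightarrow> q0"
    unfolding q0_def by (intro tendsto_intros tendsto_det C)
  obtain c where c: "c > 0" "\<forall>\<^sub>F n in sequentially. \<forall>v. c * (v \<bullet> v) \<le> v \<bullet> (matrix_inv (C n) *v v)"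
    using eventually_quadratic_form_ge[OF invlim pos_def_matrix_inv[OF pd(1)]] by blast
  have q: "\<forall>\<^sub>F n in sequentially. q0 / 2 < sqrt ((2 * pi) ^ CARD('n) * det (C n))"
    by (rule order_tendstoD(1)[OF qlim]) (use q0 in simp)
  have ml: "\<forall>\<^sub>F n in sequentially. norm (m n) < norm m0 + 1"
    by (rule order_tendstoD(2)[OF tendsto_norm[OF m]]) simp
  \<comment> \<open>The dominating function: 2 / q0 bounds the reciprocal normalising constants, and
    |x - m|^2 \<ge> |x|^2 / 2 - |m|^2 together with |m| \<le> |m0| + 1 bounds the
    exponentials.\<close>
  define w where "w x = 2 / q0 * exp (c * (norm m0 + 1)\<^sup>2 / 2) * Bf * exp (- (x \<bullet> x) * c / 4)" for x :: "real^'n"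
  have intw: "integrable lborel w"
  proof -
    \<comment> \<open>Variance 2 / c yields precisely the exponent - c |x|^2 / 4 of w, so
      integrability of w is normalisation of a Gaussian.\<close>
    have "prob_space (gaussian_measure 0 (mat (2 / c) :: real^'n^'n))"
      by (rule prob_space_gaussian_measure[OF pos_def_mat]) (use c in simp)
    then interpret prob_space "gaussian_measure 0 (mat (2 / c) :: real^'n^'n)" .
    have "integrable (gaussian_measure 0 (mat (2 / c) :: real^'n^'n)) (\<lambda>_. 1 :: real)" by simp
    then have "integrable lborel (\<lambda>x::real^'n. exp (- (x \<bullet> x) * c / 4) / sqrt ((2 * pi * (2 / c)) ^ CARD('n)))"
      using c(1) by (subst (asm) gaussian_measure_mat, simp, subst (asm) integrable_density) (auto simp: field_simps)
    then have "integrable lborel (\<lambda>x::real^'n. sqrt ((2 * pi * (2 / c)) ^ CARD('n)) * (exp (- (x \<bullet> x) * c / 4) / sqrt ((2 * pi * (2 / c)) ^ CARD('n))))"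
      by (rule integrable_mult_right)
    moreover have "sqrt ((2 * pi * (2 / c)) ^ CARD('n)) \<noteq> 0" using c(1) by simp
    ultimately show ?thesis unfolding w_def by (intro integrable_mult_right) simp
  qed
  from eventually_conj[OF c(2) eventually_conj[OF q ml]] obtain N where
    N: "\<And>n. n \<ge> N \<Longrightarrow> (\<forall>v. c * (v \<bullet> v) \<le> v \<bullet> (matrix_inv (C n) *v v)) \<and>
      q0 / 2 < sqrt ((2 * pi) ^ CARD('n) * det (C n)) \<and> norm (m n) < norm m0 + 1"
    unfolding eventually_sequentially by blast
  have "(\<lambda>n. LINT x|lborel. g (m (n + N)) (C (n + N)) x * f x) \<longlonglongrightarrow> (LINT x|lborel. g m0 C0 x * f x)"
  proof (rule integral_dominated_convergence[of _ _ _ w])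
    show "AE x in lborel. (\<lambda>n. g (m (n + N)) (C (n + N)) x * f x) \<longlonglongrightarrow> g m0 C0 x * f x"
    proof (rule AE_I2)
      fix x
      have "(\<lambda>n. g (m n) (C n) x) \<longlonglongrightarrow> g m0 C0 x"
        unfolding g_def using q0
        by (intro tendsto_intros m C invlim tendsto_det bounded_bilinear.tendsto[OF bounded_bilinear_matrix_vector])
          (use pos_def_matrix_det[OF pd(1)] in \<open>simp_all add: q0_def\<close>)
      then show "(\<lambda>n. g (m (n + N)) (C (n + N)) x * f x) \<longlonglongrightarrow> g m0 C0 x * f x"
        by (intro tendsto_intros LIMSEQ_ignore_initial_segment)
    qed
    show "AE x in lborel. norm (g (m (n + N)) (C (n + N)) x * f x) \<le> w x" for n
    proof (rule AE_I2)
      fix x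
      let ?m = "m (n + N)" and ?C = "C (n + N)"
      from N[of "n + N"] have quad: "c * ((x - ?m) \<bullet> (x - ?m)) \<le> (x - ?m) \<bullet> (matrix_inv ?C *v (x - ?m))"
        and qn: "q0 / 2 < sqrt ((2 * pi) ^ CARD('n) * det ?C)" and mn: "norm ?m < norm m0 + 1" by auto
      have "x \<bullet> x / 2 - (norm m0 + 1)\<^sup>2 \<le> (x - ?m) \<bullet> (x - ?m)"
      proof -
        \<comment> \<open>Half of this square is the difference |x - m|^2 - |x|^2 / 2 +
          |m|^2.\<close>
        have "0 \<le> (x - 2 *\<^sub>R ?m) \<bullet> (x - 2 *\<^sub>R ?m)" by simp
        then have "x \<bullet> x / 2 - ?m \<bullet> ?m \<le> (x - ?m) \<bullet> (x - ?m)"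
          by (simp add: inner_diff_left inner_diff_right inner_commute[of ?m x])
        moreover have "?m \<bullet> ?m \<le> (norm m0 + 1)\<^sup>2"
          unfolding power2_norm_eq_inner[symmetric] using mn by (intro power_mono) auto
        ultimately show ?thesis by linarith
      qed
      then have "c * (x \<bullet> x / 2 - (norm m0 + 1)\<^sup>2) \<le> c * ((x - ?m) \<bullet> (x - ?m))"
        using c(1) by (intro mult_left_mono) auto
      with quad have "- ((x - ?m) \<bullet> (matrix_inv ?C *v (x - ?m))) / 2 \<le> c * (norm m0 + 1)\<^sup>2 / 2 + - (x \<bullet> x) * c / 4"
        by (simp add: field_simps)
      then have e: "exp (- ((x - ?m) \<bullet> (matrix_inv ?C *v (x - ?m))) / 2) \<le> exp (c * (norm m0 + 1)\<^sup>2 / 2) * exp (- (x \<bullet> x) * c / 4)"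
        by (simp only: exp_add[symmetric] exp_le_cancel_iff)
      have "g ?m ?C x \<le> (exp (c * (norm m0 + 1)\<^sup>2 / 2) * exp (- (x \<bullet> x) * c / 4)) / (q0 / 2)"
        unfolding g_def using e qn q0 by (intro frac_le) auto
      moreover have "0 \<le> g ?m ?C x" unfolding g_def using qn q0 by (intro divide_nonneg_pos) (simp, linarith)
      ultimately have "norm (g ?m ?C x * f x) \<le> ((exp (c * (norm m0 + 1)\<^sup>2 / 2) * exp (- (x \<bullet> x) * c / 4)) / (q0 / 2)) * Bf"
        unfolding norm_mult by (intro mult_mono) (use Bf Bf0 q0 in auto)
      then show "norm (g ?m ?C x * f x) \<le> w x" by (simp add: w_def mult_ac)
    qed
  qed (use intw in auto)
  then have "(\<lambda>n. LINT x|lborel. g (m n) (C n) x * f x) \<longlonglongrightarrow> (LINT x|lborel. g m0 C0 x * f x)"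
    by (rule LIMSEQ_offset)
  then show ?thesis
    using pos_def_matrix_det[OF pd(1)] pos_def_matrix_det[OF pd(2)]
    by (simp add: integral_gaussian_measure g_def less_imp_le)
qed

text \<open>Dominated convergence works along sequences, hence the sequential description of the
  limit. The filter \<open>at a within S\<close> covers both \<open>at_right 0\<close> for the time
  scale and \<open>at x\<close> for continuity in the condition.\<close>

lemma gaussian_weakly_converges:
  fixes C :: "'a::first_countable_topology \<Rightarrow> real^'n^'n"
  assumes m: "(m \<longlongrightarrow> m0) (at a within S)" and C: "(C \<longlongrightarrow> C0) (at a within S)"
    and pd: "pos_def_matrix C0" "\<And>i. i \<in> S \<Longrightarrow> i \<noteq> a \<Longrightarrow> pos_def_matrix (C i)"
    and \<nu>: "\<And>i. i \<in> S \<Longrightarrow> i \<noteq> a \<Longrightarrow> \<nu> i = gaussian_measure (m i) (C i)"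
  shows "weakly_converges \<nu> (gaussian_measure m0 C0) (at a within S)"
  unfolding weakly_converges_def
proof (intro allI impI)
  fix f :: "real^'n \<Rightarrow> real" assume f: "continuous_on UNIV f" "bounded (range f)"
  show "((\<lambda>i. integral\<^sup>L (\<nu> i) f) \<longlongrightarrow> integral\<^sup>L (gaussian_measure m0 C0) f) (at a within S)"
    unfolding tendsto_at_iff_sequentially o_def
  proof (intro allI impI)
    fix X :: "nat \<Rightarrow> 'a" assume X: "\<forall>i. X i \<in> S - {a}" "X \<longlonglongrightarrow> a"
    have "(\<lambda>i. m (X i)) \<longlonglongrightarrow> m0" "(\<lambda>i. C (X i)) \<longlonglongrightarrow> C0"
      using m C X unfolding tendsto_at_iff_sequentially o_def by auto
    from gaussian_integral_tendsto[OF this pd(1) _ f] pd(2) X(1)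
    show "(\<lambda>i. integral\<^sup>L (\<nu> (X i)) f) \<longlonglongrightarrow> integral\<^sup>L (gaussian_measure m0 C0) f"
      by (simp add: \<nu>)
  qed
qed

section \<open>Stationary law of the linear equation\<close>

text \<open>Only the integrator f is differentiable; g may be a noise path. The integral enters
  through an antiderivative J of f' . g. Arbitrary tags are allowed because right endpoints are
  needed for the path formula and left ones for the variance.\<close>

lemma riemann_stieltjes_sum_tendsto:
  fixes f f' g :: "real \<Rightarrow> 'a::real_inner" and J :: "real \<Rightarrow> real"
  assumes T: "T \<ge> 0"
    and f: "\<And>t. t \<in> {0..T} \<Longrightarrow> (f has_vector_derivative f' t) (at t within {0..T})"
    and J: "\<And>t. t \<in> {0..T} \<Longrightarrow> (J has_vector_derivative f' t \<bullet> g t) (at t within {0..T})"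
    and cont: "continuous_on {0..T} f'" "continuous_on {0..T} g"
    and \<tau>: "\<And>n i. i < n \<Longrightarrow> \<tau> n i \<in> {real i * T / n..real (Suc i) * T / n}"
  shows "(\<lambda>n. \<Sum>i<n. (f (real (Suc i) * T / n) - f (real i * T / n)) \<bullet> g (\<tau> n i)) \<longlonglongrightarrow> J T - J 0"
proof (rule LIMSEQ_I)
  fix r :: real assume r: "r > 0"
  have "bounded (f' ` {0..T})"
    by (intro compact_imp_bounded compact_continuous_image cont) simp
  then obtain M where M: "M > 0" "\<And>t. t \<in> {0..T} \<Longrightarrow> norm (f' t) \<le> M"
    by (auto simp: bounded_pos)
  \<comment> \<open>Chosen so that the total error M e T is (r / 2) T / (T + 1); the 1 keeps the
    quotient defined when T = 0.\<close>
  define e where "e = r / (2 * M * (T + 1))"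
  have e: "e > 0" using r M T by (simp add: e_def)
  have "uniformly_continuous_on {0..T} g"
    by (rule compact_uniformly_continuous[OF cont(2)]) simp
  then obtain d where d: "d > 0" "\<And>s t. s \<in> {0..T} \<Longrightarrow> t \<in> {0..T} \<Longrightarrow> dist s t < d \<Longrightarrow> dist (g s) (g t) < e"
    using e unfolding uniformly_continuous_on_def by (metis dist_commute)
  obtain N :: nat where N: "real N > T / d" using reals_Archimedean2 by blast
  show "\<exists>no. \<forall>n\<ge>no. norm ((\<Sum>i<n. (f (real (Suc i) * T / n) - f (real i * T / n)) \<bullet> g (\<tau> n i)) - (J T - J 0)) < r"
  proof (intro exI[of _ "Suc N"] allI impI)
    fix n assume n: "n \<ge> Suc N"
    then have n0: "real n > 0" by simp
    have "T / d < real n" using N n by simp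
    then have h: "T / n < d" using d(1) n0 by (simp add: field_simps)
    let ?s = "\<lambda>i. real i * T / n"
    have step: "?s (Suc i) - ?s i = T / n" for i using n0 by (simp add: field_simps)
    have piece: "\<bar>(f (?s (Suc i)) - f (?s i)) \<bullet> g (\<tau> n i) - (J (?s (Suc i)) - J (?s i))\<bar> \<le> M * e * (T / n)" if i: "i < n" for i
    proof -
      have le: "?s i \<le> ?s (Suc i)" using step[of i] T by (smt (verit) divide_nonneg_nonneg of_nat_0_le_iff)
      have "real (Suc i) * T \<le> real n * T" using i T by (intro mult_right_mono) auto
      then have sub: "{?s i..?s (Suc i)} \<subseteq> {0..T}"
        using n0 T by (auto simp: field_simps intro: order.trans)
      have \<tau>i: "\<tau> n i \<in> {?s i..?s (Suc i)}" using \<tau>[OF i] .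
      \<comment> \<open>On one subinterval g is frozen at the tag. The derivative of this difference
        is f' . (g (tag) - g), which uniform continuity makes small.\<close>
      let ?\<phi> = "\<lambda>t. f t \<bullet> g (\<tau> n i) - J t"
      have "norm (?\<phi> (?s (Suc i)) - ?\<phi> (?s i)) \<le> (M * e) * norm (?s (Suc i) - ?s i)"
      proof (rule differentiable_bound[where S = "{?s i..?s (Suc i)}" and f' = "\<lambda>t h. h *\<^sub>R (f' t \<bullet> g (\<tau> n i) - f' t \<bullet> g t)"])
        fix t assume t: "t \<in> {?s i..?s (Suc i)}"
        then have t0: "t \<in> {0..T}" "\<tau> n i \<in> {0..T}" using sub \<tau>i by auto
        have "(?\<phi> has_vector_derivative f' t \<bullet> g (\<tau> n i) - f' t \<bullet> g t) (at t within {0..T})"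
          by (intro has_vector_derivative_diff J t0
              bounded_linear.has_vector_derivative[OF bounded_linear_inner_left] f)
        then show "(?\<phi> has_derivative (\<lambda>h. h *\<^sub>R (f' t \<bullet> g (\<tau> n i) - f' t \<bullet> g t))) (at t within {?s i..?s (Suc i)})"
          unfolding has_vector_derivative_def by (rule has_derivative_subset[OF _ sub])
        have "dist (\<tau> n i) t \<le> T / n" using t \<tau>i step[of i] by (auto simp: dist_real_def)
        then have "dist (g (\<tau> n i)) (g t) < e" using d(2)[OF t0(2,1)] h by simp
        then have "\<bar>f' t \<bullet> (g (\<tau> n i) - g t)\<bar> \<le> M * e"
          by (intro order.trans[OF Cauchy_Schwarz_ineq2] mult_mono M t0) (auto simp: dist_norm less_imp_le intro: order.trans[OF norm_ge_zero M(2)[OF t0(1)]])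
        then have "\<bar>f' t \<bullet> g (\<tau> n i) - f' t \<bullet> g t\<bar> \<le> M * e" by (simp add: inner_diff_right)
        then show "onorm (\<lambda>h. h *\<^sub>R (f' t \<bullet> g (\<tau> n i) - f' t \<bullet> g t)) \<le> M * e"
          by (intro onorm_le) (simp add: abs_mult mult.commute mult_left_mono)
      qed (use le in auto)
      then show ?thesis using step[of i] T by (simp add: inner_diff_left algebra_simps)
    qed
    have "(\<Sum>i<n. J (?s (Suc i)) - J (?s i)) = J T - J 0"
      using n0 by (subst sum_lessThan_telescope) simp
    then have "norm ((\<Sum>i<n. (f (?s (Suc i)) - f (?s i)) \<bullet> g (\<tau> n i)) - (J T - J 0)) =
       \<bar>\<Sum>i<n. (f (?s (Suc i)) - f (?s i)) \<bullet> g (\<tau> n i) - (J (?s (Suc i)) - J (?s i))\<bar>"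
      by (simp add: sum_subtractf)
    also have "\<dots> \<le> (\<Sum>i<n. M * e * (T / n))" using piece by (intro order.trans[OF sum_abs] sum_mono) simp
    also have "\<dots> = M * e * T" using n0 by simp
    also have "\<dots> = r / 2 * (T / (T + 1))" using M T by (simp add: e_def)
    also have "\<dots> \<le> r / 2 * 1" using r T by (intro mult_left_mono) auto
    also have "\<dots> < r" using r by simp
    finally show "norm ((\<Sum>i<n. (f (?s (Suc i)) - f (?s i)) \<bullet> g (\<tau> n i)) - (J T - J 0)) < r" .
  qed
qed

lemma has_vector_derivative_continuous_on:
  assumes "\<And>t. t \<in> S \<Longrightarrow> (f has_vector_derivative f' t) (at t within S)"
  shows "continuous_on S f"
  unfolding continuous_on_eq_continuous_within by (intro ballI has_vector_derivative_continuous) (erule assms)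

text \<open>The backward flow solves the adjoint equation \<zeta>' = - B^T \<zeta> with terminal
  value \<xi>, which cancels the drift when paired with a solution.\<close>

lemma flow_backward_derivative:
  assumes E: "decaying_flow B E" and t: "t \<in> {0..T}"
  shows "((\<lambda>s. transpose (E (T - s)) *v \<xi>) has_vector_derivative - (transpose B *v (transpose (E (T - t)) *v \<xi>))) (at t within {0..T})"
proof -
  have lin: "bounded_linear (\<lambda>P. transpose P *v \<xi>)"
    by (intro bounded_linear_compose[OF bounded_bilinear.bounded_linear_left[OF bounded_bilinear_matrix_vector]]
        bounded_linear_transpose)
  have "(E has_vector_derivative E (T - t) ** B) (at (T - t) within (\<lambda>s. T - s) ` {0..T})"
    by (rule has_vector_derivative_within_subset[OF decaying_flowD(2)[OF E]]) (use t in auto)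
  moreover have "((\<lambda>s. T - s) has_vector_derivative -1) (at t within {0..T})"
    by (auto intro!: derivative_eq_intros)
  ultimately have "((\<lambda>s. E (T - s)) has_vector_derivative (-1) *\<^sub>R (E (T - t) ** B)) (at t within {0..T})"
    by (rule vector_diff_chain_within[rotated, unfolded o_def])
  from bounded_linear.has_vector_derivative[OF lin this] show ?thesis
    by (simp add: transpose_uminus bounded_bilinear.minus_left[OF bounded_bilinear_matrix_vector]
        matrix_transpose_mul matrix_vector_mul_assoc)
qed

text \<open>The pathwise form of \<xi> . (Z_T - E_T z) = \<integral> \<zeta> . A dW. The solution
  splits as Z = Y + U, with Y differentiable and U = A W; integration by parts puts the derivative
  on \<zeta>, and Abel summation returns to increments of W.\<close>

lemma sde_path_representation:
  fixes B A E T
  defines "\<zeta> \<xi> s \<equiv> transpose (E (T - s)) *v \<xi>"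
  assumes E: "decaying_flow B E" and T: "T \<ge> 0"
    and Z: "continuous_on {0..} Z" "\<And>t. t \<ge> 0 \<Longrightarrow> Z t = z + integral {0..t} (\<lambda>s. B *v Z s) + A *v W t"
    and W0: "W 0 = 0"
  shows "(\<lambda>n. \<Sum>i<n. (transpose A *v \<zeta> \<xi> (real i * T / n)) \<bullet> (W (real (Suc i) * T / n) - W (real i * T / n)))
     \<longlonglongrightarrow> \<xi> \<bullet> (Z T - E T *v z)"
proof -
  define U where "U t = A *v W t" for t
  define Y where "Y t = z + integral {0..t} (\<lambda>s. B *v Z s)" for t
  have BZ: "continuous_on {0..} (\<lambda>s. B *v Z s)"
    by (rule bounded_linear.continuous_on[OF matrix_vector_mul_bounded_linear Z(1)])
  have Y': "(Y has_vector_derivative B *v Z t) (at t within {0..T})" if "t \<in> {0..T}" for t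
    unfolding Y_def
    using integral_has_vector_derivative[of 0 T "\<lambda>s. B *v Z s" t] that continuous_on_subset[OF BZ, of "{0..T}"]
    by (auto intro!: derivative_eq_intros)
  have Z': "Z t = Y t + U t" if "t \<ge> 0" for t using Z(2)[OF that] by (simp add: Y_def U_def)
  have Yc: "continuous_on {0..T} Y"
    by (rule has_vector_derivative_continuous_on) (rule Y')
  \<comment> \<open>Continuity of U is inherited from Z and Y.\<close>
  have Uc: "continuous_on {0..T} U"
  proof -
    have "continuous_on {0..T} (\<lambda>t. Z t - Y t)"
      by (intro continuous_on_diff Yc continuous_on_subset[OF Z(1)]) auto
    then show ?thesis by (rule continuous_on_eq) (use Z' in auto)
  qed
  have \<zeta>c: "continuous_on {0..T} (\<zeta> \<xi>)"
    unfolding \<zeta>_def by (rule has_vector_derivative_continuous_on) (rule flow_backward_derivative[OF E])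
  have \<zeta>'c: "continuous_on {0..T} (\<lambda>s. - (transpose B *v \<zeta> \<xi> s))"
    by (intro continuous_intros bounded_linear.continuous_on[OF matrix_vector_mul_bounded_linear \<zeta>c])
  \<comment> \<open>Y' = B Z and \<zeta>' = - B^T \<zeta> give (\<zeta> . Y)' = B^T \<zeta> . (Z -
    Y) = B^T \<zeta> . U, so - \<zeta> . Y is an antiderivative of \<zeta>' . U.\<close>
  have J: "((\<lambda>t. - (\<zeta> \<xi> t \<bullet> Y t)) has_vector_derivative (- (transpose B *v \<zeta> \<xi> t)) \<bullet> U t) (at t within {0..T})"
    if t: "t \<in> {0..T}" for t
  proof -
    have "((\<lambda>t. - (\<zeta> \<xi> t \<bullet> Y t)) has_vector_derivative
        - (\<zeta> \<xi> t \<bullet> (B *v Z t) + (- (transpose B *v \<zeta> \<xi> t)) \<bullet> Y t)) (at t within {0..T})"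
      unfolding \<zeta>_def
      by (intro has_vector_derivative_minus bounded_bilinear.has_vector_derivative[OF bounded_bilinear_inner]
          flow_backward_derivative[OF E t] Y'[OF t])
    moreover have "- (\<zeta> \<xi> t \<bullet> (B *v Z t) + (- (transpose B *v \<zeta> \<xi> t)) \<bullet> Y t) = (- (transpose B *v \<zeta> \<xi> t)) \<bullet> U t"
      using t by (simp add: Z' inner_matrix_transpose inner_add_right)
    ultimately show ?thesis by (simp only:)
  qed
  have "(\<lambda>n. \<Sum>i<n. (\<zeta> \<xi> (real (Suc i) * T / n) - \<zeta> \<xi> (real i * T / n)) \<bullet> U (real (Suc i) * T / n))
      \<longlonglongrightarrow> - (\<zeta> \<xi> T \<bullet> Y T) - - (\<zeta> \<xi> 0 \<bullet> Y 0)"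
  proof (rule riemann_stieltjes_sum_tendsto[OF T _ J \<zeta>'c Uc])
    show "(\<zeta> \<xi> has_vector_derivative - (transpose B *v \<zeta> \<xi> t)) (at t within {0..T})" if "t \<in> {0..T}" for t
      using flow_backward_derivative[OF E that, of \<xi>] unfolding \<zeta>_def[abs_def] .
  qed (use T in \<open>auto simp: divide_right_mono mult_right_mono\<close>)
  then have lim: "(\<lambda>n. \<zeta> \<xi> T \<bullet> U T - (\<Sum>i<n. (\<zeta> \<xi> (real (Suc i) * T / n) - \<zeta> \<xi> (real i * T / n)) \<bullet> U (real (Suc i) * T / n)))
      \<longlonglongrightarrow> \<zeta> \<xi> T \<bullet> U T - (- (\<zeta> \<xi> T \<bullet> Y T) - - (\<zeta> \<xi> 0 \<bullet> Y 0))"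
    by (intro tendsto_intros)
  \<comment> \<open>Abel summation pairs \<zeta> at left endpoints with increments of W, so the sums
    against increments of \<zeta> must take U at right endpoints. The boundary term at 0 vanishes
    since W 0 = 0.\<close>
  have parts: "(\<Sum>i<n. (transpose A *v \<zeta> \<xi> (real i * T / n)) \<bullet> (W (real (Suc i) * T / n) - W (real i * T / n))) =
      \<zeta> \<xi> T \<bullet> U T - (\<Sum>i<n. (\<zeta> \<xi> (real (Suc i) * T / n) - \<zeta> \<xi> (real i * T / n)) \<bullet> U (real (Suc i) * T / n))"
    if n: "n > 0" for n
  proof -
    let ?s = "\<lambda>i. real i * T / n"
    have "(\<Sum>i<n. (transpose A *v \<zeta> \<xi> (?s i)) \<bullet> (W (?s (Suc i)) - W (?s i))) +
        (\<Sum>i<n. (\<zeta> \<xi> (?s (Suc i)) - \<zeta> \<xi> (?s i)) \<bullet> U (?s (Suc i))) =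
        (\<Sum>i<n. \<zeta> \<xi> (?s (Suc i)) \<bullet> U (?s (Suc i)) - \<zeta> \<xi> (?s i) \<bullet> U (?s i))"
      unfolding sum.distrib[symmetric]
      by (rule sum.cong) (simp_all add: U_def inner_matrix_transpose[symmetric] inner_diff_left inner_diff_right
          matrix_vector_mult_diff_distrib)
    also have "\<dots> = \<zeta> \<xi> T \<bullet> U T"
      using n by (subst sum_lessThan_telescope) (simp add: U_def W0)
    finally show ?thesis by simp
  qed
  have "\<zeta> \<xi> T = \<xi>" by (simp add: \<zeta>_def decaying_flowD(1)[OF E] transpose_mat)
  moreover have "\<zeta> \<xi> 0 \<bullet> Y 0 = \<xi> \<bullet> (E T *v z)" by (simp add: \<zeta>_def Y_def inner_matrix_transpose)
  ultimately have "\<zeta> \<xi> T \<bullet> U T - (- (\<zeta> \<xi> T \<bullet> Y T) - - (\<zeta> \<xi> 0 \<bullet> Y 0)) = \<xi> \<bullet> (Z T - E T *v z)"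
    using Z'[OF T] by (simp add: inner_diff_right inner_add_right)
  with lim have "(\<lambda>n. \<zeta> \<xi> T \<bullet> U T - (\<Sum>i<n. (\<zeta> \<xi> (real (Suc i) * T / n) - \<zeta> \<xi> (real i * T / n)) \<bullet> U (real (Suc i) * T / n)))
      \<longlonglongrightarrow> \<xi> \<bullet> (Z T - E T *v z)" by simp
  then show ?thesis
    by (rule Lim_transform_eventually)
      (rule eventually_mono[OF eventually_gt_at_top[of 0]], rule parts[symmetric], assumption)
qed

text \<open>By the Lyapunov equation \<zeta> . K \<zeta> has derivative |A^T \<zeta>|^2, so these
  sums, the variances of the noise sums above, converge to a difference of boundary values.\<close>

lemma noise_energy_tendsto:
  assumes E: "decaying_flow B E" and T: "T \<ge> 0" and K: "B ** K + K ** transpose B = - (A ** transpose A)"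
  shows "(\<lambda>n. \<Sum>i<n. T / n * (norm (transpose A *v (transpose (E (T - real i * T / n)) *v \<xi>)))\<^sup>2)
    \<longlonglongrightarrow> \<xi> \<bullet> (K *v \<xi>) - (transpose (E T) *v \<xi>) \<bullet> (K *v (transpose (E T) *v \<xi>))"
proof -
  define \<zeta> where "\<zeta> s = transpose (E (T - s)) *v \<xi>" for s
  have \<zeta>c: "continuous_on {0..T} \<zeta>"
    unfolding \<zeta>_def by (rule has_vector_derivative_continuous_on) (rule flow_backward_derivative[OF E])
  let ?q = "\<lambda>s. \<zeta> s \<bullet> (K *v \<zeta> s)"
  have q': "(?q has_vector_derivative 1 \<bullet> (norm (transpose A *v \<zeta> t))\<^sup>2) (at t within {0..T})" if t: "t \<in> {0..T}" for t
  proof -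
    have "(?q has_vector_derivative \<zeta> t \<bullet> (K *v - (transpose B *v \<zeta> t)) + (- (transpose B *v \<zeta> t)) \<bullet> (K *v \<zeta> t)) (at t within {0..T})"
      unfolding \<zeta>_def
      by (intro bounded_bilinear.has_vector_derivative[OF bounded_bilinear_inner]
          bounded_linear.has_vector_derivative[OF matrix_vector_mul_bounded_linear]
          flow_backward_derivative[OF E t])
    moreover have "\<zeta> t \<bullet> (K *v - (transpose B *v \<zeta> t)) + (- (transpose B *v \<zeta> t)) \<bullet> (K *v \<zeta> t)
       = - (\<zeta> t \<bullet> ((B ** K + K ** transpose B) *v \<zeta> t))"
      using inner_matrix_transpose[of "\<zeta> t" B "K *v \<zeta> t"]
      by (simp add: matrix_vector_mult_add_rdistrib inner_add_right matrix_vector_mul_assoc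
          bounded_bilinear.minus_right[OF bounded_bilinear_matrix_vector])
    moreover have "\<dots> = 1 \<bullet> (norm (transpose A *v \<zeta> t))\<^sup>2"
      unfolding K power2_norm_eq_inner inner_matrix_transpose[symmetric]
      by (simp add: bounded_bilinear.minus_left[OF bounded_bilinear_matrix_vector] matrix_vector_mul_assoc inner_matrix_transpose)
    ultimately show ?thesis by (simp only:)
  qed
  have "(\<lambda>n. \<Sum>i<n. (real (Suc i) * T / n - real i * T / n) \<bullet> (norm (transpose A *v \<zeta> (real i * T / n)))\<^sup>2) \<longlonglongrightarrow> ?q T - ?q 0"
  proof (rule riemann_stieltjes_sum_tendsto[OF T _ q'])
    show "((\<lambda>t. t) has_vector_derivative 1) (at t within {0..T})" for t by (auto intro!: derivative_eq_intros)
    show "continuous_on {0..T} (\<lambda>s. (norm (transpose A *v \<zeta> s))\<^sup>2)"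
      by (intro continuous_intros bounded_linear.continuous_on[OF matrix_vector_mul_bounded_linear \<zeta>c])
  qed (use T in \<open>auto simp: divide_right_mono mult_right_mono\<close>)
  moreover have "real (Suc i) * T / n - real i * T / n = T / n" for i and n :: nat
    by (simp add: algebra_simps add_divide_distrib)
  ultimately show ?thesis
    by (simp add: \<zeta>_def decaying_flowD(1)[OF E] transpose_mat)
qed

section \<open>Characteristic functions of Brownian increment sums and of the stationary law\<close>

lemma borel_measurable_join_vec [measurable (raw)]:
  fixes f :: "'a \<Rightarrow> real^'m" and g :: "'a \<Rightarrow> real^'n"
  assumes [measurable]: "f \<in> borel_measurable M" "g \<in> borel_measurable M"
  shows "(\<lambda>\<omega>. join_vec (f \<omega>) (g \<omega>)) \<in> borel_measurable M"
proof -
  have "linear (\<lambda>x :: real^'m. join_vec x (0 :: real^'n))" "linear (\<lambda>y :: real^'n. join_vec (0 :: real^'m) y)"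
    by (auto simp: linear_iff vec_eq_iff all_sum_iff join_vec_def)
  then have [measurable]: "(\<lambda>x :: real^'m. join_vec x (0 :: real^'n)) \<in> borel_measurable borel"
    "(\<lambda>y :: real^'n. join_vec (0 :: real^'m) y) \<in> borel_measurable borel"
    by (auto intro!: borel_measurable_continuous_onI linear_continuous_on simp: linear_linear)
  have "(\<lambda>\<omega>. join_vec (f \<omega>) 0 + join_vec 0 (g \<omega>)) \<in> borel_measurable M" by measurable
  moreover have "join_vec x 0 + join_vec 0 y = join_vec x y" for x :: "real^'m" and y :: "real^'n"
    by (auto simp: vec_eq_iff all_sum_iff join_vec_def)
  ultimately show ?thesis by simp
qed

text \<open>The coefficients \<open>a i\<close> absorb the frequency, which is why
  \<open>char\<close> is taken at 1.\<close>

lemma brownian_increments_char: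
  assumes W: "brownian_motion M W"
    and t: "0 \<le> t 0" "\<And>i. i < n \<Longrightarrow> t i < t (Suc i)"
  shows "char (distr M borel (\<lambda>\<omega>. \<Sum>i<n. a i \<bullet> (W (t (Suc i)) \<omega> - W (t i) \<omega>))) 1 =
    of_real (exp (- (\<Sum>i<n. (t (Suc i) - t i) * (norm (a i))\<^sup>2) / 2))"
proof -
  interpret prob_space M using W by (simp add: brownian_motion_def)
  have tn: "0 \<le> t i" if "i \<le> n" for i
    using that by (induction i) (use t in \<open>auto intro: order.trans less_imp_le simp: Suc_le_eq\<close>)
  have [measurable]: "W (t i) \<in> borel_measurable M" if "i \<le> n" for i
    using W tn[OF that] by (simp add: brownian_motion_def)
  have "indep_vars (\<lambda>_. borel) (\<lambda>i \<omega>. W (t (Suc i)) \<omega> - W (t i) \<omega>) {..<n}"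
    using W t by (simp add: brownian_motion_def)
  then have "indep_vars (\<lambda>_. borel) (\<lambda>i \<omega>. a i \<bullet> (W (t (Suc i)) \<omega> - W (t i) \<omega>)) {..<n}"
    by (rule indep_vars_compose2) simp
  then have "char (distr M borel (\<lambda>\<omega>. \<Sum>i<n. a i \<bullet> (W (t (Suc i)) \<omega> - W (t i) \<omega>))) 1 =
      (\<Prod>i<n. char (distr M borel (\<lambda>\<omega>. a i \<bullet> (W (t (Suc i)) \<omega> - W (t i) \<omega>))) 1)"
    by (rule char_distr_sum)
  also have "\<dots> = (\<Prod>i<n. of_real (exp (- ((t (Suc i) - t i) * (norm (a i))\<^sup>2) / 2)))"
  proof (rule prod.cong[OF refl])
    fix i assume "i \<in> {..<n}"
    then have i: "i < n" "i \<le> n" "Suc i \<le> n" by auto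
    note [measurable] = \<open>\<And>i. i \<le> n \<Longrightarrow> W (t i) \<in> borel_measurable M\<close>[OF i(2)]
      \<open>\<And>i. i \<le> n \<Longrightarrow> W (t i) \<in> borel_measurable M\<close>[OF i(3)]
    have law: "distr M borel (\<lambda>\<omega>. W (t (Suc i)) \<omega> - W (t i) \<omega>) = gaussian_measure 0 (mat (t (Suc i) - t i))"
      using W tn[OF i(2)] t(2)[OF i(1)] by (simp add: brownian_motion_def)
    have "char (distr M borel (\<lambda>\<omega>. a i \<bullet> (W (t (Suc i)) \<omega> - W (t i) \<omega>))) 1 =
        vchar (distr M borel (\<lambda>\<omega>. W (t (Suc i)) \<omega> - W (t i) \<omega>)) (a i)"
      by (simp add: char_def vchar_def integral_distr)
    also have "\<dots> = of_real (exp (- ((t (Suc i) - t i) * (norm (a i))\<^sup>2) / 2))"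
      unfolding law using t(2)[OF i(1)]
      by (subst vchar_gaussian_measure) (auto intro: pos_def_mat simp: mat_vector power2_norm_eq_inner)
    finally show "char (distr M borel (\<lambda>\<omega>. a i \<bullet> (W (t (Suc i)) \<omega> - W (t i) \<omega>))) 1 =
        of_real (exp (- ((t (Suc i) - t i) * (norm (a i))\<^sup>2) / 2))" .
  qed
  also have "\<dots> = of_real (exp (- (\<Sum>i<n. (t (Suc i) - t i) * (norm (a i))\<^sup>2) / 2))"
    unfolding of_real_prod[symmetric] by (subst exp_sum[symmetric]) (simp_all add: sum_negf sum_divide_distrib)
  finally show ?thesis .
qed

text \<open>A finite sum of increments is a measurable function of the path. This is how
  independence of whole processes descends to the sums.\<close>

lemma increment_sum_generated:
  fixes X :: "real \<Rightarrow> 'w \<Rightarrow> real^'k"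
  assumes t: "\<And>i. i \<le> n \<Longrightarrow> 0 \<le> t i"
  shows "sigma_sets \<Omega> {(\<lambda>\<omega>. \<Sum>i<n. c i \<bullet> (X (t (Suc i)) \<omega> - X (t i) \<omega>)) -` S \<inter> \<Omega> |S. S \<in> sets borel}
    \<subseteq> sets (vimage_algebra \<Omega> (\<lambda>\<omega>. \<lambda>t\<in>{0..}. X t \<omega>) (\<Pi>\<^sub>M t\<in>{0..}. borel))"
proof -
  let ?V = "vimage_algebra (\<Omega>) (\<lambda>\<omega>. \<lambda>t\<in>{0..}. X t \<omega>) (\<Pi>\<^sub>M t\<in>{0..}. borel :: (real^'k) measure)"
  have X: "X s \<in> borel_measurable ?V" if s: "s \<ge> 0" for s
  proof -
    have "(\<lambda>\<omega>. \<lambda>t\<in>{0..}. X t \<omega>) \<in> ?V \<rightarrow>\<^sub>M (\<Pi>\<^sub>M t\<in>{0..}. borel)"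
      by (rule measurable_vimage_algebra1) (auto simp: space_PiM)
    from measurable_compose[OF this measurable_component_singleton[of s "{0..}" "\<lambda>_. borel"]] s
    show ?thesis by simp
  qed
  have "(\<lambda>\<omega>. \<Sum>i<n. c i \<bullet> (X (t (Suc i)) \<omega> - X (t i) \<omega>)) \<in> borel_measurable ?V"
    by (intro borel_measurable_sum borel_measurable_inner borel_measurable_const borel_measurable_diff X t) auto
  from measurable_sets[OF this]
  have "{(\<lambda>\<omega>. \<Sum>i<n. c i \<bullet> (X (t (Suc i)) \<omega> - X (t i) \<omega>)) -` S \<inter> \<Omega> |S. S \<in> sets borel} \<subseteq> sets ?V"
    by auto
  then show ?thesis using sets.sigma_sets_subset[of _ ?V] by simp
qed

lemma independent_processes_sums:
  fixes U :: "real \<Rightarrow> 'w \<Rightarrow> real^'m" and V :: "real \<Rightarrow> 'w \<Rightarrow> real^'n"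
  assumes M: "prob_space M" and UV: "independent_processes M U V"
    and meas: "\<And>s. s \<ge> 0 \<Longrightarrow> U s \<in> borel_measurable M" "\<And>s. s \<ge> 0 \<Longrightarrow> V s \<in> borel_measurable M"
    and t: "\<And>i. i \<le> n \<Longrightarrow> 0 \<le> t i"
  shows "prob_space.indep_var M borel (\<lambda>\<omega>. \<Sum>i<n. a i \<bullet> (U (t (Suc i)) \<omega> - U (t i) \<omega>))
    borel (\<lambda>\<omega>. \<Sum>i<n. b i \<bullet> (V (t (Suc i)) \<omega> - V (t i) \<omega>))"
proof -
  interpret prob_space M by fact
  have "indep_set (sigma_sets (space M) {(\<lambda>\<omega>. \<Sum>i<n. a i \<bullet> (U (t (Suc i)) \<omega> - U (t i) \<omega>)) -` S \<inter> space M |S. S \<in> sets borel})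
      (sigma_sets (space M) {(\<lambda>\<omega>. \<Sum>i<n. b i \<bullet> (V (t (Suc i)) \<omega> - V (t i) \<omega>)) -` S \<inter> space M |S. S \<in> sets borel})"
    using UV unfolding independent_processes_def indep_set_def
    by (rule indep_sets_mono_sets)
      (use increment_sum_generated[where t = t and n = n and X = U and c = a, OF t]
         increment_sum_generated[where t = t and n = n and X = V and c = b, OF t] in \<open>simp split: bool.split\<close>)
  moreover have "(\<lambda>\<omega>. \<Sum>i<n. a i \<bullet> (U (t (Suc i)) \<omega> - U (t i) \<omega>)) \<in> borel_measurable M"
    "(\<lambda>\<omega>. \<Sum>i<n. b i \<bullet> (V (t (Suc i)) \<omega> - V (t i) \<omega>)) \<in> borel_measurable M"
    by (intro borel_measurable_sum borel_measurable_inner borel_measurable_const borel_measurable_diff meas t; auto)+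
  ultimately show ?thesis unfolding indep_var_eq by blast
qed

text \<open>Splitting every coefficient into its two parts separates the noises; independence
  multiplies the characteristic functions and the squared norms add up again.\<close>

lemma joint_noise_char:
  fixes W1 :: "real \<Rightarrow> 'w \<Rightarrow> real^'m" and W2 :: "real \<Rightarrow> 'w \<Rightarrow> real^'n" and a :: "nat \<Rightarrow> real^('m + 'n)"
  assumes W: "brownian_motion M W1" "brownian_motion M W2" "independent_processes M W1 W2"
    and t: "0 \<le> t 0" "\<And>i. i < n \<Longrightarrow> t i < t (Suc i)"
  defines "W \<equiv> \<lambda>t \<omega>. join_vec (W1 t \<omega>) (W2 t \<omega>)"
  shows "(CLINT \<omega>|M. iexp (\<Sum>i<n. a i \<bullet> (W (t (Suc i)) \<omega> - W (t i) \<omega>))) =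
    of_real (exp (- (\<Sum>i<n. (t (Suc i) - t i) * (norm (a i))\<^sup>2) / 2))"
proof -
  interpret prob_space M using W(1) by (simp add: brownian_motion_def)
  have meas: "W1 s \<in> borel_measurable M" "W2 s \<in> borel_measurable M" if "s \<ge> 0" for s
    using W(1,2) that by (simp_all add: brownian_motion_def)
  have tn: "0 \<le> t i" if "i \<le> n" for i
    using that by (induction i) (use t in \<open>auto intro: order.trans less_imp_le simp: Suc_le_eq\<close>)
  let ?S1 = "\<lambda>\<omega>. \<Sum>i<n. x_part (a i) \<bullet> (W1 (t (Suc i)) \<omega> - W1 (t i) \<omega>)"
  let ?S2 = "\<lambda>\<omega>. \<Sum>i<n. y_part (a i) \<bullet> (W2 (t (Suc i)) \<omega> - W2 (t i) \<omega>)"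
  have split: "a i \<bullet> (join_vec x y - join_vec x' y') = x_part (a i) \<bullet> (x - x') + y_part (a i) \<bullet> (y - y')" for i x y x' y'
    using inner_join_vec[of "x_part (a i)" "y_part (a i)"] by (simp add: join_parts inner_diff_right)
  have norm: "(norm (a i))\<^sup>2 = (norm (x_part (a i)))\<^sup>2 + (norm (y_part (a i)))\<^sup>2" for i
    using inner_join_vec[of "x_part (a i)" "y_part (a i)" "x_part (a i)" "y_part (a i)"]
    by (simp add: join_parts power2_norm_eq_inner)
  have indep: "indep_var borel ?S1 borel ?S2"
    by (rule independent_processes_sums[OF prob_space_axioms W(3) meas tn])
  note [measurable] = indep_var_rv1[OF indep] indep_var_rv2[OF indep]
  have "(CLINT \<omega>|M. iexp (\<Sum>i<n. a i \<bullet> (W (t (Suc i)) \<omega> - W (t i) \<omega>))) =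
      char (distr M borel (\<lambda>\<omega>. ?S1 \<omega> + ?S2 \<omega>)) 1"
    unfolding char_def by (subst integral_distr) (simp_all add: W_def split sum.distrib)
  also have "\<dots> = char (distr M borel ?S1) 1 * char (distr M borel ?S2) 1"
    by (rule char_distr_add[OF indep])
  also have "\<dots> = of_real (exp (- (\<Sum>i<n. (t (Suc i) - t i) * (norm (a i))\<^sup>2) / 2))"
  proof -
    have c1: "char (distr M borel ?S1) 1 = of_real (exp (- (\<Sum>i<n. (t (Suc i) - t i) * (norm (x_part (a i)))\<^sup>2) / 2))"
      by (rule brownian_increments_char[OF W(1)]) (use t in auto)
    have c2: "char (distr M borel ?S2) 1 = of_real (exp (- (\<Sum>i<n. (t (Suc i) - t i) * (norm (y_part (a i)))\<^sup>2) / 2))"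
      by (rule brownian_increments_char[OF W(2)]) (use t in auto)
    show ?thesis unfolding c1 c2 norm
      by (simp add: exp_add[symmetric] sum.distrib distrib_left add_divide_distrib flip: of_real_mult)
  qed
  finally show ?thesis .
qed

text \<open>The flow acts linearly on the start: Z_T = E_T z + G almost surely with one noise G for
  all z. By invariance \<mu> is the law of E_T z + G under the product of \<mu> and M, and its
  characteristic function factors.\<close>

lemma invariant_measure_vchar:
  fixes W1 :: "real \<Rightarrow> 'w \<Rightarrow> real^'m" and W2 :: "real \<Rightarrow> 'w \<Rightarrow> real^'n"
    and B A K :: "real^('m + 'n)^('m + 'n)"
  assumes W: "brownian_motion M W1" "brownian_motion M W2" "independent_processes M W1 W2"
    and inv: "invariant_measure M (\<lambda>t \<omega>. join_vec (W1 t \<omega>) (W2 t \<omega>)) B A \<mu>"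
    and E: "decaying_flow B E" and K: "B ** K + K ** transpose B = - (A ** transpose A)" and T: "T > 0"
  shows "vchar \<mu> \<xi> = vchar \<mu> (transpose (E T) *v \<xi>) *
    of_real (exp (- (\<xi> \<bullet> (K *v \<xi>) - (transpose (E T) *v \<xi>) \<bullet> (K *v (transpose (E T) *v \<xi>))) / 2))"
proof -
  define W where "W = (\<lambda>t \<omega>. join_vec (W1 t \<omega>) (W2 t \<omega>))"
  interpret M: prob_space M using W(1) by (simp add: brownian_motion_def)
  from inv obtain Z where \<mu>: "prob_space \<mu>" "sets \<mu> = sets borel"
    and Z: "\<And>z. sde_solution M W B A z (Z z)"
    and stat: "\<And>t S. t \<ge> 0 \<Longrightarrow> S \<in> sets borel \<Longrightarrow> (\<integral>\<^sup>+ z. emeasure (distr M borel (Z z t)) S \<partial>\<mu>) = emeasure \<mu> S"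
    unfolding invariant_measure_def W_def by blast
  interpret \<mu>: prob_space \<mu> by fact
  interpret P: pair_prob_space \<mu> M ..
  note [measurable_cong] = \<mu>(2)
  have space: "space \<mu> = UNIV" using sets_eq_imp_space_eq[OF \<mu>(2)] by simp
  have [measurable]: "Z z T \<in> borel_measurable M" for z using Z[of z] T by (simp add: sde_solution_def)
  let ?a = "\<lambda>\<xi> n i. transpose A *v (transpose (E (T - real i * T / n)) *v \<xi>)"
  let ?N = "\<lambda>\<xi> n \<omega>. \<Sum>i<n. ?a \<xi> n i \<bullet> (W (real (Suc i) * T / n) \<omega> - W (real i * T / n) \<omega>)"
  have W0: "AE \<omega> in M. W 0 \<omega> = 0"
  proof -
    have "AE \<omega> in M. W1 0 \<omega> = 0" "AE \<omega> in M. W2 0 \<omega> = 0" using W(1,2) by (simp_all add: brownian_motion_def)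
    then show ?thesis by eventually_elim (simp add: W_def join_vec_eq_0)
  qed
  have lim: "AE \<omega> in M. \<forall>\<xi>. (\<lambda>n. ?N \<xi> n \<omega>) \<longlonglongrightarrow> \<xi> \<bullet> (Z z T \<omega> - E T *v z)" for z
  proof -
    have "AE \<omega> in M. continuous_on {0..} (\<lambda>t. Z z t \<omega>) \<and>
        (\<forall>t\<ge>0. Z z t \<omega> = z + integral {0..t} (\<lambda>s. B *v Z z s \<omega>) + A *v W t \<omega>)"
      using Z[of z] by (simp add: sde_solution_def)
    with W0 show ?thesis
    proof eventually_elim
      case (elim \<omega>)
      show ?case
        using sde_path_representation[OF E, of T "\<lambda>t. Z z t \<omega>" z A "\<lambda>t. W t \<omega>"] elim T by auto
    qed
  qed
  \<comment> \<open>The solution started at 0 consists of noise alone.\<close>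
  define G where "G = Z 0 T"
  have [measurable]: "G \<in> borel_measurable M" by (simp add: G_def)
  \<comment> \<open>The noise sums do not involve z, so for any two starting points their limits
    agree.\<close>
  have ZG: "AE \<omega> in M. Z z T \<omega> = E T *v z + G \<omega>" for z
    using lim[of z] lim[of 0]
  proof eventually_elim
    case (elim \<omega>)
    have "\<xi> \<bullet> (Z z T \<omega> - E T *v z) = \<xi> \<bullet> (Z 0 T \<omega> - E T *v 0)" for \<xi>
      using elim LIMSEQ_unique by blast
    then have "\<xi> \<bullet> (Z z T \<omega> - E T *v z - G \<omega>) = 0" for \<xi>
      by (simp add: G_def inner_diff_right)
    then have "Z z T \<omega> - E T *v z - G \<omega> = 0" using inner_eq_zero_iff by blast
    then show ?case by (simp add: algebra_simps)
  qed
  \<comment> \<open>The exceptional null set in \<open>ZG\<close> depends on z. Laws are therefore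
    compared for each fixed z, and the product measure only sees the jointly measurable map (z,
    \<omega>) to E_T z + G \<omega>.\<close>
  have law: "\<mu> = distr (\<mu> \<Otimes>\<^sub>M M) borel (\<lambda>(z, \<omega>). E T *v z + G \<omega>)"
  proof (rule measure_eqI)
    fix S assume "S \<in> sets \<mu>"
    then have [measurable]: "S \<in> sets borel" by (simp add: \<mu>(2))
    have "emeasure \<mu> S = (\<integral>\<^sup>+ z. emeasure (distr M borel (Z z T)) S \<partial>\<mu>)" using stat[of T S] T by simp
    also have "\<dots> = (\<integral>\<^sup>+ z. emeasure M (Pair z -` ((\<lambda>(z, \<omega>). E T *v z + G \<omega>) -` S \<inter> space (\<mu> \<Otimes>\<^sub>M M))) \<partial>\<mu>)"
    proof (rule nn_integral_cong)
      fix z assume z: "z \<in> space \<mu>"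
      have "distr M borel (Z z T) = distr M borel (\<lambda>\<omega>. E T *v z + G \<omega>)"
        by (rule distr_cong_AE[OF refl refl ZG]) simp_all
      then have "emeasure (distr M borel (Z z T)) S = emeasure M ((\<lambda>\<omega>. E T *v z + G \<omega>) -` S \<inter> space M)"
        by (simp add: emeasure_distr)
      also have "(\<lambda>\<omega>. E T *v z + G \<omega>) -` S \<inter> space M = Pair z -` ((\<lambda>(z, \<omega>). E T *v z + G \<omega>) -` S \<inter> space (\<mu> \<Otimes>\<^sub>M M))"
        using z by (auto simp: space_pair_measure)
      finally show "emeasure (distr M borel (Z z T)) S = emeasure M (Pair z -` ((\<lambda>(z, \<omega>). E T *v z + G \<omega>) -` S \<inter> space (\<mu> \<Otimes>\<^sub>M M)))" .
    qed
    also have "\<dots> = emeasure (\<mu> \<Otimes>\<^sub>M M) ((\<lambda>(z, \<omega>). E T *v z + G \<omega>) -` S \<inter> space (\<mu> \<Otimes>\<^sub>M M))"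
      by (rule M.emeasure_pair_measure_alt[symmetric]) (rule measurable_sets[of _ _ borel]; simp)
    also have "\<dots> = emeasure (distr (\<mu> \<Otimes>\<^sub>M M) borel (\<lambda>(z, \<omega>). E T *v z + G \<omega>)) S"
      by (rule emeasure_distr[symmetric]) simp_all
    finally show "emeasure \<mu> S = \<dots>" .
  qed (simp add: \<mu>(2))
  have G: "(CLINT \<omega>|M. iexp (\<xi> \<bullet> G \<omega>)) =
      of_real (exp (- (\<xi> \<bullet> (K *v \<xi>) - (transpose (E T) *v \<xi>) \<bullet> (K *v (transpose (E T) *v \<xi>))) / 2))"
  proof -
    have Wm: "W s \<in> borel_measurable M" if "s \<ge> 0" for s
      using W(1,2) that unfolding W_def brownian_motion_def by (intro borel_measurable_join_vec) auto
    have Nm: "?N \<xi> n \<in> borel_measurable M" for n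
      by (intro borel_measurable_sum borel_measurable_inner borel_measurable_const borel_measurable_diff Wm)
        (use T in auto)
    have "(\<lambda>n. CLINT \<omega>|M. iexp (?N \<xi> n \<omega>)) \<longlonglongrightarrow> (CLINT \<omega>|M. iexp (\<xi> \<bullet> G \<omega>))"
    proof (rule integral_dominated_convergence[of _ _ _ "\<lambda>_. 1"])
      show "AE \<omega> in M. (\<lambda>n. iexp (?N \<xi> n \<omega>)) \<longlonglongrightarrow> iexp (\<xi> \<bullet> G \<omega>)"
        using lim[of 0]
      proof eventually_elim
        case (elim \<omega>)
        then have "(\<lambda>n. ?N \<xi> n \<omega>) \<longlonglongrightarrow> \<xi> \<bullet> G \<omega>" by (simp add: G_def)
        then show ?case by (intro tendsto_intros)
      qed
      show "(\<lambda>\<omega>. iexp (?N \<xi> n \<omega>)) \<in> borel_measurable M" for n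
        by (rule measurable_compose[OF Nm[of n], of "\<lambda>x. iexp x" borel]) simp
    qed auto
    moreover have "(\<lambda>n. CLINT \<omega>|M. iexp (?N \<xi> n \<omega>)) \<longlonglongrightarrow>
      of_real (exp (- (\<xi> \<bullet> (K *v \<xi>) - (transpose (E T) *v \<xi>) \<bullet> (K *v (transpose (E T) *v \<xi>))) / 2))"
    proof -
      have lim: "(\<lambda>n. complex_of_real (exp (- (\<Sum>i<n. T / n * (norm (?a \<xi> n i))\<^sup>2) / 2))) \<longlonglongrightarrow>
        of_real (exp (- (\<xi> \<bullet> (K *v \<xi>) - (transpose (E T) *v \<xi>) \<bullet> (K *v (transpose (E T) *v \<xi>))) / 2))"
        by (intro tendsto_intros noise_energy_tendsto[OF E _ K]) (use T in auto)
      have eq: "(CLINT \<omega>|M. iexp (?N \<xi> n \<omega>)) = of_real (exp (- (\<Sum>i<n. T / n * (norm (?a \<xi> n i))\<^sup>2) / 2))" if "n > 0" for n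
      proof -
        have inc: "real (Suc i) * T / n - real i * T / n = T / n" for i
          by (simp add: algebra_simps add_divide_distrib)
        have lt: "real i * T / n < real (Suc i) * T / n" for i
          using T that by (intro divide_strict_right_mono) auto
        show ?thesis
          using joint_noise_char[OF W, of "\<lambda>i. real i * T / n" n "?a \<xi> n"] lt
          unfolding inc W_def by simp
      qed
      show ?thesis
        by (rule Lim_transform_eventually[OF lim])
          (rule eventually_mono[OF eventually_gt_at_top[of 0]], rule eq[symmetric], assumption)
    qed
    ultimately show ?thesis by (rule LIMSEQ_unique)
  qed
  have "vchar \<mu> \<xi> = (CLINT p|(\<mu> \<Otimes>\<^sub>M M). iexp (\<xi> \<bullet> (E T *v fst p + G (snd p))))"
    unfolding vchar_def by (subst law, subst integral_distr) (simp_all add: split_beta)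
  also have "\<dots> = (CLINT z|\<mu>. (CLINT \<omega>|M. iexp (\<xi> \<bullet> (E T *v z + G \<omega>))))"
    by (subst P.integral_fst'[symmetric])
      (rule P.integrable_const_bound[of _ 1], auto simp: split_beta)
  also have "\<dots> = (CLINT z|\<mu>. iexp ((transpose (E T) *v \<xi>) \<bullet> z) * (CLINT \<omega>|M. iexp (\<xi> \<bullet> G \<omega>)))"
    by (simp add: inner_add_right inner_matrix_transpose distrib_left exp_add)
  also have "\<dots> = vchar \<mu> (transpose (E T) *v \<xi>) * (CLINT \<omega>|M. iexp (\<xi> \<bullet> G \<omega>))"
    by (simp add: vchar_def)
  finally show ?thesis unfolding G .
qed

lemma invariant_measure_gaussian:
  fixes W1 :: "real \<Rightarrow> 'w \<Rightarrow> real^'m" and W2 :: "real \<Rightarrow> 'w \<Rightarrow> real^'n"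
    and B A K :: "real^('m + 'n)^('m + 'n)"
  assumes W: "brownian_motion M W1" "brownian_motion M W2" "independent_processes M W1 W2"
    and inv: "invariant_measure M (\<lambda>t \<omega>. join_vec (W1 t \<omega>) (W2 t \<omega>)) B A \<mu>"
    and B: "hurwitz B" and K: "lyapunov_solution B A K"
  shows "\<mu> = gaussian_measure 0 K"
proof -
  from K have pd: "pos_def_matrix K" and lyap: "B ** K + K ** transpose B = - (A ** transpose A)"
    by (simp_all add: lyapunov_solution_def)
  obtain E where E: "decaying_flow B E" using hurwitz_flow[OF B] by blast
  from inv have \<mu>: "prob_space \<mu>" "sets \<mu> = sets borel" by (auto simp: invariant_measure_def)
  interpret \<mu>: prob_space \<mu> by fact
  note [measurable_cong] = \<mu>(2)
  show ?thesis
  proof (rule vchar_determines_measure[OF \<mu> prob_space_gaussian_measure[OF pd] sets_gaussian_measure])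
    fix \<xi>
    \<comment> \<open>Times tend to infinity through the positive integers; \<open>Suc\<close>
      excludes T = 0. The characteristic function of \<mu> along \<open>?\<eta>\<close> then tends
      to its value 1 at the origin.\<close>
    let ?\<eta> = "\<lambda>n. transpose (E (real (Suc n))) *v \<xi>"
    have "(\<lambda>n. E (real (Suc n))) \<longlonglongrightarrow> 0"
      by (rule filterlim_compose[OF decaying_flowD(3)[OF E]])
        (rule filterlim_compose[OF filterlim_real_sequentially filterlim_Suc])
    then have "?\<eta> \<longlonglongrightarrow> transpose 0 *v \<xi>"
      by (intro bounded_bilinear.tendsto[OF bounded_bilinear_matrix_vector] tendsto_const
          bounded_linear.tendsto[OF bounded_linear_transpose])
    then have \<eta>: "?\<eta> \<longlonglongrightarrow> 0" by (simp add: transpose_zero)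
    have "(\<lambda>n. vchar \<mu> (?\<eta> n)) \<longlonglongrightarrow> (CLINT x|\<mu>. 1)"
      unfolding vchar_def
    proof (rule integral_dominated_convergence[of _ _ _ "\<lambda>_. 1"])
      show "AE x in \<mu>. (\<lambda>n. iexp (?\<eta> n \<bullet> x)) \<longlonglongrightarrow> 1"
      proof (rule AE_I2)
        fix x
        have "(\<lambda>n. iexp (?\<eta> n \<bullet> x)) \<longlonglongrightarrow> iexp (0 \<bullet> x)" by (intro tendsto_intros \<eta>)
        then show "(\<lambda>n. iexp (?\<eta> n \<bullet> x)) \<longlonglongrightarrow> 1" by simp
      qed
    qed auto
    then have "(\<lambda>n. vchar \<mu> (?\<eta> n) * of_real (exp (- (\<xi> \<bullet> (K *v \<xi>) - ?\<eta> n \<bullet> (K *v ?\<eta> n)) / 2)))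
        \<longlonglongrightarrow> (CLINT x|\<mu>. 1) * of_real (exp (- (\<xi> \<bullet> (K *v \<xi>) - 0 \<bullet> (K *v 0)) / 2))"
      by (intro tendsto_intros \<eta> bounded_linear.tendsto[OF matrix_vector_mul_bounded_linear]) simp_all
    moreover have "vchar \<mu> (?\<eta> n) * of_real (exp (- (\<xi> \<bullet> (K *v \<xi>) - ?\<eta> n \<bullet> (K *v ?\<eta> n)) / 2)) = vchar \<mu> \<xi>" for n
      by (rule invariant_measure_vchar[OF W inv E lyap, symmetric]) simp
    ultimately have "(\<lambda>n::nat. vchar \<mu> \<xi>) \<longlonglongrightarrow> of_real (exp (- (\<xi> \<bullet> (K *v \<xi>)) / 2))"
      using \<mu>.prob_space by simp
    then show "vchar \<mu> \<xi> = vchar (gaussian_measure 0 K) \<xi>"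
      by (simp add: vchar_gaussian_measure[OF pd] LIMSEQ_const_iff)
  qed
qed

section \<open>Conditional laws\<close>

lemma borel_measurable_parts [measurable]:
  "x_part \<in> borel_measurable borel" "y_part \<in> borel_measurable borel"
  by (auto intro!: borel_measurable_continuous_onI linear_continuous_on
      simp: linear_conv_bounded_linear[symmetric] linear_iff x_part_def y_part_def vec_eq_iff)

lemma gaussian_measure_shift:
  fixes C :: "real^'n^'n"
  assumes "pos_def_matrix C"
  shows "gaussian_measure m C = distr (gaussian_measure 0 C) borel (\<lambda>v. m + v)"
proof -
  obtain L :: "real^'n^'n" where L: "invertible L" "C = L ** transpose L"
    using pos_def_matrix_factor[OF assms] by blast
  show ?thesis
    unfolding L(2) gaussian_measure_eq_distr[OF L(1)] by (simp add: distr_distr o_def)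
qed

text \<open>The regression form: y is H x plus noise independent of x, whose covariance is the Schur
  complement. Characteristic functions reduce the claim to the completed square.\<close>

lemma gaussian_measure_block:
  fixes P :: "real^'m^'m" and S :: "real^'n^'n"
  assumes pd: "pos_def_matrix (block_matrix P Q R S)"
  shows "gaussian_measure 0 (block_matrix P Q R S) =
    distr (gaussian_measure 0 P \<Otimes>\<^sub>M gaussian_measure 0 (S - R ** matrix_inv P ** Q)) borel
      (\<lambda>(x, v). join_vec x ((R ** matrix_inv P) *v x + v))"
proof -
  let ?C = "S - R ** matrix_inv P ** Q" and ?H = "R ** matrix_inv P"
  note blk = pos_def_block[OF pd]
  have sP: "transpose P = P" using blk(2) by (simp add: pos_def_matrix_def)
  interpret P: prob_space "gaussian_measure 0 P" by (rule prob_space_gaussian_measure[OF blk(2)])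
  interpret C: prob_space "gaussian_measure 0 ?C" by (rule prob_space_gaussian_measure[OF blk(3)])
  interpret PC: pair_prob_space "gaussian_measure 0 P" "gaussian_measure 0 ?C" ..
  have [measurable]: "(\<lambda>(x, v). join_vec x (?H *v x + v)) \<in> borel_measurable (gaussian_measure 0 P \<Otimes>\<^sub>M gaussian_measure 0 ?C)"
    by measurable
  show ?thesis
  proof (rule vchar_determines_measure[OF prob_space_gaussian_measure[OF pd] sets_gaussian_measure])
    show "prob_space (distr (gaussian_measure 0 P \<Otimes>\<^sub>M gaussian_measure 0 ?C) borel (\<lambda>(x, v). join_vec x (?H *v x + v)))"
      by (rule PC.prob_space_distr) simp
    fix \<xi> :: "real^('m + 'n)"
    define a b where "a = x_part \<xi>" and "b = y_part \<xi>"
    have \<xi>: "\<xi> = join_vec a b" by (simp add: a_def b_def join_parts)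
    have "vchar (distr (gaussian_measure 0 P \<Otimes>\<^sub>M gaussian_measure 0 ?C) borel (\<lambda>(x, v). join_vec x (?H *v x + v))) \<xi> =
      (CLINT p|(gaussian_measure 0 P \<Otimes>\<^sub>M gaussian_measure 0 ?C). iexp ((a + transpose ?H *v b) \<bullet> fst p) * iexp (b \<bullet> snd p))"
      unfolding vchar_def \<xi>
      by (subst integral_distr) (simp_all add: split_beta inner_join_vec inner_add_right inner_add_left
          inner_matrix_transpose[of b ?H] algebra_simps exp_add)
    also have "\<dots> = (CLINT x|gaussian_measure 0 P. (CLINT v|gaussian_measure 0 ?C.
        iexp ((a + transpose ?H *v b) \<bullet> x) * iexp (b \<bullet> v)))"
      by (subst PC.integral_fst'[symmetric])
        (rule PC.integrable_const_bound[of _ 1], auto simp: norm_mult)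
    also have "\<dots> = vchar (gaussian_measure 0 P) (a + transpose ?H *v b) * vchar (gaussian_measure 0 ?C) b"
      by (simp add: vchar_def)
    also have "\<dots> = vchar (gaussian_measure 0 (block_matrix P Q R S)) \<xi>"
      unfolding vchar_gaussian_measure[OF pd] vchar_gaussian_measure[OF blk(2)] vchar_gaussian_measure[OF blk(3)] \<xi>
        schur_complement_quadratic[OF sP blk(1) pos_def_matrix_invertible[OF blk(2)]]
      by (simp add: exp_add[symmetric] add_divide_distrib flip: of_real_mult)
    finally show "vchar (gaussian_measure 0 (block_matrix P Q R S)) \<xi> =
      vchar (distr (gaussian_measure 0 P \<Otimes>\<^sub>M gaussian_measure 0 ?C) borel (\<lambda>(x, v). join_vec x (?H *v x + v))) \<xi>" by simp
  qed simp
qed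

text \<open>For fixed S both sides of the defining identity are measures in T: the law of y
  restricted to x in S, and the bind of the restricted marginal with \<kappa>. Equal measures
  integrate every nonnegative f equally.\<close>

lemma conditional_law_nn_integral:
  fixes \<mu> :: "(real^('m::finite + 'n::finite)) measure"
  assumes \<mu>: "prob_space \<mu>" "sets \<mu> = sets borel" and \<kappa>: "conditional_law \<mu> \<kappa>"
    and [measurable]: "S \<in> sets borel" "f \<in> borel_measurable borel"
  shows "(\<integral>\<^sup>+ z. indicator S (x_part z) * f (y_part z) \<partial>\<mu>) =
    (\<integral>\<^sup>+ x. indicator S x * (\<integral>\<^sup>+ y. f y \<partial>\<kappa> x) \<partial>distr \<mu> borel x_part)"
proof -
  note [measurable_cong] = \<mu>(2)
  have space: "space \<mu> = UNIV" using sets_eq_imp_space_eq[OF \<mu>(2)] by simp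
  let ?N = "density (distr \<mu> borel x_part) (indicator S)"
  have \<kappa>p: "\<kappa> \<in> borel \<rightarrow>\<^sub>M prob_algebra borel" using \<kappa> by (simp add: conditional_law_def)
  have [measurable]: "\<kappa> \<in> borel \<rightarrow>\<^sub>M subprob_algebra borel" by (rule measurable_prob_algebraD[OF \<kappa>p])
  have "distr (density \<mu> (\<lambda>z. indicator S (x_part z))) borel y_part = ?N \<bind> \<kappa>"
  proof (rule measure_eqI)
    show "sets (distr (density \<mu> (\<lambda>z. indicator S (x_part z))) borel y_part) = sets (?N \<bind> \<kappa>)"
      by (subst sets_bind[of _ _ borel]) (auto simp: subprob_measurableD(2)[of \<kappa> borel])
    fix T assume "T \<in> sets (distr (density \<mu> (\<lambda>z. indicator S (x_part z))) borel y_part)"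
    then have [measurable]: "T \<in> sets borel" by simp
    have "emeasure (distr (density \<mu> (\<lambda>z. indicator S (x_part z))) borel y_part) T =
        (\<integral>\<^sup>+ z. indicator S (x_part z) * indicator (y_part -` T \<inter> space \<mu>) z \<partial>\<mu>)"
      by (subst emeasure_distr) (simp_all add: emeasure_density)
    also have "\<dots> = (\<integral>\<^sup>+ z. indicator {z. x_part z \<in> S \<and> y_part z \<in> T} z \<partial>\<mu>)"
      by (rule nn_integral_cong) (auto simp: space split: split_indicator)
    also have "\<dots> = emeasure \<mu> {z. x_part z \<in> S \<and> y_part z \<in> T}"
    proof (rule nn_integral_indicator)
      have "{z \<in> space \<mu>. x_part z \<in> S \<and> y_part z \<in> T} \<in> sets \<mu>" by measurable
      then show "{z. x_part z \<in> S \<and> y_part z \<in> T} \<in> sets \<mu>" by (simp add: space)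
    qed
    also have "\<dots> = (\<integral>\<^sup>+ x\<in>S. emeasure (\<kappa> x) T \<partial>distr \<mu> borel x_part)"
      using \<kappa> by (simp add: conditional_law_def)
    also have "\<dots> = emeasure (?N \<bind> \<kappa>) T"
      by (subst emeasure_bind[of _ _ borel]) (auto simp: nn_integral_density mult.commute measurable_emeasure_subprob_algebra
          intro!: nn_integral_density[symmetric, THEN trans])
    finally show "emeasure (distr (density \<mu> (\<lambda>z. indicator S (x_part z))) borel y_part) T = emeasure (?N \<bind> \<kappa>) T" .
  qed
  then have "(\<integral>\<^sup>+ y. f y \<partial>distr (density \<mu> (\<lambda>z. indicator S (x_part z))) borel y_part) = (\<integral>\<^sup>+ y. f y \<partial>(?N \<bind> \<kappa>))"
    by simp
  moreover have "(\<integral>\<^sup>+ y. f y \<partial>distr (density \<mu> (\<lambda>z. indicator S (x_part z))) borel y_part) =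
      (\<integral>\<^sup>+ z. indicator S (x_part z) * f (y_part z) \<partial>\<mu>)"
    by (simp add: nn_integral_distr nn_integral_density)
  moreover have "(\<integral>\<^sup>+ y. f y \<partial>(?N \<bind> \<kappa>)) = (\<integral>\<^sup>+ x. (\<integral>\<^sup>+ y. f y \<partial>\<kappa> x) \<partial>?N)"
    by (rule nn_integral_bind[of _ borel]) simp_all
  moreover have "\<dots> = (\<integral>\<^sup>+ x. indicator S x * (\<integral>\<^sup>+ y. f y \<partial>\<kappa> x) \<partial>distr \<mu> borel x_part)"
    by (rule nn_integral_density) simp_all
  ultimately show ?thesis by simp
qed

lemma weakly_converges_isCont:
  assumes "\<And>x. weakly_converges \<kappa> (\<kappa> x) (at x)" "continuous_on UNIV f" "bounded (range f)"
  shows "continuous_on UNIV (\<lambda>x :: real^'m. integral\<^sup>L (\<kappa> x) (f :: real^'n \<Rightarrow> real))"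
  using assms by (auto simp: continuous_on_eq_continuous_at isCont_def weakly_converges_def)

text \<open>Both sides integrate a bounded continuous function to a continuous function of the condition, so the
  almost sure equality of regular conditional distributions holds everywhere.\<close>

lemma conditional_law_gaussian:
  fixes P :: "real^'m^'m" and S :: "real^'n^'n"
  assumes pd: "pos_def_matrix (block_matrix P Q R S)"
    and \<kappa>: "conditional_law (gaussian_measure 0 (block_matrix P Q R S)) \<kappa>"
  shows "\<kappa> x = gaussian_measure ((R ** matrix_inv P) *v x) (S - R ** matrix_inv P ** Q)"
proof -
  let ?C = "S - R ** matrix_inv P ** Q" and ?H = "R ** matrix_inv P" and ?\<mu> = "gaussian_measure 0 (block_matrix P Q R S)"
  let ?\<gamma> = "\<lambda>x. gaussian_measure (?H *v x) ?C"
  note blk = pos_def_block[OF pd]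
  interpret P: prob_space "gaussian_measure 0 P" by (rule prob_space_gaussian_measure[OF blk(2)])
  interpret C: prob_space "gaussian_measure 0 ?C" by (rule prob_space_gaussian_measure[OF blk(3)])
  interpret PC: pair_prob_space "gaussian_measure 0 P" "gaussian_measure 0 ?C" ..
  have \<kappa>p: "\<kappa> \<in> borel \<rightarrow>\<^sub>M prob_algebra borel" using \<kappa> by (simp add: conditional_law_def)
  have \<kappa>m[measurable]: "\<kappa> \<in> borel \<rightarrow>\<^sub>M subprob_algebra borel" by (rule measurable_prob_algebraD[OF \<kappa>p])
  have \<kappa>x: "prob_space (\<kappa> x)" "sets (\<kappa> x) = sets borel" for x
    using measurable_space[OF \<kappa>p, of x] by (auto simp: space_prob_algebra)
  have \<gamma>x: "prob_space (?\<gamma> x)" for x by (rule prob_space_gaussian_measure[OF blk(3)])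
  have [measurable]: "(\<lambda>(x, v). join_vec x (?H *v x + v)) \<in> borel_measurable (gaussian_measure 0 P \<Otimes>\<^sub>M gaussian_measure 0 ?C)"
    by measurable
  have marg: "distr ?\<mu> borel x_part = gaussian_measure 0 P"
  proof -
    have "distr ?\<mu> borel x_part = distr (gaussian_measure 0 P \<Otimes>\<^sub>M gaussian_measure 0 ?C) borel fst"
      unfolding gaussian_measure_block[OF pd] by (simp add: distr_distr o_def split_beta join_parts)
    also have "\<dots> = distr (gaussian_measure 0 P \<Otimes>\<^sub>M gaussian_measure 0 ?C) (gaussian_measure 0 P) fst"
      by (rule distr_cong) (simp_all add: sets_gaussian_measure)
    finally show ?thesis by (simp add: C.distr_pair_fst)
  qed
  show ?thesis
  proof (rule measure_eqI_bounded_continuous[OF \<kappa>x \<gamma>x sets_gaussian_measure])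
    fix f :: "real^'n \<Rightarrow> real" assume f: "continuous_on UNIV f" "\<And>x. 0 \<le> f x" "\<And>x. f x \<le> 1"
    have [measurable]: "f \<in> borel_measurable borel" by (rule borel_measurable_continuous_onI[OF f(1)])
    have bf: "bounded (range f)" using f(2,3) by (auto simp: bounded_real intro!: exI[of _ 1] simp: abs_le_iff intro: order.trans[of _ 0])
    have nn: "(\<integral>\<^sup>+ y. ennreal (f y) \<partial>M) = ennreal (integral\<^sup>L M f)" if M: "prob_space M" "sets M = sets borel" for M
    proof -
      interpret prob_space M by fact
      note [measurable_cong] = M(2)
      show ?thesis
        by (rule nn_integral_eq_integral) (use f in \<open>auto intro!: integrable_const_bound[of _ 1]\<close>)
    qed
    \<comment> \<open>As an integral of a shifted function against one fixed measure, this is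
      visibly measurable in x.\<close>
    have \<gamma>int: "(\<integral>\<^sup>+ y. ennreal (f y) \<partial>?\<gamma> x) = (\<integral>\<^sup>+ v. ennreal (f (?H *v x + v)) \<partial>gaussian_measure 0 ?C)" for x
      by (subst gaussian_measure_shift[OF blk(3)]) (simp add: nn_integral_distr)
    have \<gamma>meas[measurable]: "(\<lambda>x. \<integral>\<^sup>+ y. ennreal (f y) \<partial>?\<gamma> x) \<in> borel_measurable borel"
      unfolding \<gamma>int by measurable
    \<comment> \<open>The two conditional integrals are compared over all Borel sets of conditions;
      equality of the resulting measures gives equality of the densities almost everywhere.\<close>
    have "density (gaussian_measure 0 P) (\<lambda>x. \<integral>\<^sup>+ y. f y \<partial>\<kappa> x) = density (gaussian_measure 0 P) (\<lambda>x. \<integral>\<^sup>+ y. f y \<partial>?\<gamma> x)"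
    proof (rule measure_eqI)
      fix X assume "X \<in> sets (density (gaussian_measure 0 P) (\<lambda>x. \<integral>\<^sup>+ y. f y \<partial>\<kappa> x))"
      then have [measurable]: "X \<in> sets borel" by (simp add: sets_gaussian_measure)
      have "emeasure (density (gaussian_measure 0 P) (\<lambda>x. \<integral>\<^sup>+ y. f y \<partial>\<kappa> x)) X =
          (\<integral>\<^sup>+ x. indicator X x * (\<integral>\<^sup>+ y. f y \<partial>\<kappa> x) \<partial>distr ?\<mu> borel x_part)"
        unfolding marg by (subst emeasure_density) (simp_all add: mult.commute)
      also have "\<dots> = (\<integral>\<^sup>+ z. indicator X (x_part z) * ennreal (f (y_part z)) \<partial>?\<mu>)"
        by (rule conditional_law_nn_integral[OF prob_space_gaussian_measure[OF pd] sets_gaussian_measure \<kappa>, symmetric]) simp_all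
      also have "\<dots> = (\<integral>\<^sup>+ p. indicator X (fst p) * ennreal (f (?H *v fst p + snd p)) \<partial>(gaussian_measure 0 P \<Otimes>\<^sub>M gaussian_measure 0 ?C))"
        unfolding gaussian_measure_block[OF pd]
        by (subst nn_integral_distr) (simp_all add: split_beta join_parts)
      also have "\<dots> = (\<integral>\<^sup>+ x. (\<integral>\<^sup>+ v. indicator X x * ennreal (f (?H *v x + v)) \<partial>gaussian_measure 0 ?C) \<partial>gaussian_measure 0 P)"
        by (subst C.nn_integral_fst[symmetric]) simp_all
      also have "\<dots> = (\<integral>\<^sup>+ x. indicator X x * (\<integral>\<^sup>+ y. f y \<partial>?\<gamma> x) \<partial>gaussian_measure 0 P)"
        unfolding \<gamma>int by (simp add: nn_integral_cmult)
      also have "\<dots> = emeasure (density (gaussian_measure 0 P) (\<lambda>x. \<integral>\<^sup>+ y. f y \<partial>?\<gamma> x)) X"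
        by (subst emeasure_density) (simp_all add: mult.commute)
      finally show "emeasure (density (gaussian_measure 0 P) (\<lambda>x. \<integral>\<^sup>+ y. f y \<partial>\<kappa> x)) X =
        emeasure (density (gaussian_measure 0 P) (\<lambda>x. \<integral>\<^sup>+ y. f y \<partial>?\<gamma> x)) X" .
    qed simp
    then have "AE x in gaussian_measure 0 P. (\<integral>\<^sup>+ y. f y \<partial>\<kappa> x) = (\<integral>\<^sup>+ y. f y \<partial>?\<gamma> x)"
      by (subst (asm) P.density_unique_iff) simp_all
    then have "AE x in gaussian_measure 0 P. integral\<^sup>L (\<kappa> x) f = integral\<^sup>L (?\<gamma> x) f"
    proof eventually_elim
      case (elim x)
      then show ?case
        unfolding nn[OF \<kappa>x] nn[OF \<gamma>x sets_gaussian_measure] using f(2) by (simp add: integral_nonneg_AE)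
    qed
    \<comment> \<open>The Gaussian density is strictly positive, so its null sets are Lebesgue null.
      A closed set of full Lebesgue measure is the whole space, which upgrades the equality to every
      x.\<close>
    then have "AE x in lborel. integral\<^sup>L (\<kappa> x) f = integral\<^sup>L (?\<gamma> x) f"
      unfolding gaussian_measure_def[of 0 P]
      using pos_def_matrix_det[OF blk(2)] by (subst (asm) AE_density) auto
    then have ae: "AE x in lebesgue. x \<in> {x. integral\<^sup>L (\<kappa> x) f = integral\<^sup>L (?\<gamma> x) f}"
      by (simp add: AE_completion)
    have "continuous_on UNIV (\<lambda>x. integral\<^sup>L (\<kappa> x) f)"
      by (rule weakly_converges_isCont[OF _ f(1) bf]) (use \<kappa> in \<open>simp add: conditional_law_def\<close>)
    moreover have "continuous_on UNIV (\<lambda>x. integral\<^sup>L (?\<gamma> x) f)"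
    proof (rule weakly_converges_isCont[OF _ f(1) bf])
      fix x
      have "((\<lambda>y. ?H *v y) \<longlongrightarrow> ?H *v x) (at x)"
        by (intro bounded_linear.tendsto[OF matrix_vector_mul_bounded_linear] tendsto_ident_at)
      from gaussian_weakly_converges[OF this tendsto_const blk(3,3) refl]
      show "weakly_converges ?\<gamma> (?\<gamma> x) (at x)" .
    qed
    ultimately have "closed {x. integral\<^sup>L (\<kappa> x) f = integral\<^sup>L (?\<gamma> x) f}"
      by (rule closed_Collect_eq)
    from mem_closed_if_AE_lebesgue[OF this ae] show "integral\<^sup>L (\<kappa> x) f = integral\<^sup>L (?\<gamma> x) f" by simp
  qed
qed

lemma slow_fast_conditional_law:
  fixes W1 :: "real \<Rightarrow> 'w \<Rightarrow> real^'m" and W2 :: "real \<Rightarrow> 'w \<Rightarrow> real^'n"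
    and B A :: "real^('m + 'n)^('m + 'n)"
  assumes W: "brownian_motion M W1" "brownian_motion M W2" "independent_processes M W1 W2"
    and inv: "invariant_measure M (\<lambda>t \<omega>. join_vec (W1 t \<omega>) (W2 t \<omega>)) B A \<mu>"
    and B: "hurwitz B" "controllable B A" and \<kappa>: "conditional_law \<mu> \<kappa>"
  shows "\<exists>P Q R S. lyapunov_solution B A (block_matrix P Q R S) \<and>
    (\<forall>x. \<kappa> x = gaussian_measure ((R ** matrix_inv P) *v x) (S - R ** matrix_inv P ** Q))"
proof -
  obtain K where K: "lyapunov_solution B A K" using lyapunov_solution_exists_unique[OF B] by blast
  obtain P Q R S where blk: "K = block_matrix P Q R S" by (rule block_matrix_exhaust)
  have "\<mu> = gaussian_measure 0 K" by (rule invariant_measure_gaussian[OF W inv B(1) K])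
  then have "\<kappa> x = gaussian_measure ((R ** matrix_inv P) *v x) (S - R ** matrix_inv P ** Q)" for x
    using K \<kappa> conditional_law_gaussian[of P Q R S \<kappa> x] by (simp add: blk lyapunov_solution_def)
  with K show ?thesis unfolding blk by blast
qed

theorem proposition3p9:
  fixes B11 A11 :: "real^'nx^'nx"
    and B12 :: "real^'ny^'nx"
    and B21 :: "real^'nx^'ny"
    and B22 A22 :: "real^'ny^'ny"
    and B A :: "real \<Rightarrow> real^('nx + 'ny)^('nx + 'ny)"
    and M :: "'w measure"
    and W1 :: "real \<Rightarrow> 'w \<Rightarrow> real^'nx"
    and W2 :: "real \<Rightarrow> 'w \<Rightarrow> real^'ny"
    and \<mu> :: "real \<Rightarrow> (real^('nx + 'ny)) measure"
    and \<mu>bar :: "real \<Rightarrow> real^'nx \<Rightarrow> (real^'ny) measure"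
  defines "B \<equiv> \<lambda>\<epsilon>. block_matrix B11 B12 ((1 / \<epsilon>) *\<^sub>R B21) ((1 / \<epsilon>) *\<^sub>R B22)"
    and "A \<equiv> \<lambda>\<epsilon>. block_matrix A11 0 0 ((1 / sqrt \<epsilon>) *\<^sub>R A22)"
  assumes W1: "brownian_motion M W1"
    and W2: "brownian_motion M W2"
    and indep: "independent_processes M W1 W2"
    and hurwitz_B: "\<And>\<epsilon>. \<epsilon> > 0 \<Longrightarrow> hurwitz (B \<epsilon>)"
    and controllable_BA: "\<And>\<epsilon>. \<epsilon> > 0 \<Longrightarrow> controllable (B \<epsilon>) (A \<epsilon>)"
    and invariant: "\<And>\<epsilon>. \<epsilon> > 0 \<Longrightarrow>
      invariant_measure M (\<lambda>t \<omega>. join_vec (W1 t \<omega>) (W2 t \<omega>)) (B \<epsilon>) (A \<epsilon>) (\<mu> \<epsilon>)"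
    and conditional: "\<And>\<epsilon>. \<epsilon> > 0 \<Longrightarrow> conditional_law (\<mu> \<epsilon>) (\<mu>bar \<epsilon>)"
    and hurwitz_B22: "hurwitz B22"
    and controllable_22: "controllable B22 A22"
    and hurwitz_eff: "hurwitz (B11 - B12 ** matrix_inv B22 ** B21)"
    and controllable_eff: "controllable (B11 - B12 ** matrix_inv B22 ** B21) A11"
  shows "\<exists>\<Sigma>. lyapunov_solution B22 A22 \<Sigma> \<and>
    (\<forall>\<Sigma>'. lyapunov_solution B22 A22 \<Sigma>' \<longrightarrow> \<Sigma>' = \<Sigma>) \<and>
    (\<forall>x. weakly_converges (\<lambda>\<epsilon>. \<mu>bar \<epsilon> x)
           (gaussian_measure (- (matrix_inv B22 ** B21 *v x)) \<Sigma>) (at_right 0) \<and>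
         (\<exists>m C. (\<forall>\<epsilon>>0. pos_def_matrix (C \<epsilon>) \<and> \<mu>bar \<epsilon> x = gaussian_measure (m \<epsilon>) (C \<epsilon>)) \<and>
           (m \<longlongrightarrow> - (matrix_inv B22 ** B21 *v x)) (at_right 0) \<and>
           (C \<longlongrightarrow> \<Sigma>) (at_right 0)))"
proof -
  obtain \<Sigma> where \<Sigma>: "lyapunov_solution B22 A22 \<Sigma>" and uniq: "\<forall>\<Sigma>'. lyapunov_solution B22 A22 \<Sigma>' \<longrightarrow> \<Sigma>' = \<Sigma>"
    using lyapunov_solution_exists_unique[OF hurwitz_B22 controllable_22] by blast
  obtain P0 where P0: "lyapunov_solution (B11 - B12 ** matrix_inv B22 ** B21) A11 P0"
    using lyapunov_solution_exists_unique[OF hurwitz_eff controllable_eff] by blast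
  \<comment> \<open>The implication stands inside the existential so that choice yields blocks as
    total functions of \<epsilon>.\<close>
  have "\<forall>\<epsilon>. \<exists>P Q R S. \<epsilon> > 0 \<longrightarrow> lyapunov_solution (B \<epsilon>) (A \<epsilon>) (block_matrix P Q R S) \<and>
      (\<forall>x. \<mu>bar \<epsilon> x = gaussian_measure ((R ** matrix_inv P) *v x) (S - R ** matrix_inv P ** Q))"
    using slow_fast_conditional_law[OF W1 W2 indep invariant hurwitz_B controllable_BA conditional] by blast
  then obtain P Q R S where lyap: "\<And>\<epsilon>. \<epsilon> > 0 \<Longrightarrow> lyapunov_solution (B \<epsilon>) (A \<epsilon>) (block_matrix (P \<epsilon>) (Q \<epsilon>) (R \<epsilon>) (S \<epsilon>))"
    and law: "\<And>\<epsilon> x. \<epsilon> > 0 \<Longrightarrow> \<mu>bar \<epsilon> x =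
      gaussian_measure ((R \<epsilon> ** matrix_inv (P \<epsilon>)) *v x) (S \<epsilon> - R \<epsilon> ** matrix_inv (P \<epsilon>) ** Q \<epsilon>)"
    by metis
  have pd: "pos_def_matrix (S \<epsilon> - R \<epsilon> ** matrix_inv (P \<epsilon>) ** Q \<epsilon>)" if "\<epsilon> > 0" for \<epsilon>
    using lyap[OF that] by (intro pos_def_block(3)) (simp add: lyapunov_solution_def)
  have inv0: "invertible P0" using P0 by (simp add: lyapunov_solution_def pos_def_matrix_invertible)
  have lims: "(P \<longlongrightarrow> P0) (at_right 0)" "(Q \<longlongrightarrow> P0 ** transpose (- (matrix_inv B22 ** B21))) (at_right 0)"
    "(R \<longlongrightarrow> - (matrix_inv B22 ** B21) ** P0) (at_right 0)"
    "(S \<longlongrightarrow> - (matrix_inv B22 ** B21) ** P0 ** transpose (- (matrix_inv B22 ** B21)) + \<Sigma>) (at_right 0)"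
    using slow_fast_covariance_limit[OF hurwitz_B22 hurwitz_eff, of P Q R S A11 A22 P0 \<Sigma>] lyap P0 \<Sigma>
    unfolding lyapunov_solution_def B_def A_def by blast+
  note par = conditional_parameters_limit[OF lims inv0]
  have mean: "((\<lambda>\<epsilon>. (R \<epsilon> ** matrix_inv (P \<epsilon>)) *v x) \<longlongrightarrow> - (matrix_inv B22 ** B21 *v x)) (at_right 0)" for x
    using bounded_linear.tendsto[OF bounded_bilinear.bounded_linear_left[OF bounded_bilinear_matrix_vector] par(1), of x]
    by (simp add: bounded_bilinear.minus_left[OF bounded_bilinear_matrix_vector])
  have \<Sigma>pd: "pos_def_matrix \<Sigma>" using \<Sigma> by (simp add: lyapunov_solution_def)
  show ?thesis
  proof (intro exI[of _ \<Sigma>] conjI allI)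
    show "lyapunov_solution B22 A22 \<Sigma>" by (rule \<Sigma>)
    show "lyapunov_solution B22 A22 \<Sigma>' \<longrightarrow> \<Sigma>' = \<Sigma>" for \<Sigma>' using uniq by blast
    fix x
    show "weakly_converges (\<lambda>\<epsilon>. \<mu>bar \<epsilon> x) (gaussian_measure (- (matrix_inv B22 ** B21 *v x)) \<Sigma>) (at_right 0)"
      by (rule gaussian_weakly_converges[OF mean[of x] par(2) \<Sigma>pd]) (simp_all add: pd law)
    show "\<exists>m C. (\<forall>\<epsilon>>0. pos_def_matrix (C \<epsilon>) \<and> \<mu>bar \<epsilon> x = gaussian_measure (m \<epsilon>) (C \<epsilon>)) \<and>
           (m \<longlongrightarrow> - (matrix_inv B22 ** B21 *v x)) (at_right 0) \<and> (C \<longlongrightarrow> \<Sigma>) (at_right 0)"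
      using mean[of x] par(2) pd law by (intro exI conjI allI impI) auto
  qed
qed

end
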